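(* Let $G$ be a finite group whose order $|G|$ is square-free. Then for all subgroups $H, J \subset G$ and all integers $l \geq 1$ there is an isomorphism of $A(G)$-modules \[ \operatorname{Ext}^l_{A(G)}(\mathbb{Z}_H, \mathbb{Z}_J) \simeq \operatorname{Ext}^{l+2}_{A(G)}(\mathbb{Z}_H, \mathbb{Z}_J). \]
   Context: For a finite group $G$, the Burnside ring $A(G)$ is the Grothendieck ring of the commutative semi-ring of isomorphism classes of finite $G$-sets, with addition given by disjoint union and multiplication by cartesian product; $[X]$ denotes the class of a finite $G$-set $X$. For a subgroup $H \subset G$, the mark homomorphism $\pi_H : A(G) \to \mathbb{Z}$ is the ring homomorphism determined by $\pi_H([X]) = |X^H|$, where $X^H$ is the set of $H$-fixed points of the finite $G$-set $X$. $\mathbb{Z}_H$ denotes the $A(G)$-module with underlying abelian group $\mathbb{Z}$ and action $a\cdot n = \pi_H(a)n$. Since $A(G)$ is commutative, each $\operatorname{Ext}^l_{A(G)}(M,N)$ is naturally an $A(G)$-module. *)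

theory Defs
  imports
    "HOL-Library.FSet"
    "HOL-Computational_Algebra.Squarefree"
    "HOL-Algebra.Group_Action"
    "HOL-Algebra.Module"
    "HOL-Algebra.IntRing"
begin

section \<open>Finite G-sets\<close>

type_synonym ('g, 'x) gset = "'x set \<times> ('g \<Rightarrow> 'x \<Rightarrow> 'x)"

definition finite_gset :: "('g, 'k) monoid_scheme \<Rightarrow> ('g, 'x) gset \<Rightarrow> bool" where
  "finite_gset G X \<longleftrightarrow> finite (fst X) \<and> group_action G (fst X) (snd X)"

definition gset_iso ::
  "('g, 'k) monoid_scheme \<Rightarrow> ('g, 'x) gset \<Rightarrow> ('g, 'y) gset \<Rightarrow> bool" where
  "gset_iso G X Y \<longleftrightarrow> (\<exists>f. bij_betw f (fst X) (fst Y) \<and>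
     (\<forall>g \<in> carrier G. \<forall>x \<in> fst X. f (snd X g x) = snd Y g (f x)))"

text \<open>The restrictions are needed because \<^const>\<open>group_action\<close> asks for extensional permutations.\<close>

definition gset_sum :: "('g, 'x) gset \<Rightarrow> ('g, 'y) gset \<Rightarrow> ('g, 'x + 'y) gset" where
  "gset_sum X Y = (Sum_Type.Plus (fst X) (fst Y),
     \<lambda>g. restrict (map_sum (snd X g) (snd Y g)) (Sum_Type.Plus (fst X) (fst Y)))"

definition gset_prod :: "('g, 'x) gset \<Rightarrow> ('g, 'y) gset \<Rightarrow> ('g, 'x \<times> 'y) gset" where
  "gset_prod X Y = (fst X \<times> fst Y,
     \<lambda>g. restrict (map_prod (snd X g) (snd Y g)) (fst X \<times> fst Y))"

definition gset_empty :: "('g, 'x) gset" where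
  "gset_empty = ({}, \<lambda>g. restrict id {})"

definition gset_point :: "('g, unit) gset" where
  "gset_point = ({()}, \<lambda>g. restrict id {()})"

definition fixed_points :: "'g set \<Rightarrow> ('g, 'x) gset \<Rightarrow> 'x set" where
  "fixed_points H X = {x \<in> fst X. \<forall>h \<in> H. snd X h x = x}"


section \<open>The Grothendieck ring of a commutative semiring\<close>

definition groth_rel :: "('s, 'k) ring_scheme \<Rightarrow> (('s \<times> 's) \<times> ('s \<times> 's)) set" where
  "groth_rel S = {((a, b), (c, d)) | a b c d.
     {a, b, c, d} \<subseteq> carrier S \<and>
     (\<exists>k \<in> carrier S. a \<oplus>\<^bsub>S\<^esub> d \<oplus>\<^bsub>S\<^esub> k = c \<oplus>\<^bsub>S\<^esub> b \<oplus>\<^bsub>S\<^esub> k)}"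

text \<open>The formal difference of \<open>a\<close> and \<open>b\<close>.\<close>

definition groth_diff :: "('s, 'k) ring_scheme \<Rightarrow> 's \<Rightarrow> 's \<Rightarrow> ('s \<times> 's) set" where
  "groth_diff S a b = groth_rel S `` {(a, b)}"

definition groth_ring :: "('s, 'k) ring_scheme \<Rightarrow> ('s \<times> 's) set ring" where
  "groth_ring S =
    \<lparr>carrier = (carrier S \<times> carrier S) // groth_rel S,
     mult = (\<lambda>P Q. \<Union>(a, b) \<in> P. \<Union>(c, d) \<in> Q.
       groth_diff S (a \<otimes>\<^bsub>S\<^esub> c \<oplus>\<^bsub>S\<^esub> b \<otimes>\<^bsub>S\<^esub> d) (a \<otimes>\<^bsub>S\<^esub> d \<oplus>\<^bsub>S\<^esub> b \<otimes>\<^bsub>S\<^esub> c)),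
     one = groth_diff S \<one>\<^bsub>S\<^esub> \<zero>\<^bsub>S\<^esub>,
     zero = groth_diff S \<zero>\<^bsub>S\<^esub> \<zero>\<^bsub>S\<^esub>,
     add = (\<lambda>P Q. \<Union>(a, b) \<in> P. \<Union>(c, d) \<in> Q.
       groth_diff S (a \<oplus>\<^bsub>S\<^esub> c) (b \<oplus>\<^bsub>S\<^esub> d))\<rparr>"


section \<open>The Burnside ring and the mark homomorphisms\<close>

text \<open>
  Every finite G-set is isomorphic to one whose underlying set consists of natural numbers, so
  the isomorphism class of a finite G-set, over whatever type it lives, is represented by the set
  of its isomorphic copies on subsets of \<^typ>\<open>nat\<close>.
\<close>

definition gset_class ::
  "('g, 'k) monoid_scheme \<Rightarrow> ('g, 'x) gset \<Rightarrow> ('g, nat) gset set" where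
  "gset_class G X = {Y. finite_gset G Y \<and> gset_iso G X Y}"

definition gset_semiring :: "('g, 'k) monoid_scheme \<Rightarrow> ('g, nat) gset set ring" where
  "gset_semiring G =
    \<lparr>carrier = {gset_class G X | X :: ('g, nat) gset. finite_gset G X},
     mult = (\<lambda>A B. \<Union>X \<in> A. \<Union>Y \<in> B. gset_class G (gset_prod X Y)),
     one = gset_class G gset_point,
     zero = gset_class G (gset_empty :: ('g, nat) gset),
     add = (\<lambda>A B. \<Union>X \<in> A. \<Union>Y \<in> B. gset_class G (gset_sum X Y))\<rparr>"

type_synonym 'g burnside = "(('g, nat) gset set \<times> ('g, nat) gset set) set"

definition burnside_ring :: "('g, 'k) monoid_scheme \<Rightarrow> 'g burnside ring" where
  "burnside_ring G = groth_ring (gset_semiring G)"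

definition burnside_class :: "('g, 'k) monoid_scheme \<Rightarrow> ('g, 'x) gset \<Rightarrow> 'g burnside" where
  "burnside_class G X = groth_diff (gset_semiring G) (gset_class G X) \<zero>\<^bsub>gset_semiring G\<^esub>"

text \<open>
  Every element of the Burnside ring is a difference of classes of finite G-sets, which determines
  the mark homomorphism; see \<open>mark_diff\<close>, \<open>mark_class\<close> and \<open>mark_ring_hom\<close> below.
\<close>

definition mark :: "('g, 'k) monoid_scheme \<Rightarrow> 'g set \<Rightarrow> 'g burnside \<Rightarrow> int" where
  "mark G H a = (THE n. \<exists>(X :: ('g, nat) gset) (Y :: ('g, nat) gset). finite_gset G X \<and> finite_gset G Y \<and>
     a = groth_diff (gset_semiring G) (gset_class G X) (gset_class G Y) \<and>
     n = int (card (fixed_points H X)) - int (card (fixed_points H Y)))"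

definition mark_module ::
  "('g, 'k) monoid_scheme \<Rightarrow> 'g set \<Rightarrow> ('g burnside, int) module" where
  "mark_module G H =
    \<lparr>carrier = UNIV, mult = (*), one = 1, zero = 0, add = (+),
     smult = (\<lambda>a n. mark G H a * n)\<rparr>"


section \<open>Module homomorphisms and quotients\<close>

text \<open>
  Homomorphisms are extensional, so that they form a module under pointwise operations.  The
  fields \<open>mult\<close> and \<open>one\<close> that records of type \<open>module\<close> inherit from rings play no role for
  modules and are left unspecified in the constructions below.
\<close>

definition module_hom ::
  "('r, 'k) ring_scheme \<Rightarrow> ('r, 'm, 'p) module_scheme \<Rightarrow> ('r, 'n, 'q) module_scheme
     \<Rightarrow> ('m \<Rightarrow> 'n) set" where
  "module_hom R M N = {f \<in> carrier M \<rightarrow>\<^sub>E carrier N.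
     (\<forall>x \<in> carrier M. \<forall>y \<in> carrier M. f (x \<oplus>\<^bsub>M\<^esub> y) = f x \<oplus>\<^bsub>N\<^esub> f y) \<and>
     (\<forall>r \<in> carrier R. \<forall>x \<in> carrier M. f (r \<odot>\<^bsub>M\<^esub> x) = r \<odot>\<^bsub>N\<^esub> f x)}"

definition module_iso ::
  "('r, 'k) ring_scheme \<Rightarrow> ('r, 'm, 'p) module_scheme \<Rightarrow> ('r, 'n, 'q) module_scheme
     \<Rightarrow> bool" where
  "module_iso R M N \<longleftrightarrow> (\<exists>f \<in> module_hom R M N. bij_betw f (carrier M) (carrier N))"

definition Hom_module ::
  "('r, 'k) ring_scheme \<Rightarrow> ('r, 'm, 'p) module_scheme \<Rightarrow> ('r, 'n, 'q) module_scheme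
     \<Rightarrow> ('r, 'm \<Rightarrow> 'n) module" where
  "Hom_module R M N =
    \<lparr>carrier = module_hom R M N, mult = undefined, one = undefined,
     zero = (\<lambda>x \<in> carrier M. \<zero>\<^bsub>N\<^esub>),
     add = (\<lambda>f g. \<lambda>x \<in> carrier M. f x \<oplus>\<^bsub>N\<^esub> g x),
     smult = (\<lambda>r f. \<lambda>x \<in> carrier M. r \<odot>\<^bsub>N\<^esub> f x)\<rparr>"

definition quotient_module :: "('r, 'm, 'p) module_scheme \<Rightarrow> 'm set \<Rightarrow> ('r, 'm set) module" where
  "quotient_module M U =
    \<lparr>carrier = a_rcosets\<^bsub>M\<^esub> U, mult = undefined, one = undefined,
     zero = U,
     add = set_add M,
     smult = (\<lambda>r C. \<Union>x \<in> C. U +>\<^bsub>M\<^esub> (r \<odot>\<^bsub>M\<^esub> x))\<rparr>"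


section \<open>Free modules and the standard free resolution\<close>

text \<open>Finitely supported functions; \<open>B\<close> indexes the basis.\<close>

definition free_module :: "('r, 'k) ring_scheme \<Rightarrow> 'b set \<Rightarrow> ('r, 'b \<Rightarrow> 'r) module" where
  "free_module R B =
    \<lparr>carrier = {f. range f \<subseteq> carrier R \<and> finite {b. f b \<noteq> \<zero>\<^bsub>R\<^esub>} \<and> {b. f b \<noteq> \<zero>\<^bsub>R\<^esub>} \<subseteq> B},
     mult = undefined, one = undefined,
     zero = (\<lambda>b. \<zero>\<^bsub>R\<^esub>),
     add = (\<lambda>f g b. f b \<oplus>\<^bsub>R\<^esub> g b),
     smult = (\<lambda>r f b. r \<otimes>\<^bsub>R\<^esub> f b)\<rparr>"

definition free_unit :: "('r, 'k) ring_scheme \<Rightarrow> 'b \<Rightarrow> 'b \<Rightarrow> 'r" where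
  "free_unit R b = (\<lambda>c. if c = b then \<one>\<^bsub>R\<^esub> else \<zero>\<^bsub>R\<^esub>)"

text \<open>The linear map with \<open>b \<mapsto> h b\<close> on basis elements.\<close>

definition free_lift ::
  "('r, 'k) ring_scheme \<Rightarrow> ('r, 'm, 'p) module_scheme \<Rightarrow> ('b \<Rightarrow> 'm) \<Rightarrow> ('b \<Rightarrow> 'r) \<Rightarrow> 'm" where
  "free_lift R M h f = (\<Oplus>\<^bsub>M\<^esub> b \<in> {b. f b \<noteq> \<zero>\<^bsub>R\<^esub>}. f b \<odot>\<^bsub>M\<^esub> h b)"

text \<open>
  The standard free resolution of \<open>M\<close>: \<open>F\<^sub>0\<close> is free on the set \<open>M\<close>, with augmentation
  \<open>F\<^sub>0 \<rightarrow> M\<close>, and \<open>F\<^sub>n\<^sub>+\<^sub>1\<close> is free on the set of all \<open>n\<close>-cycles, that is, on the kernel of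
  \<open>F\<^sub>n \<rightarrow> F\<^sub>n\<^sub>-\<^sub>1\<close> (of the augmentation if \<open>n = 0\<close>).  For all \<open>F\<^sub>n\<close> to have the same type, the
  generators are taken from a datatype in which a cycle, being a finitely supported function
  on generators, is represented by the graph of its restriction to its support.  Exactness is
  proved in \<open>standard_resolution\<close> below.
\<close>

datatype ('r, 'm) generator = Elem 'm | Cycle "(('r, 'm) generator \<times> 'r) fset"

definition cycle_generator ::
  "('r, 'k) ring_scheme \<Rightarrow> (('r, 'm) generator \<Rightarrow> 'r) \<Rightarrow> ('r, 'm) generator" where
  "cycle_generator R z = Cycle (Abs_fset {(b, z b) | b. z b \<noteq> \<zero>\<^bsub>R\<^esub>})"

fun generator_elem :: "('r, 'm) generator \<Rightarrow> 'm" where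
  "generator_elem (Elem m) = m"
| "generator_elem (Cycle _) = undefined"

fun generator_cycle ::
  "('r, 'k) ring_scheme \<Rightarrow> ('r, 'm) generator \<Rightarrow> (('r, 'm) generator \<Rightarrow> 'r)" where
  "generator_cycle R (Cycle S) =
     (\<lambda>b. if \<exists>r. (b, r) |\<in>| S then THE r. (b, r) |\<in>| S else \<zero>\<^bsub>R\<^esub>)"
| "generator_cycle R (Elem _) = undefined"

definition res_augmentation ::
  "('r, 'k) ring_scheme \<Rightarrow> ('r, 'm, 'p) module_scheme \<Rightarrow> (('r, 'm) generator \<Rightarrow> 'r) \<Rightarrow> 'm" where
  "res_augmentation R M = free_lift R M generator_elem"

definition res_boundary ::
  "('r, 'k) ring_scheme \<Rightarrow> (('r, 'm) generator \<Rightarrow> 'r) \<Rightarrow> (('r, 'm) generator \<Rightarrow> 'r)" where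
  "res_boundary R = free_lift R (free_module R UNIV) (generator_cycle R)"

primrec res_basis ::
  "('r, 'k) ring_scheme \<Rightarrow> ('r, 'm, 'p) module_scheme \<Rightarrow> nat \<Rightarrow> ('r, 'm) generator set" where
  "res_basis R M 0 = Elem ` carrier M"
| "res_basis R M (Suc n) = cycle_generator R ` {z \<in> carrier (free_module R (res_basis R M n)).
     case n of 0 \<Rightarrow> res_augmentation R M z = \<zero>\<^bsub>M\<^esub>
             | Suc _ \<Rightarrow> res_boundary R z = (\<lambda>b. \<zero>\<^bsub>R\<^esub>)}"

definition res_module ::
  "('r, 'k) ring_scheme \<Rightarrow> ('r, 'm, 'p) module_scheme \<Rightarrow> nat
     \<Rightarrow> ('r, ('r, 'm) generator \<Rightarrow> 'r) module" where
  "res_module R M n = free_module R (res_basis R M n)"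


section \<open>Ext\<close>

text \<open>\<open>Ext R l M N\<close> is the \<open>l\<close>-th cohomology module of the cochain complex \<open>Hom(F\<^sub>\<bullet>, N)\<close>.\<close>

definition ext_cocycles ::
  "('r, 'k) ring_scheme \<Rightarrow> nat \<Rightarrow> ('r, 'm, 'p) module_scheme \<Rightarrow> ('r, 'n, 'q) module_scheme
     \<Rightarrow> ((('r, 'm) generator \<Rightarrow> 'r) \<Rightarrow> 'n) set" where
  "ext_cocycles R l M N = {f \<in> module_hom R (res_module R M l) N.
     \<forall>x \<in> carrier (res_module R M (Suc l)). f (res_boundary R x) = \<zero>\<^bsub>N\<^esub>}"

fun ext_coboundaries ::
  "('r, 'k) ring_scheme \<Rightarrow> nat \<Rightarrow> ('r, 'm, 'p) module_scheme \<Rightarrow> ('r, 'n, 'q) module_scheme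
     \<Rightarrow> ((('r, 'm) generator \<Rightarrow> 'r) \<Rightarrow> 'n) set" where
  "ext_coboundaries R 0 M N = {\<lambda>x \<in> carrier (res_module R M 0). \<zero>\<^bsub>N\<^esub>}"
| "ext_coboundaries R (Suc l) M N =
     {\<lambda>x \<in> carrier (res_module R M (Suc l)). f (res_boundary R x) | f.
        f \<in> module_hom R (res_module R M l) N}"

definition Ext ::
  "('r, 'k) ring_scheme \<Rightarrow> nat \<Rightarrow> ('r, 'm, 'p) module_scheme \<Rightarrow> ('r, 'n, 'q) module_scheme
     \<Rightarrow> ('r, ((('r, 'm) generator \<Rightarrow> 'r) \<Rightarrow> 'n) set) module" where
  "Ext R l M N = quotient_module
     ((Hom_module R (res_module R M l) N)\<lparr>carrier := ext_cocycles R l M N\<rparr>)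
     (ext_coboundaries R l M N)"


section \<open>The Grothendieck ring is a ring\<close>

locale groth = semiring S + comm_monoid S for S (structure)
begin

lemma m_ac:
  "\<lbrakk>x \<in> carrier S; y \<in> carrier S; z \<in> carrier S\<rbrakk> \<Longrightarrow> x \<otimes> y \<otimes> z = x \<otimes> (y \<otimes> z)"
  "\<lbrakk>x \<in> carrier S; y \<in> carrier S\<rbrakk> \<Longrightarrow> x \<otimes> y = y \<otimes> x"
  "\<lbrakk>x \<in> carrier S; y \<in> carrier S; z \<in> carrier S\<rbrakk> \<Longrightarrow> x \<otimes> (y \<otimes> z) = y \<otimes> (x \<otimes> z)"
  by (auto simp: m_assoc m_comm m_lcomm)

lemma groth_rel_iff:
  "((a, b), (c, d)) \<in> groth_rel S \<longleftrightarrow> a \<in> carrier S \<and> b \<in> carrier S \<and> c \<in> carrier S \<and> d \<in> carrier S \<and>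
     (\<exists>k \<in> carrier S. a \<oplus> d \<oplus> k = c \<oplus> b \<oplus> k)"
  by (auto simp: groth_rel_def)

lemma groth_equiv: "equiv (carrier S \<times> carrier S) (groth_rel S)"
proof (rule equivI)
  show "groth_rel S \<subseteq> (carrier S \<times> carrier S) \<times> carrier S \<times> carrier S"
    by (auto simp: groth_rel_def)
  show "refl_on (carrier S \<times> carrier S) (groth_rel S)"
    by (auto simp: refl_on_def groth_rel_iff)
  show "sym (groth_rel S)"
    unfolding sym_def by (auto simp: groth_rel_iff) metis
  show "trans (groth_rel S)"
  proof (rule transI, clarify)
    fix a b c d e f
    assume "((a, b), (c, d)) \<in> groth_rel S" "((c, d), (e, f)) \<in> groth_rel S"
    then obtain k m where car: "a \<in> carrier S" "b \<in> carrier S" "c \<in> carrier S" "d \<in> carrier S"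
        "e \<in> carrier S" "f \<in> carrier S" "k \<in> carrier S" "m \<in> carrier S"
      and eq: "a \<oplus> d \<oplus> k = c \<oplus> b \<oplus> k" "c \<oplus> f \<oplus> m = e \<oplus> d \<oplus> m"
      by (auto simp: groth_rel_iff)
    have "a \<oplus> f \<oplus> (d \<oplus> k \<oplus> m) = (a \<oplus> d \<oplus> k) \<oplus> (f \<oplus> m)" using car by (simp add: a_ac)
    also have "\<dots> = (c \<oplus> f \<oplus> m) \<oplus> (b \<oplus> k)" unfolding eq(1) using car by (simp add: a_ac)
    also have "\<dots> = e \<oplus> b \<oplus> (d \<oplus> k \<oplus> m)" unfolding eq(2) using car by (simp add: a_ac)
    finally show "((a, b), (e, f)) \<in> groth_rel S"
      using car by (auto simp: groth_rel_iff)
  qed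
qed

lemma groth_diff_eq_iff:
  assumes "a \<in> carrier S" "b \<in> carrier S" "c \<in> carrier S" "d \<in> carrier S"
  shows "groth_diff S a b = groth_diff S c d \<longleftrightarrow> (\<exists>k \<in> carrier S. a \<oplus> d \<oplus> k = c \<oplus> b \<oplus> k)"
  using eq_equiv_class_iff[OF groth_equiv, of "(a, b)" "(c, d)"] assms
  by (simp add: groth_diff_def groth_rel_iff)

lemma groth_carrier:
  "carrier (groth_ring S) = {groth_diff S a b | a b. a \<in> carrier S \<and> b \<in> carrier S}"
  by (auto simp: groth_ring_def groth_diff_def quotient_def)

lemma groth_op:
  assumes car: "a \<in> carrier S" "b \<in> carrier S" "c \<in> carrier S" "d \<in> carrier S"
    and cong: "\<And>a' b' c' d'. ((a, b), (a', b')) \<in> groth_rel S \<Longrightarrow> ((c, d), (c', d')) \<in> groth_rel S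
      \<Longrightarrow> F a' b' c' d' = F a b c d"
  shows "(\<Union>(a, b) \<in> groth_diff S a b. \<Union>(c, d) \<in> groth_diff S c d. F a b c d) = F a b c d"
proof -
  have "(a, b) \<in> groth_diff S a b" "(c, d) \<in> groth_diff S c d"
    using car by (auto simp: groth_diff_def groth_rel_iff)
  moreover have "F a' b' c' d' = F a b c d" if "(a', b') \<in> groth_diff S a b" "(c', d') \<in> groth_diff S c d" for a' b' c' d'
    using that cong by (auto simp: groth_diff_def)
  ultimately show ?thesis by fast
qed

lemma groth_add:
  assumes car: "a \<in> carrier S" "b \<in> carrier S" "c \<in> carrier S" "d \<in> carrier S"
  shows "groth_diff S a b \<oplus>\<^bsub>groth_ring S\<^esub> groth_diff S c d = groth_diff S (a \<oplus> c) (b \<oplus> d)"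
  unfolding groth_ring_def ring_record_simps
proof (rule groth_op[OF car])
  fix a' b' c' d'
  assume "((a, b), (a', b')) \<in> groth_rel S" "((c, d), (c', d')) \<in> groth_rel S"
  then obtain k m where car': "a' \<in> carrier S" "b' \<in> carrier S" "c' \<in> carrier S" "d' \<in> carrier S"
      "k \<in> carrier S" "m \<in> carrier S"
    and eq: "a \<oplus> b' \<oplus> k = a' \<oplus> b \<oplus> k" "c \<oplus> d' \<oplus> m = c' \<oplus> d \<oplus> m"
    by (auto simp: groth_rel_iff)
  have "(a' \<oplus> c') \<oplus> (b \<oplus> d) \<oplus> (k \<oplus> m) = (a' \<oplus> b \<oplus> k) \<oplus> (c' \<oplus> d \<oplus> m)"
    using car car' by (simp add: a_ac)
  also have "\<dots> = (a \<oplus> c) \<oplus> (b' \<oplus> d') \<oplus> (k \<oplus> m)"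
    unfolding eq[symmetric] using car car' by (simp add: a_ac)
  finally show "groth_diff S (a' \<oplus> c') (b' \<oplus> d') = groth_diff S (a \<oplus> c) (b \<oplus> d)"
    using car car' by (subst groth_diff_eq_iff) auto
qed

lemma groth_mult_cong:
  assumes car: "a \<in> carrier S" "b \<in> carrier S" "c \<in> carrier S" "d \<in> carrier S" "a' \<in> carrier S" "b' \<in> carrier S"
    and k: "k \<in> carrier S" "a \<oplus> b' \<oplus> k = a' \<oplus> b \<oplus> k"
  shows "groth_diff S (a' \<otimes> c \<oplus> b' \<otimes> d) (a' \<otimes> d \<oplus> b' \<otimes> c)
    = groth_diff S (a \<otimes> c \<oplus> b \<otimes> d) (a \<otimes> d \<oplus> b \<otimes> c)"
proof -
  have "(a' \<otimes> c \<oplus> b' \<otimes> d) \<oplus> (a \<otimes> d \<oplus> b \<otimes> c) \<oplus> (k \<otimes> c \<oplus> k \<otimes> d)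
      = (a' \<oplus> b \<oplus> k) \<otimes> c \<oplus> (a \<oplus> b' \<oplus> k) \<otimes> d"
    using car k(1) by (simp add: l_distr a_ac)
  also have "\<dots> = (a \<oplus> b' \<oplus> k) \<otimes> c \<oplus> (a' \<oplus> b \<oplus> k) \<otimes> d"
    by (simp only: k(2))
  also have "\<dots> = (a \<otimes> c \<oplus> b \<otimes> d) \<oplus> (a' \<otimes> d \<oplus> b' \<otimes> c) \<oplus> (k \<otimes> c \<oplus> k \<otimes> d)"
    using car k(1) by (simp add: l_distr a_ac)
  finally show ?thesis
    using car k(1) by (subst groth_diff_eq_iff) auto
qed

lemma groth_mult:
  assumes car: "a \<in> carrier S" "b \<in> carrier S" "c \<in> carrier S" "d \<in> carrier S"
  shows "groth_diff S a b \<otimes>\<^bsub>groth_ring S\<^esub> groth_diff S c d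
    = groth_diff S (a \<otimes> c \<oplus> b \<otimes> d) (a \<otimes> d \<oplus> b \<otimes> c)"
  unfolding groth_ring_def ring_record_simps monoid_record_simps
proof (rule groth_op[OF car])
  fix a' b' c' d'
  assume "((a, b), (a', b')) \<in> groth_rel S" "((c, d), (c', d')) \<in> groth_rel S"
  then obtain k m where car': "a' \<in> carrier S" "b' \<in> carrier S" "c' \<in> carrier S" "d' \<in> carrier S"
      "k \<in> carrier S" "m \<in> carrier S"
    and eq: "a \<oplus> b' \<oplus> k = a' \<oplus> b \<oplus> k" "c \<oplus> d' \<oplus> m = c' \<oplus> d \<oplus> m"
    by (auto simp: groth_rel_iff)
  have "groth_diff S (a' \<otimes> c' \<oplus> b' \<otimes> d') (a' \<otimes> d' \<oplus> b' \<otimes> c')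
      = groth_diff S (a \<otimes> c' \<oplus> b \<otimes> d') (a \<otimes> d' \<oplus> b \<otimes> c')"
    using groth_mult_cong[of a b c' d' a' b' k] car car' eq by simp
  also have "\<dots> = groth_diff S (a \<otimes> c \<oplus> b \<otimes> d) (a \<otimes> d \<oplus> b \<otimes> c)"
    using groth_mult_cong[of c d a b c' d' m] car car' eq by (simp add: m_comm a_comm)
  finally show "groth_diff S (a' \<otimes> c' \<oplus> b' \<otimes> d') (a' \<otimes> d' \<oplus> b' \<otimes> c')
      = groth_diff S (a \<otimes> c \<oplus> b \<otimes> d) (a \<otimes> d \<oplus> b \<otimes> c)" .
qed

lemma groth_zero: "\<zero>\<^bsub>groth_ring S\<^esub> = groth_diff S \<zero> \<zero>"
  and groth_one: "\<one>\<^bsub>groth_ring S\<^esub> = groth_diff S \<one> \<zero>"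
  by (simp_all add: groth_ring_def)

lemma groth_diff_closed:
  "a \<in> carrier S \<Longrightarrow> b \<in> carrier S \<Longrightarrow> groth_diff S a b \<in> carrier (groth_ring S)"
  by (auto simp: groth_carrier)

lemma groth_cases:
  assumes "x \<in> carrier (groth_ring S)"
  obtains a b where "a \<in> carrier S" "b \<in> carrier S" "x = groth_diff S a b"
  using assms by (auto simp: groth_carrier)

lemma groth_ring_cring: "cring (groth_ring S)"
proof -
  let ?K = "groth_ring S"
  note [simp] = groth_add groth_mult groth_zero groth_one groth_diff_closed
  have ag: "abelian_group ?K"
  proof (rule abelian_groupI)
    fix x assume "x \<in> carrier ?K"
    then obtain a b where x: "a \<in> carrier S" "b \<in> carrier S" "x = groth_diff S a b"
      by (auto simp: groth_carrier)
    then have "groth_diff S b a \<oplus>\<^bsub>?K\<^esub> x = \<zero>\<^bsub>?K\<^esub>"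
      by (simp add: groth_diff_eq_iff) (auto simp: a_comm)
    then show "\<exists>y \<in> carrier ?K. y \<oplus>\<^bsub>?K\<^esub> x = \<zero>\<^bsub>?K\<^esub>"
      using x groth_diff_closed by blast
  qed (auto elim!: groth_cases simp: a_ac)
  have cm: "Group.comm_monoid ?K"
    by (rule comm_monoidI)
      (auto elim!: groth_cases simp: l_distr r_distr m_ac a_ac)
  show ?thesis
    by (rule cringI[OF ag cm]) (auto elim!: groth_cases simp: l_distr r_distr m_ac a_ac)
qed

end


section \<open>The Burnside ring is a ring and marks are ring homomorphisms\<close>

lemma group_action_closed:
  assumes "finite_gset G X" "g \<in> carrier G" "x \<in> fst X"
  shows "snd X g x \<in> fst X"
  using assms group_action.element_image unfolding finite_gset_def by metis

lemma group_action_intro: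
  assumes "Group.group G"
    and ext: "\<And>g. g \<in> carrier G \<Longrightarrow> \<phi> g \<in> extensional E"
    and cl: "\<And>g x. g \<in> carrier G \<Longrightarrow> x \<in> E \<Longrightarrow> \<phi> g x \<in> E"
    and one: "\<And>x. x \<in> E \<Longrightarrow> \<phi> \<one>\<^bsub>G\<^esub> x = x"
    and mult: "\<And>g h x. g \<in> carrier G \<Longrightarrow> h \<in> carrier G \<Longrightarrow> x \<in> E \<Longrightarrow> \<phi> (g \<otimes>\<^bsub>G\<^esub> h) x = \<phi> g (\<phi> h x)"
  shows "group_action G E \<phi>"
proof -
  interpret Group.group G by fact
  have bij: "\<phi> g \<in> Bij E" if g: "g \<in> carrier G" for g
  proof -
    have "bij_betw (\<phi> g) E E"
      by (rule bij_betw_byWitness[where f' = "\<phi> (inv\<^bsub>G\<^esub> g)"])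
        (use g cl in \<open>auto simp: mult[symmetric] one\<close>)
    then show ?thesis using ext[OF g] by (simp add: Bij_def)
  qed
  have "\<phi> (g \<otimes>\<^bsub>G\<^esub> h) = compose E (\<phi> g) (\<phi> h)" if "g \<in> carrier G" "h \<in> carrier G" for g h
    by (rule extensionalityI[of _ E]) (use that ext in \<open>auto simp: mult compose_def\<close>)
  then have "\<phi> \<in> hom G (BijGroup E)"
    using bij by (auto simp: hom_def BijGroup_def)
  then show ?thesis
    unfolding group_action_def group_hom_def group_hom_axioms_def
    using assms(1) group_BijGroup by blast
qed

lemma finite_gsetD:
  assumes "finite_gset G X"
  shows "Group.group G" "finite (fst X)" "x \<in> fst X \<Longrightarrow> snd X \<one>\<^bsub>G\<^esub> x = x"
    "g \<in> carrier G \<Longrightarrow> h \<in> carrier G \<Longrightarrow> x \<in> fst X \<Longrightarrow> snd X (g \<otimes>\<^bsub>G\<^esub> h) x = snd X g (snd X h x)"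
proof -
  interpret group_action G "fst X" "snd X"
    using assms by (simp add: finite_gset_def)
  show "Group.group G"
    using group_hom by (simp add: group_hom_def)
  show "finite (fst X)" using assms by (simp add: finite_gset_def)
  show "x \<in> fst X \<Longrightarrow> snd X \<one>\<^bsub>G\<^esub> x = x" by (metis id_eq_one restrict_apply')
  show "g \<in> carrier G \<Longrightarrow> h \<in> carrier G \<Longrightarrow> x \<in> fst X \<Longrightarrow> snd X (g \<otimes>\<^bsub>G\<^esub> h) x = snd X g (snd X h x)"
    by (rule composition_rule)
qed

lemma gset_constructions:
  assumes "finite_gset G X" "finite_gset G Y"
  shows finite_gset_sum: "finite_gset G (gset_sum X Y)"
    and finite_gset_prod: "finite_gset G (gset_prod X Y)"
proof -
  have one: "\<one>\<^bsub>G\<^esub> \<in> carrier G" and mult: "\<And>g h. g \<in> carrier G \<Longrightarrow> h \<in> carrier G \<Longrightarrow> g \<otimes>\<^bsub>G\<^esub> h \<in> carrier G"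
    using group.is_monoid[OF finite_gsetD(1)[OF assms(1)]] by (auto intro: monoid.one_closed monoid.m_closed)
  show "finite_gset G (gset_sum X Y)"
    unfolding finite_gset_def
  proof (rule conjI[OF _ group_action_intro[OF finite_gsetD(1)[OF assms(1)]]])
    show "finite (fst (gset_sum X Y))"
      using assms by (simp add: finite_gset_def gset_sum_def)
  qed (auto simp: gset_sum_def one mult finite_gsetD(3,4)[OF assms(1)] finite_gsetD(3,4)[OF assms(2)]
      group_action_closed[OF assms(1)] group_action_closed[OF assms(2)])
  show "finite_gset G (gset_prod X Y)"
    unfolding finite_gset_def
  proof (rule conjI[OF _ group_action_intro[OF finite_gsetD(1)[OF assms(1)]]])
    show "finite (fst (gset_prod X Y))"
      using assms by (simp add: finite_gset_def gset_prod_def)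
  qed (auto simp: gset_prod_def one mult finite_gsetD(3,4)[OF assms(1)] finite_gsetD(3,4)[OF assms(2)]
      group_action_closed[OF assms(1)] group_action_closed[OF assms(2)])
qed

lemma finite_gset_trivial:
  assumes "Group.group G"
  shows finite_gset_empty: "finite_gset G gset_empty" and finite_gset_point: "finite_gset G gset_point"
  using assms by (auto simp: finite_gset_def gset_empty_def gset_point_def intro!: group_action_intro)

lemma gset_isoI:
  assumes "bij_betw f (fst X) (fst Y)"
    "\<And>g x. g \<in> carrier G \<Longrightarrow> x \<in> fst X \<Longrightarrow> f (snd X g x) = snd Y g (f x)"
  shows "gset_iso G X Y"
  using assms unfolding gset_iso_def by blast

lemma gset_iso_refl: "gset_iso G X X"
  by (rule gset_isoI[of id]) auto

lemma gset_iso_trans: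
  assumes "gset_iso G X Y" "gset_iso G Y Z"
  shows "gset_iso G X Z"
proof -
  obtain f g where f: "bij_betw f (fst X) (fst Y)" "\<forall>a \<in> carrier G. \<forall>x \<in> fst X. f (snd X a x) = snd Y a (f x)"
    and g: "bij_betw g (fst Y) (fst Z)" "\<forall>a \<in> carrier G. \<forall>y \<in> fst Y. g (snd Y a y) = snd Z a (g y)"
    using assms unfolding gset_iso_def by metis
  show ?thesis
    by (rule gset_isoI[OF bij_betw_trans[OF f(1) g(1)]])
      (use f g bij_betw_apply[OF f(1)] in auto)
qed

lemma gset_iso_sym:
  assumes "finite_gset G X" "gset_iso G X Y"
  shows "gset_iso G Y X"
proof -
  obtain f where f: "bij_betw f (fst X) (fst Y)" "\<forall>g \<in> carrier G. \<forall>x \<in> fst X. f (snd X g x) = snd Y g (f x)"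
    using assms(2) unfolding gset_iso_def by metis
  show ?thesis
  proof (rule gset_isoI[OF bij_betw_inv_into[OF f(1)]])
    fix g y assume g: "g \<in> carrier G" and "y \<in> fst Y"
    then obtain x where x: "x \<in> fst X" "y = f x"
      using f(1) by (auto simp: bij_betw_def)
    have "snd X g x \<in> fst X"
      using group_action_closed[OF assms(1) g x(1)] .
    then have "inv_into (fst X) f (f (snd X g x)) = snd X g x"
      using bij_betw_inv_into_left[OF f(1)] by blast
    then show "inv_into (fst X) f (snd Y g y) = snd X g (inv_into (fst X) f y)"
      using f g x bij_betw_inv_into_left[OF f(1)] by simp
  qed
qed

lemma gset_nat_copy:
  fixes X :: "('g, 'x) gset"
  assumes "finite_gset G X"
  shows "\<exists>Y :: ('g, nat) gset. finite_gset G Y \<and> gset_iso G X Y"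
proof -
  obtain f :: "'x \<Rightarrow> nat" and E where f: "bij_betw f (fst X) E"
    using finite_imp_inj_to_nat_seg[OF finite_gsetD(2)[OF assms]] by (metis bij_betw_def)
  let ?k = "inv_into (fst X) f"
  define Y where "Y = (E, \<lambda>g. restrict (\<lambda>y. f (snd X g (?k y))) E)"
  have k: "?k y \<in> fst X" if "y \<in> E" for y
    using bij_betw_apply[OF bij_betw_inv_into[OF f] that] .
  have fE: "f x \<in> E" if "x \<in> fst X" for x
    using bij_betw_apply[OF f that] .
  have kf: "?k (f x) = x" if "x \<in> fst X" for x
    using bij_betw_inv_into_left[OF f that] .
  have fk: "f (?k y) = y" if "y \<in> E" for y
    using bij_betw_inv_into_right[OF f that] .
  have one: "\<one>\<^bsub>G\<^esub> \<in> carrier G" and mult: "\<And>g h. g \<in> carrier G \<Longrightarrow> h \<in> carrier G \<Longrightarrow> g \<otimes>\<^bsub>G\<^esub> h \<in> carrier G"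
    using group.is_monoid[OF finite_gsetD(1)[OF assms]] by (auto intro: monoid.one_closed monoid.m_closed)
  have "finite_gset G Y"
    unfolding finite_gset_def
  proof (rule conjI[OF _ group_action_intro[OF finite_gsetD(1)[OF assms]]])
    show "finite (fst Y)"
      using finite_gsetD(2)[OF assms] bij_betw_finite[OF f] by (simp add: Y_def)
  qed (auto simp: Y_def k fE kf fk one mult finite_gsetD(3,4)[OF assms] group_action_closed[OF assms])
  moreover have "gset_iso G X Y"
    by (rule gset_isoI[of f]) (auto simp: Y_def f fE kf)
  ultimately show ?thesis by blast
qed

lemma gset_class_eq_iff:
  assumes X: "finite_gset G X" and Y: "finite_gset G Y"
  shows "gset_class G X = gset_class G Y \<longleftrightarrow> gset_iso G X Y"
proof
  assume eq: "gset_class G X = gset_class G Y"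
  obtain Z :: "('a, nat) gset" where "finite_gset G Z" "gset_iso G X Z"
    using gset_nat_copy[OF X] by blast
  then have "Z \<in> gset_class G X" by (simp add: gset_class_def)
  moreover from this have "Z \<in> gset_class G Y" by (simp add: eq)
  ultimately have "gset_iso G X Z" "gset_iso G Y Z"
    by (simp_all add: gset_class_def)
  then show "gset_iso G X Y"
    using gset_iso_trans[OF _ gset_iso_sym[OF Y]] by blast
next
  assume iso: "gset_iso G X Y"
  then have "gset_iso G X Z \<longleftrightarrow> gset_iso G Y Z" for Z :: "(_, nat) gset"
    using gset_iso_trans[OF iso, of Z] gset_iso_trans[OF gset_iso_sym[OF X iso], of Z] by auto
  then show "gset_class G X = gset_class G Y"
    by (simp add: gset_class_def)
qed

lemma gset_class_closed:
  assumes X: "finite_gset G X"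
  shows "gset_class G X \<in> carrier (gset_semiring G)"
proof -
  obtain Z :: "('a, nat) gset" where "finite_gset G Z" "gset_iso G X Z"
    using gset_nat_copy[OF X] by blast
  then have "gset_class G X = gset_class G Z" "finite_gset G Z"
    using gset_class_eq_iff[OF X] by blast+
  then show ?thesis
    unfolding gset_semiring_def partial_object.simps by blast
qed

lemma bij_betw_map_sum:
  assumes f: "bij_betw f A A'" and h: "bij_betw h B B'"
  shows "bij_betw (map_sum f h) (Sum_Type.Plus A B) (Sum_Type.Plus A' B')"
proof (rule bij_betw_imageI)
  show "inj_on (map_sum f h) (Sum_Type.Plus A B)"
    by (rule inj_onI)
      (auto simp: inj_on_eq_iff[OF bij_betw_imp_inj_on[OF f]] inj_on_eq_iff[OF bij_betw_imp_inj_on[OF h]])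
  show "map_sum f h ` Sum_Type.Plus A B = Sum_Type.Plus A' B'"
    unfolding Plus_def image_Un image_image
    using bij_betw_imp_surj_on[OF f] bij_betw_imp_surj_on[OF h] by auto
qed

lemma gset_sum_cong:
  assumes "gset_iso G X X'" "gset_iso G Y Y'"
  shows "gset_iso G (gset_sum X Y) (gset_sum X' Y')"
proof -
  obtain f h where f: "bij_betw f (fst X) (fst X')" "\<forall>g \<in> carrier G. \<forall>x \<in> fst X. f (snd X g x) = snd X' g (f x)"
    and h: "bij_betw h (fst Y) (fst Y')" "\<forall>g \<in> carrier G. \<forall>x \<in> fst Y. h (snd Y g x) = snd Y' g (h x)"
    using assms unfolding gset_iso_def by metis
  show ?thesis
    by (rule gset_isoI[of "map_sum f h"])
      (use f h bij_betw_apply[OF f(1)] bij_betw_apply[OF h(1)] in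
        \<open>auto simp: gset_sum_def intro: bij_betw_map_sum\<close>)
qed

lemma gset_prod_cong:
  assumes "gset_iso G X X'" "gset_iso G Y Y'"
  shows "gset_iso G (gset_prod X Y) (gset_prod X' Y')"
proof -
  obtain f h where f: "bij_betw f (fst X) (fst X')" "\<forall>g \<in> carrier G. \<forall>x \<in> fst X. f (snd X g x) = snd X' g (f x)"
    and h: "bij_betw h (fst Y) (fst Y')" "\<forall>g \<in> carrier G. \<forall>x \<in> fst Y. h (snd Y g x) = snd Y' g (h x)"
    using assms unfolding gset_iso_def by metis
  show ?thesis
    by (rule gset_isoI[of "map_prod f h"])
      (use f h bij_betw_apply[OF f(1)] bij_betw_apply[OF h(1)] in
        \<open>auto simp: gset_prod_def intro: bij_betw_map_prod\<close>)
qed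

lemma gset_class_op:
  assumes "finite_gset G X" "finite_gset G Y"
    and cong: "\<And>X' Y'. finite_gset G X' \<Longrightarrow> finite_gset G Y' \<Longrightarrow> gset_iso G X X' \<Longrightarrow> gset_iso G Y Y' \<Longrightarrow>
      F X' Y' = C"
  shows "(\<Union>X \<in> gset_class G X. \<Union>Y \<in> gset_class G Y. F X Y) = C"
proof -
  obtain X' Y' where "X' \<in> gset_class G X" "Y' \<in> gset_class G Y"
    using gset_nat_copy[OF assms(1)] gset_nat_copy[OF assms(2)] by (auto simp: gset_class_def)
  moreover have "F X' Y' = C" if "X' \<in> gset_class G X" "Y' \<in> gset_class G Y" for X' Y'
    using that cong by (auto simp: gset_class_def)
  ultimately show ?thesis by blast
qed

lemma gset_class_add:
  assumes "finite_gset G X" "finite_gset G Y"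
  shows "gset_class G X \<oplus>\<^bsub>gset_semiring G\<^esub> gset_class G Y = gset_class G (gset_sum X Y)"
  unfolding gset_semiring_def ring_record_simps
proof (rule gset_class_op[OF assms])
  fix X' Y' :: "('a, nat) gset"
  assume "finite_gset G X'" "finite_gset G Y'" "gset_iso G X X'" "gset_iso G Y Y'"
  then show "gset_class G (gset_sum X' Y') = gset_class G (gset_sum X Y)"
    using gset_class_eq_iff[OF finite_gset_sum[OF assms] finite_gset_sum] gset_sum_cong by metis
qed

lemma gset_class_mult:
  assumes "finite_gset G X" "finite_gset G Y"
  shows "gset_class G X \<otimes>\<^bsub>gset_semiring G\<^esub> gset_class G Y = gset_class G (gset_prod X Y)"
  unfolding gset_semiring_def ring_record_simps monoid_record_simps
proof (rule gset_class_op[OF assms])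
  fix X' Y' :: "('a, nat) gset"
  assume "finite_gset G X'" "finite_gset G Y'" "gset_iso G X X'" "gset_iso G Y Y'"
  then show "gset_class G (gset_prod X' Y') = gset_class G (gset_prod X Y)"
    using gset_class_eq_iff[OF finite_gset_prod[OF assms] finite_gset_prod] gset_prod_cong by metis
qed

lemma gset_class_zero: "\<zero>\<^bsub>gset_semiring G\<^esub> = gset_class G (gset_empty :: ('g, nat) gset)"
  and gset_class_one: "\<one>\<^bsub>gset_semiring G\<^esub> = gset_class G gset_point"
  by (simp_all add: gset_semiring_def)

lemma gset_semiring_cases:
  assumes "A \<in> carrier (gset_semiring G)"
  obtains X :: "('g, nat) gset" where "finite_gset G X" "A = gset_class G X"
  using assms by (auto simp: gset_semiring_def)

lemma gset_sum_comm:
  assumes "finite_gset G X" "finite_gset G Y"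
  shows "gset_iso G (gset_sum X Y) (gset_sum Y X)"
proof (rule gset_isoI[of "case_sum Inr Inl"])
  show "bij_betw (case_sum Inr Inl) (fst (gset_sum X Y)) (fst (gset_sum Y X))"
    by (rule bij_betw_byWitness[where f' = "case_sum Inr Inl"]) (auto simp: gset_sum_def)
qed (auto simp: gset_sum_def assms[THEN group_action_closed])

lemma gset_sum_assoc:
  assumes "finite_gset G X" "finite_gset G Y" "finite_gset G Z"
  shows "gset_iso G (gset_sum (gset_sum X Y) Z) (gset_sum X (gset_sum Y Z))"
proof (rule gset_isoI[of "case_sum (case_sum Inl (Inr \<circ> Inl)) (Inr \<circ> Inr)"])
  show "bij_betw (case_sum (case_sum Inl (Inr \<circ> Inl)) (Inr \<circ> Inr))
      (fst (gset_sum (gset_sum X Y) Z)) (fst (gset_sum X (gset_sum Y Z)))"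
    by (rule bij_betw_byWitness[where f' = "case_sum (Inl \<circ> Inl) (case_sum (Inl \<circ> Inr) Inr)"])
      (auto simp: gset_sum_def)
qed (auto simp: gset_sum_def assms[THEN group_action_closed])

lemma gset_sum_empty:
  fixes X :: "('g, 'x) gset"
  assumes "finite_gset G X"
  shows "gset_iso G (gset_sum (gset_empty :: ('g, 'e) gset) X) X"
proof (rule gset_isoI[of "case_sum undefined id"])
  show "bij_betw (case_sum undefined id) (fst (gset_sum (gset_empty :: ('g, 'e) gset) X)) (fst X)"
    by (rule bij_betw_byWitness[where f' = Inr]) (auto simp: gset_sum_def gset_empty_def)
qed (auto simp: gset_sum_def gset_empty_def assms[THEN group_action_closed])

lemma gset_prod_comm:
  assumes "finite_gset G X" "finite_gset G Y"
  shows "gset_iso G (gset_prod X Y) (gset_prod Y X)"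
proof (rule gset_isoI[of prod.swap])
  show "bij_betw prod.swap (fst (gset_prod X Y)) (fst (gset_prod Y X))"
    by (rule bij_betw_byWitness[where f' = prod.swap]) (auto simp: gset_prod_def)
qed (auto simp: gset_prod_def assms[THEN group_action_closed])

lemma gset_prod_assoc:
  assumes "finite_gset G X" "finite_gset G Y" "finite_gset G Z"
  shows "gset_iso G (gset_prod (gset_prod X Y) Z) (gset_prod X (gset_prod Y Z))"
proof (rule gset_isoI[of "\<lambda>((x, y), z). (x, (y, z))"])
  show "bij_betw (\<lambda>((x, y), z). (x, (y, z)))
      (fst (gset_prod (gset_prod X Y) Z)) (fst (gset_prod X (gset_prod Y Z)))"
    by (rule bij_betw_byWitness[where f' = "\<lambda>(x, (y, z)). ((x, y), z)"]) (auto simp: gset_prod_def)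
qed (auto simp: gset_prod_def assms[THEN group_action_closed])

lemma gset_prod_point:
  assumes "finite_gset G X"
  shows "gset_iso G (gset_prod gset_point X) X"
proof (rule gset_isoI[of snd])
  show "bij_betw snd (fst (gset_prod gset_point X)) (fst X)"
    by (rule bij_betw_byWitness[where f' = "Pair ()"]) (auto simp: gset_prod_def gset_point_def)
qed (auto simp: gset_prod_def gset_point_def assms[THEN group_action_closed])

lemma gset_prod_empty:
  fixes X :: "('g, 'x) gset"
  shows "gset_iso G (gset_prod (gset_empty :: ('g, 'e) gset) X) (gset_empty :: ('g, 'f) gset)"
  by (rule gset_isoI[of undefined]) (auto simp: gset_prod_def gset_empty_def bij_betw_def)

lemma gset_distrib:
  assumes "finite_gset G X" "finite_gset G Y" "finite_gset G Z"
  shows "gset_iso G (gset_prod (gset_sum X Y) Z) (gset_sum (gset_prod X Z) (gset_prod Y Z))"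
proof (rule gset_isoI[of "\<lambda>(s, z). case_sum (\<lambda>x. Inl (x, z)) (\<lambda>y. Inr (y, z)) s"])
  show "bij_betw (\<lambda>(s, z). case_sum (\<lambda>x. Inl (x, z)) (\<lambda>y. Inr (y, z)) s)
      (fst (gset_prod (gset_sum X Y) Z)) (fst (gset_sum (gset_prod X Z) (gset_prod Y Z)))"
    by (rule bij_betw_byWitness[where f' =
          "case_sum (\<lambda>(x, z). (Inl x, z)) (\<lambda>(y, z). (Inr y, z))"])
      (auto simp: gset_prod_def gset_sum_def)
qed (auto simp: gset_prod_def gset_sum_def assms[THEN group_action_closed])

lemma groth_gset_semiring:
  assumes "Group.group G"
  shows "groth (gset_semiring G)"
proof -
  let ?S = "gset_semiring G"
  note simps = gset_class_add gset_class_mult gset_class_zero gset_class_one gset_class_closed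
    gset_class_eq_iff finite_gset_sum finite_gset_prod finite_gset_trivial[OF assms]
  have add: "abelian_monoid ?S"
    by (rule abelian_monoidI; (elim gset_semiring_cases)?;
        simp add: simps gset_sum_comm gset_sum_assoc gset_sum_empty)
  have mult: "Group.comm_monoid ?S"
    by (rule comm_monoidI; (elim gset_semiring_cases)?;
        simp add: simps gset_prod_comm gset_prod_assoc gset_prod_point)
  interpret M: Group.comm_monoid ?S by (rule mult)
  have l_distr: "(x \<oplus>\<^bsub>?S\<^esub> y) \<otimes>\<^bsub>?S\<^esub> z = x \<otimes>\<^bsub>?S\<^esub> z \<oplus>\<^bsub>?S\<^esub> y \<otimes>\<^bsub>?S\<^esub> z"
    if "x \<in> carrier ?S" "y \<in> carrier ?S" "z \<in> carrier ?S" for x y z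
    using that by (elim gset_semiring_cases) (simp add: simps gset_distrib)
  have l_null: "\<zero>\<^bsub>?S\<^esub> \<otimes>\<^bsub>?S\<^esub> x = \<zero>\<^bsub>?S\<^esub>" if "x \<in> carrier ?S" for x
    using that by (elim gset_semiring_cases) (simp add: simps gset_prod_empty)
  interpret A: abelian_monoid ?S by (rule add)
  have "semiring ?S"
  proof (intro semiring.intro semiring_axioms.intro add M.monoid_axioms)
    fix x y z assume c: "x \<in> carrier ?S" "y \<in> carrier ?S" "z \<in> carrier ?S"
    then show "z \<otimes>\<^bsub>?S\<^esub> (x \<oplus>\<^bsub>?S\<^esub> y) = z \<otimes>\<^bsub>?S\<^esub> x \<oplus>\<^bsub>?S\<^esub> z \<otimes>\<^bsub>?S\<^esub> y"
      using l_distr[of x y z] by (simp add: M.m_comm)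
  next
    fix x assume "x \<in> carrier ?S"
    then show "x \<otimes>\<^bsub>?S\<^esub> \<zero>\<^bsub>?S\<^esub> = \<zero>\<^bsub>?S\<^esub>"
      using l_null[of x] by (simp add: M.m_comm)
  qed (use l_distr l_null in auto)
  then show ?thesis
    using mult by (simp add: groth_def)
qed

theorem burnside_ring_cring:
  assumes "Group.group G"
  shows "cring (burnside_ring G)"
  unfolding burnside_ring_def by (rule groth.groth_ring_cring[OF groth_gset_semiring[OF assms]])

lemma card_fixed_points_iso:
  assumes "finite_gset G X" "gset_iso G X Y" "H \<subseteq> carrier G"
  shows "card (fixed_points H X) = card (fixed_points H Y)"
proof -
  obtain f where f: "bij_betw f (fst X) (fst Y)" "\<forall>g \<in> carrier G. \<forall>x \<in> fst X. f (snd X g x) = snd Y g (f x)"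
    using assms(2) unfolding gset_iso_def by metis
  have "f x \<in> fixed_points H Y \<longleftrightarrow> x \<in> fixed_points H X" if x: "x \<in> fst X" for x
  proof -
    have "snd Y h (f x) = f x \<longleftrightarrow> snd X h x = x" if "h \<in> H" for h
    proof -
      have h: "h \<in> carrier G" using that assms(3) by blast
      then have "snd X h x \<in> fst X" using group_action_closed[OF assms(1)] x by blast
      then show ?thesis
        using f h x by (metis bij_betw_inv_into_left)
    qed
    then show ?thesis
      using x bij_betw_apply[OF f(1) x] by (auto simp: fixed_points_def)
  qed
  moreover have "fixed_points H X \<subseteq> fst X" "fixed_points H Y \<subseteq> f ` fst X"
    using f(1) by (auto simp: fixed_points_def bij_betw_def)
  ultimately have "bij_betw f (fixed_points H X) (fixed_points H Y)"
    using bij_betw_subset[OF f(1), of "fixed_points H X" "fixed_points H Y"] by blast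
  then show ?thesis by (rule bij_betw_same_card)
qed

lemma fixed_points_finite: "finite_gset G X \<Longrightarrow> finite (fixed_points H X)"
  by (simp add: finite_gset_def fixed_points_def)

lemma card_fixed_points_sum:
  assumes "finite_gset G X" "finite_gset G Y"
  shows "card (fixed_points H (gset_sum X Y)) = card (fixed_points H X) + card (fixed_points H Y)"
proof -
  have "fixed_points H (gset_sum X Y) = Sum_Type.Plus (fixed_points H X) (fixed_points H Y)"
    by (auto simp: fixed_points_def gset_sum_def)
  then show ?thesis
    using card_Plus[OF assms[THEN fixed_points_finite]] by simp
qed

lemma card_fixed_points_prod:
  "card (fixed_points H (gset_prod X Y)) = card (fixed_points H X) * card (fixed_points H Y)"
proof -
  have "fixed_points H (gset_prod X Y) = fixed_points H X \<times> fixed_points H Y"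
    by (auto simp: fixed_points_def gset_prod_def)
  then show ?thesis by (simp add: card_cartesian_product)
qed

lemma card_fixed_points_trivial:
  "card (fixed_points H gset_empty) = 0" "card (fixed_points H gset_point) = 1"
proof -
  show "card (fixed_points H gset_empty) = 0" by (simp add: fixed_points_def gset_empty_def)
  have "fixed_points H gset_point = {()}" by (auto simp: fixed_points_def gset_point_def)
  then show "card (fixed_points H gset_point) = 1" by simp
qed

lemma mark_diff:
  fixes X :: "('g, 'x) gset" and Y :: "('g, 'y) gset"
  assumes H: "H \<subseteq> carrier G" and X: "finite_gset G X" and Y: "finite_gset G Y"
  shows "mark G H (groth_diff (gset_semiring G) (gset_class G X) (gset_class G Y))
    = int (card (fixed_points H X)) - int (card (fixed_points H Y))"
proof -
  interpret groth "gset_semiring G"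
    by (rule groth_gset_semiring[OF finite_gsetD(1)[OF X]])
  have well: "int (card (fixed_points H X')) - int (card (fixed_points H Y'))
      = int (card (fixed_points H X)) - int (card (fixed_points H Y))"
    if X': "finite_gset G X'" and Y': "finite_gset G Y'"
      and eq: "groth_diff (gset_semiring G) (gset_class G X) (gset_class G Y)
        = groth_diff (gset_semiring G) (gset_class G X') (gset_class G Y')"
    for X' Y' :: "('g, nat) gset"
  proof -
    obtain K :: "('g, nat) gset" where K: "finite_gset G K"
      and "gset_class G (gset_sum (gset_sum X Y') K) = gset_class G (gset_sum (gset_sum X' Y) K)"
      using eq X Y X' Y'
      by (auto elim!: gset_semiring_cases simp: groth_diff_eq_iff gset_class_closed gset_class_add finite_gset_sum)
    then have "gset_iso G (gset_sum (gset_sum X Y') K) (gset_sum (gset_sum X' Y) K)"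
      using X Y X' Y' by (simp add: gset_class_eq_iff finite_gset_sum)
    then have "card (fixed_points H (gset_sum (gset_sum X Y') K)) = card (fixed_points H (gset_sum (gset_sum X' Y) K))"
      using card_fixed_points_iso[OF _ _ H] X Y' K finite_gset_sum by metis
    then show ?thesis
      by (simp add: card_fixed_points_sum[where G = G] finite_gset_sum X Y X' Y' K)
  qed
  obtain X0 Y0 :: "('g, nat) gset" where 0: "finite_gset G X0" "gset_iso G X X0" "finite_gset G Y0" "gset_iso G Y Y0"
    using gset_nat_copy[OF X] gset_nat_copy[OF Y] by blast
  have eq0: "gset_class G X = gset_class G X0" "gset_class G Y = gset_class G Y0"
    using 0 X Y by (simp_all add: gset_class_eq_iff)
  show ?thesis
    unfolding mark_def
  proof (rule the_equality)
    show "\<exists>(X' :: ('g, nat) gset) (Y' :: ('g, nat) gset). finite_gset G X' \<and> finite_gset G Y' \<and>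
      groth_diff (gset_semiring G) (gset_class G X) (gset_class G Y)
        = groth_diff (gset_semiring G) (gset_class G X') (gset_class G Y') \<and>
      int (card (fixed_points H X)) - int (card (fixed_points H Y))
        = int (card (fixed_points H X')) - int (card (fixed_points H Y'))"
      using 0 eq0 well[OF 0(1,3)] by metis
  qed (use well in auto)
qed

theorem mark_class:
  assumes "H \<subseteq> carrier G" "finite_gset G X"
  shows "mark G H (burnside_class G X) = int (card (fixed_points H X))"
  using mark_diff[OF assms finite_gset_empty[OF finite_gsetD(1)[OF assms(2)]]]
  by (simp add: burnside_class_def gset_class_zero card_fixed_points_trivial)

theorem mark_ring_hom:
  assumes G: "Group.group G" and H: "H \<subseteq> carrier G"
  shows "mark G H \<in> ring_hom (burnside_ring G) \<Z>"
proof -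
  let ?S = "gset_semiring G"
  interpret groth ?S by (rule groth_gset_semiring[OF G])
  have cases: "\<exists>(X :: ('a, nat) gset) (Y :: ('a, nat) gset). finite_gset G X \<and> finite_gset G Y \<and>
      a = groth_diff ?S (gset_class G X) (gset_class G Y)" if "a \<in> carrier (burnside_ring G)" for a
    using that unfolding burnside_ring_def groth_carrier by (auto elim!: gset_semiring_cases)
  show ?thesis
  proof (rule ring_hom_memI)
    show "mark G H \<one>\<^bsub>burnside_ring G\<^esub> = \<one>\<^bsub>\<Z>\<^esub>"
      using mark_diff[OF H finite_gset_point[OF G] finite_gset_empty[OF G]]
      by (simp add: burnside_ring_def groth_one gset_class_one gset_class_zero card_fixed_points_trivial)
  next
    fix a b assume "a \<in> carrier (burnside_ring G)" "b \<in> carrier (burnside_ring G)"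
    then obtain X Y X' Y' :: "('a, nat) gset" where
      fin: "finite_gset G X" "finite_gset G Y" "finite_gset G X'" "finite_gset G Y'"
      and a: "a = groth_diff ?S (gset_class G X) (gset_class G Y)"
      and b: "b = groth_diff ?S (gset_class G X') (gset_class G Y')"
      using cases by metis
    note simps = fin mark_diff[OF H] gset_class_add gset_class_mult gset_class_closed
      finite_gset_sum finite_gset_prod card_fixed_points_sum[where G = G] card_fixed_points_prod
    show "mark G H (a \<oplus>\<^bsub>burnside_ring G\<^esub> b) = mark G H a \<oplus>\<^bsub>\<Z>\<^esub> mark G H b"
      by (simp add: a b burnside_ring_def groth_add simps)
    show "mark G H (a \<otimes>\<^bsub>burnside_ring G\<^esub> b) = mark G H a \<otimes>\<^bsub>\<Z>\<^esub> mark G H b"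
      by (simp add: a b burnside_ring_def groth_mult simps algebra_simps)
  qed auto
qed

theorem mark_module_module:
  assumes G: "Group.group G" and H: "H \<subseteq> carrier G"
  shows "module (burnside_ring G) (mark_module G H)"
proof -
  note hom = mark_ring_hom[OF G H]
  have "abelian_group (mark_module G H)"
    by (rule abelian_groupI) (auto simp: mark_module_def intro: left_minus)
  then show ?thesis
    using burnside_ring_cring[OF G] ring_hom_add[OF hom] ring_hom_mult[OF hom] ring_hom_one[OF hom]
    by (intro moduleI) (auto simp: mark_module_def algebra_simps)
qed


section \<open>The standard free resolution is a free resolution\<close>

lemma free_module_carrier:
  "f \<in> carrier (free_module R B) \<longleftrightarrow>
     (\<forall>b. f b \<in> carrier R) \<and> finite {b. f b \<noteq> \<zero>\<^bsub>R\<^esub>} \<and> (\<forall>b. f b \<noteq> \<zero>\<^bsub>R\<^esub> \<longrightarrow> b \<in> B)"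
  by (auto simp: free_module_def)

lemma free_module_simps:
  "\<zero>\<^bsub>free_module R B\<^esub> = (\<lambda>b. \<zero>\<^bsub>R\<^esub>)"
  "f \<oplus>\<^bsub>free_module R B\<^esub> g = (\<lambda>b. f b \<oplus>\<^bsub>R\<^esub> g b)"
  "r \<odot>\<^bsub>free_module R B\<^esub> f = (\<lambda>b. r \<otimes>\<^bsub>R\<^esub> f b)"
  by (simp_all add: free_module_def)

lemma free_module_module:
  fixes B :: "'b set"
  assumes "cring R"
  shows "module R (free_module R B)"
proof -
  interpret R: cring R by fact
  let ?F = "free_module R B"
  have fin: "finite {b. f b \<oplus>\<^bsub>R\<^esub> g b \<noteq> \<zero>\<^bsub>R\<^esub>}"
    if "finite {b. f b \<noteq> \<zero>\<^bsub>R\<^esub>}" "finite {b. g b \<noteq> \<zero>\<^bsub>R\<^esub>}" for f g :: "'b \<Rightarrow> _"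
    by (rule finite_subset[of _ "{b. f b \<noteq> \<zero>\<^bsub>R\<^esub>} \<union> {b. g b \<noteq> \<zero>\<^bsub>R\<^esub>}"]) (use that in auto)
  have fin2: "finite {b. r \<otimes>\<^bsub>R\<^esub> f b \<noteq> \<zero>\<^bsub>R\<^esub>}"
    if "finite {b. f b \<noteq> \<zero>\<^bsub>R\<^esub>}" "r \<in> carrier R" for r and f :: "'b \<Rightarrow> _"
    by (rule finite_subset[OF _ that(1)]) (use that in auto)
  have ag: "abelian_group ?F"
  proof (rule abelian_groupI)
    fix x y assume x: "x \<in> carrier ?F" and y: "y \<in> carrier ?F"
    show "x \<oplus>\<^bsub>?F\<^esub> y \<in> carrier ?F"
      using x y fin[of x y] by (force simp: free_module_carrier free_module_simps)
    show "x \<oplus>\<^bsub>?F\<^esub> y = y \<oplus>\<^bsub>?F\<^esub> x"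
      using x y by (auto simp: free_module_carrier free_module_simps R.a_comm)
    show "\<exists>y \<in> carrier ?F. y \<oplus>\<^bsub>?F\<^esub> x = \<zero>\<^bsub>?F\<^esub>"
    proof (intro bexI)
      have "\<ominus>\<^bsub>R\<^esub> x b = \<zero>\<^bsub>R\<^esub> \<longleftrightarrow> x b = \<zero>\<^bsub>R\<^esub>" for b
        using x by (metis R.add.inv_eq_1_iff free_module_carrier)
      then show "(\<lambda>b. \<ominus>\<^bsub>R\<^esub> x b) \<in> carrier ?F"
        using x by (auto simp: free_module_carrier)
      show "(\<lambda>b. \<ominus>\<^bsub>R\<^esub> x b) \<oplus>\<^bsub>?F\<^esub> x = \<zero>\<^bsub>?F\<^esub>"
        using x by (auto simp: free_module_carrier free_module_simps R.l_neg)
    qed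
  qed (auto simp: free_module_carrier free_module_simps R.a_assoc)
  show ?thesis
  proof (rule moduleI)
    fix a x assume "a \<in> carrier R" "x \<in> carrier ?F"
    then show "a \<odot>\<^bsub>?F\<^esub> x \<in> carrier ?F"
      using fin2[of x a] by (force simp: free_module_carrier free_module_simps)
  qed (use assms ag in \<open>auto simp: free_module_carrier free_module_simps
        R.l_distr R.r_distr R.m_assoc\<close>)
qed

lemma free_unit_closed:
  assumes "cring R" "b \<in> B"
  shows "free_unit R b \<in> carrier (free_module R B)"
proof -
  interpret R: cring R by fact
  have "finite {c. free_unit R b c \<noteq> \<zero>\<^bsub>R\<^esub>}"
    by (rule finite_subset[of _ "{b}"]) (auto simp: free_unit_def)
  then show ?thesis
    using assms(2) by (auto simp: free_module_carrier free_unit_def)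
qed

lemma free_lift_superset:
  assumes "module R M" and f: "f \<in> carrier (free_module R B)" and h: "\<And>b. b \<in> B \<Longrightarrow> h b \<in> carrier M"
    and A: "finite A" "A \<subseteq> B" "{b. f b \<noteq> \<zero>\<^bsub>R\<^esub>} \<subseteq> A"
  shows "free_lift R M h f = (\<Oplus>\<^bsub>M\<^esub> b \<in> A. f b \<odot>\<^bsub>M\<^esub> h b)"
proof -
  interpret M: module R M by fact
  show ?thesis
    unfolding free_lift_def
    by (rule M.add.finprod_mono_neutral_cong_left)
      (use f h A in \<open>auto simp: free_module_carrier subset_iff\<close>)
qed

lemma free_lift_hom:
  assumes "module R M" and h: "\<And>b. b \<in> B \<Longrightarrow> h b \<in> carrier M"
  shows "restrict (free_lift R M h) (carrier (free_module R B)) \<in> module_hom R (free_module R B) M"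
proof -
  interpret M: module R M by fact
  interpret F: module R "free_module R B"
    using M.R.cring_axioms by (rule free_module_module)
  let ?F = "free_module R B" and ?L = "free_lift R M h"
  have supp: "finite {b. f b \<noteq> \<zero>\<^bsub>R\<^esub>}" "{b. f b \<noteq> \<zero>\<^bsub>R\<^esub>} \<subseteq> B" if "f \<in> carrier ?F" for f
    using that by (auto simp: free_module_carrier)
  have closed: "?L f \<in> carrier M" if "f \<in> carrier ?F" for f
    unfolding free_lift_def
    by (rule M.M.finsum_closed) (use that h in \<open>auto simp: free_module_carrier\<close>)
  have add: "?L (f \<oplus>\<^bsub>?F\<^esub> g) = ?L f \<oplus>\<^bsub>M\<^esub> ?L g" if fg: "f \<in> carrier ?F" "g \<in> carrier ?F" for f g
  proof -
    let ?A = "{b. f b \<noteq> \<zero>\<^bsub>R\<^esub>} \<union> {b. g b \<noteq> \<zero>\<^bsub>R\<^esub>}"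
    have A: "finite ?A" "?A \<subseteq> B" using supp fg by auto
    have "?L (f \<oplus>\<^bsub>?F\<^esub> g) = (\<Oplus>\<^bsub>M\<^esub> b \<in> ?A. (f \<oplus>\<^bsub>?F\<^esub> g) b \<odot>\<^bsub>M\<^esub> h b)"
      by (rule free_lift_superset[OF assms(1) _ h A])
        (use fg F.M.a_closed[OF fg] in \<open>auto simp: free_module_simps\<close>)
    also have "\<dots> = (\<Oplus>\<^bsub>M\<^esub> b \<in> ?A. f b \<odot>\<^bsub>M\<^esub> h b \<oplus>\<^bsub>M\<^esub> g b \<odot>\<^bsub>M\<^esub> h b)"
      by (rule M.M.finsum_cong')
        (use fg h A in \<open>auto simp: free_module_carrier free_module_simps M.smult_l_distr\<close>)
    also have "\<dots> = (\<Oplus>\<^bsub>M\<^esub> b \<in> ?A. f b \<odot>\<^bsub>M\<^esub> h b) \<oplus>\<^bsub>M\<^esub> (\<Oplus>\<^bsub>M\<^esub> b \<in> ?A. g b \<odot>\<^bsub>M\<^esub> h b)"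
      by (rule M.M.finsum_addf) (use fg h A in \<open>auto simp: free_module_carrier\<close>)
    also have "\<dots> = ?L f \<oplus>\<^bsub>M\<^esub> ?L g"
      using free_lift_superset[OF assms(1) fg(1) h A] free_lift_superset[OF assms(1) fg(2) h A]
      by auto
    finally show ?thesis .
  qed
  have smult: "?L (r \<odot>\<^bsub>?F\<^esub> f) = r \<odot>\<^bsub>M\<^esub> ?L f" if r: "r \<in> carrier R" and f: "f \<in> carrier ?F" for r f
  proof -
    let ?A = "{b. f b \<noteq> \<zero>\<^bsub>R\<^esub>}"
    have "?L (r \<odot>\<^bsub>?F\<^esub> f) = (\<Oplus>\<^bsub>M\<^esub> b \<in> ?A. (r \<odot>\<^bsub>?F\<^esub> f) b \<odot>\<^bsub>M\<^esub> h b)"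
      by (rule free_lift_superset[OF assms(1) F.smult_closed[OF r f] h supp[OF f]])
        (use r f in \<open>auto simp: free_module_simps\<close>)
    also have "\<dots> = (\<Oplus>\<^bsub>M\<^esub> b \<in> ?A. r \<odot>\<^bsub>M\<^esub> (f b \<odot>\<^bsub>M\<^esub> h b))"
      by (rule M.M.finsum_cong')
        (use r f h in \<open>auto simp: free_module_carrier free_module_simps M.smult_assoc1\<close>)
    also have "\<dots> = r \<odot>\<^bsub>M\<^esub> ?L f"
      unfolding free_lift_def
      by (rule M.finsum_smult_ldistr[symmetric])
        (use r f h in \<open>auto simp: free_module_carrier\<close>)
    finally show ?thesis .
  qed
  show ?thesis
    by (auto simp: module_hom_def closed add smult simp del: F.M.add.m_closed)
qed

lemma free_lift_unit:
  assumes "module R M" and h: "h b \<in> carrier M"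
  shows "free_lift R M h (free_unit R b) = h b"
proof -
  interpret M: module R M by fact
  have "free_lift R M h (free_unit R b) = (\<Oplus>\<^bsub>M\<^esub> c \<in> {b}. free_unit R b c \<odot>\<^bsub>M\<^esub> h c)"
    by (rule free_lift_superset[OF assms(1) free_unit_closed[OF M.R.cring_axioms, of b "{b}"]])
      (use h in \<open>auto simp: free_unit_def\<close>)
  also have "\<dots> = h b"
    by (subst M.M.finsum_insert) (auto simp: h free_unit_def)
  finally show ?thesis .
qed

lemma generator_cycle_of_cycle_generator:
  assumes "finite {b. z b \<noteq> \<zero>\<^bsub>R\<^esub>}"
  shows "generator_cycle R (cycle_generator R z) = z"
proof -
  have "finite {(b, z b) | b. z b \<noteq> \<zero>\<^bsub>R\<^esub>}"
    using finite_imageI[OF assms, of "\<lambda>b. (b, z b)"] by (simp add: setcompr_eq_image)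
  then have "(b, r) |\<in>| Abs_fset {(b, z b) | b. z b \<noteq> \<zero>\<^bsub>R\<^esub>} \<longleftrightarrow> r = z b \<and> z b \<noteq> \<zero>\<^bsub>R\<^esub>" for b r
    by (auto simp: Abs_fset_inverse)
  then show ?thesis
    by (auto simp: cycle_generator_def fun_eq_iff)
qed

lemma finsum_free_module_support:
  assumes "cring R" "finite A" "\<And>a. a \<in> A \<Longrightarrow> f a \<in> carrier (free_module R B)"
  shows "finsum (free_module R UNIV) f A \<in> carrier (free_module R B)"
  using assms(2,3)
proof (induction A rule: finite_induct)
  interpret U: module R "free_module R UNIV"
    using assms(1) by (rule free_module_module)
  interpret F: module R "free_module R B"
    using assms(1) by (rule free_module_module)
  case empty
  then show ?case
    using F.M.zero_closed by (simp add: free_module_simps)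
next
  interpret U: module R "free_module R UNIV"
    using assms(1) by (rule free_module_module)
  interpret F: module R "free_module R B"
    using assms(1) by (rule free_module_module)
  case (insert a A)
  have "f \<in> insert a A \<rightarrow> carrier (free_module R UNIV)"
    using insert.prems by (auto simp: free_module_carrier)
  then have "finsum (free_module R UNIV) f (insert a A)
      = f a \<oplus>\<^bsub>free_module R B\<^esub> finsum (free_module R UNIV) f A"
    using insert.hyps by (simp add: free_module_simps U.M.finsum_insert)
  then show ?case
    using insert F.M.a_closed by auto
qed

lemma restrict_module_homD:
  assumes "module R M" "restrict f (carrier M) \<in> module_hom R M N"
  shows "x \<in> carrier M \<Longrightarrow> f x \<in> carrier N"
    and "x \<in> carrier M \<Longrightarrow> y \<in> carrier M \<Longrightarrow> f (x \<oplus>\<^bsub>M\<^esub> y) = f x \<oplus>\<^bsub>N\<^esub> f y"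
    and "r \<in> carrier R \<Longrightarrow> x \<in> carrier M \<Longrightarrow> f (r \<odot>\<^bsub>M\<^esub> x) = r \<odot>\<^bsub>N\<^esub> f x"
proof -
  interpret M: module R M by fact
  show "x \<in> carrier M \<Longrightarrow> f x \<in> carrier N"
    using assms(2) by (auto simp: module_hom_def)
  show "f (x \<oplus>\<^bsub>M\<^esub> y) = f x \<oplus>\<^bsub>N\<^esub> f y" if "x \<in> carrier M" "y \<in> carrier M"
    using assms(2) that M.M.a_closed[OF that] unfolding module_hom_def by force
  show "f (r \<odot>\<^bsub>M\<^esub> x) = r \<odot>\<^bsub>N\<^esub> f x" if "r \<in> carrier R" "x \<in> carrier M"
    using assms(2) that M.smult_closed[OF that] unfolding module_hom_def by force
qed

theorem standard_resolution:
  fixes M :: "('r, 'm, 'p) module_scheme"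
  assumes "module R M"
  shows res_module_module: "module R (res_module R M n)"
    and res_augmentation_hom:
      "restrict (res_augmentation R M) (carrier (res_module R M 0)) \<in> module_hom R (res_module R M 0) M"
    and res_boundary_hom:
      "restrict (res_boundary R) (carrier (res_module R M (Suc n)))
        \<in> module_hom R (res_module R M (Suc n)) (res_module R M n)"
    and res_augmentation_surj: "res_augmentation R M ` carrier (res_module R M 0) = carrier M"
    and res_exact_0: "res_boundary R ` carrier (res_module R M (Suc 0))
        = {x \<in> carrier (res_module R M 0). res_augmentation R M x = \<zero>\<^bsub>M\<^esub>}"
    and res_exact_Suc: "res_boundary R ` carrier (res_module R M (Suc (Suc n)))
        = {x \<in> carrier (res_module R M (Suc n)). res_boundary R x = \<zero>\<^bsub>res_module R M n\<^esub>}"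
proof -
  interpret M: module R M by fact
  note cring = M.R.cring_axioms
  have mod: "module R (res_module R M n)" for n
    unfolding res_module_def by (rule free_module_module[OF cring])
  show "module R (res_module R M n)" by (rule mod)
  have gen: "generator_elem b \<in> carrier M" if "b \<in> res_basis R M 0" for b
    using that by auto
  show aug_hom: "restrict (res_augmentation R M) (carrier (res_module R M 0))
      \<in> module_hom R (res_module R M 0) M"
    unfolding res_augmentation_def res_module_def by (rule free_lift_hom[OF assms gen])
  define Z where "Z n = {z \<in> carrier (res_module R M n).
     case n of 0 \<Rightarrow> res_augmentation R M z = \<zero>\<^bsub>M\<^esub>
             | Suc _ \<Rightarrow> res_boundary R z = (\<lambda>b. \<zero>\<^bsub>R\<^esub>)}" for n
  have basis: "res_basis R M (Suc n) = cycle_generator R ` Z n" for n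
    by (simp add: Z_def res_module_def)
  have cyc: "generator_cycle R (cycle_generator R z) = z" if "z \<in> Z n" for z n
    by (rule generator_cycle_of_cycle_generator)
      (use that in \<open>auto simp: Z_def res_module_def free_module_carrier\<close>)
  have cycZ: "generator_cycle R b \<in> Z n" if "b \<in> res_basis R M (Suc n)" for b n
    using that by (auto simp: basis cyc simp del: res_basis.simps)
  have modU: "module R (free_module R (UNIV :: ('r, 'm) generator set))"
    by (rule free_module_module[OF cring])
  have sub: "x \<in> carrier (free_module R UNIV)" if "x \<in> carrier (res_module R M n)" for x n
    using that by (auto simp: res_module_def free_module_carrier)
  have cycU: "generator_cycle R b \<in> carrier (free_module R UNIV)" if "b \<in> res_basis R M (Suc n)" for b n
    using cycZ[OF that] sub by (auto simp: Z_def)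
  have bd_homU: "restrict (res_boundary R) (carrier (res_module R M (Suc n)))
      \<in> module_hom R (res_module R M (Suc n)) (free_module R UNIV)" for n
    unfolding res_boundary_def res_module_def
    by (rule free_lift_hom[OF modU]) (rule cycU)
  have bd_closed: "res_boundary R x \<in> carrier (res_module R M n)"
    if x: "x \<in> carrier (res_module R M (Suc n))" for x n
    unfolding res_boundary_def free_lift_def res_module_def
  proof (rule finsum_free_module_support[OF cring])
    interpret F: module R "res_module R M n" by (rule mod)
    show "finite {b. x b \<noteq> \<zero>\<^bsub>R\<^esub>}"
      using x by (auto simp: res_module_def free_module_carrier)
    fix b assume "b \<in> {b. x b \<noteq> \<zero>\<^bsub>R\<^esub>}"
    then have "generator_cycle R b \<in> carrier (res_module R M n)" "x b \<in> carrier R"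
      using x cycZ[of b n] by (auto simp: res_module_def free_module_carrier Z_def)
    then show "x b \<odot>\<^bsub>free_module R UNIV\<^esub> generator_cycle R b \<in> carrier (free_module R (res_basis R M n))"
      using F.smult_closed[of "x b" "generator_cycle R b"]
      by (simp add: res_module_def free_module_simps)
  qed
  show bd_hom: "restrict (res_boundary R) (carrier (res_module R M (Suc n)))
        \<in> module_hom R (res_module R M (Suc n)) (res_module R M n)" for n
    using bd_homU[of n] bd_closed[of _ n]
    by (auto simp: module_hom_def res_module_def free_module_simps)
  have unit: "free_unit R b \<in> carrier (res_module R M n)" if "b \<in> res_basis R M n" for b n
    unfolding res_module_def by (rule free_unit_closed[OF cring that])
  show "res_augmentation R M ` carrier (res_module R M 0) = carrier M"
  proof
    show "res_augmentation R M ` carrier (res_module R M 0) \<subseteq> carrier M"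
      using aug_hom by (auto simp: module_hom_def PiE_iff)
    show "carrier M \<subseteq> res_augmentation R M ` carrier (res_module R M 0)"
    proof
      fix m assume m: "m \<in> carrier M"
      have "res_augmentation R M (free_unit R (Elem m)) = m"
        using free_lift_unit[OF assms, of generator_elem "Elem m"] m by (simp add: res_augmentation_def)
      then show "m \<in> res_augmentation R M ` carrier (res_module R M 0)"
        using unit[of "Elem m" 0] m by (metis imageI res_basis.simps(1))
    qed
  qed
  \<comment> \<open>cycles form a submodule, so boundaries are cycles\<close>
  have Z_zero: "(\<lambda>b. \<zero>\<^bsub>R\<^esub>) \<in> Z n" for n
  proof -
    interpret F: module R "res_module R M n" by (rule mod)
    have "(\<lambda>b. \<zero>\<^bsub>R\<^esub>) \<in> carrier (res_module R M n)"
      using F.M.zero_closed by (simp add: res_module_def free_module_simps)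
    moreover have "res_augmentation R M (\<lambda>b. \<zero>\<^bsub>R\<^esub>) = \<zero>\<^bsub>M\<^esub>"
      by (simp add: res_augmentation_def free_lift_def)
    moreover have "res_boundary R (\<lambda>b :: ('r, 'm) generator. \<zero>\<^bsub>R\<^esub>) = (\<lambda>b. \<zero>\<^bsub>R\<^esub>)"
    proof -
      interpret U: module R "free_module R (UNIV :: ('r, 'm) generator set)" by (rule modU)
      show ?thesis by (simp add: res_boundary_def free_lift_def) (simp add: free_module_simps)
    qed
    ultimately show ?thesis
      by (cases n) (auto simp: Z_def)
  qed
  have Z_lin: "(\<lambda>b. r \<otimes>\<^bsub>R\<^esub> x b \<oplus>\<^bsub>R\<^esub> y b) \<in> Z n" if "x \<in> Z n" "y \<in> Z n" "r \<in> carrier R" for r x y n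
  proof -
    interpret F: module R "res_module R M n" by (rule mod)
    have xy: "x \<in> carrier (res_module R M n)" "y \<in> carrier (res_module R M n)"
      using that by (auto simp: Z_def)
    have eq: "(\<lambda>b. r \<otimes>\<^bsub>R\<^esub> x b \<oplus>\<^bsub>R\<^esub> y b) = (r \<odot>\<^bsub>res_module R M n\<^esub> x) \<oplus>\<^bsub>res_module R M n\<^esub> y"
      by (simp add: res_module_def free_module_simps)
    have rx: "r \<odot>\<^bsub>res_module R M n\<^esub> x \<in> carrier (res_module R M n)"
      using xy that by auto
    show ?thesis
    proof (cases n)
      case 0
      have "res_augmentation R M ((r \<odot>\<^bsub>res_module R M n\<^esub> x) \<oplus>\<^bsub>res_module R M n\<^esub> y)
          = r \<odot>\<^bsub>M\<^esub> res_augmentation R M x \<oplus>\<^bsub>M\<^esub> res_augmentation R M y"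
        using restrict_module_homD[OF mod aug_hom] xy rx that(3) unfolding 0 by simp
      then show ?thesis
        using that xy rx F.M.a_closed[OF rx xy(2)] unfolding eq by (simp add: Z_def 0)
    next
      case (Suc k)
      interpret G: module R "res_module R M k" by (rule mod)
      have "res_boundary R ((r \<odot>\<^bsub>res_module R M n\<^esub> x) \<oplus>\<^bsub>res_module R M n\<^esub> y)
          = r \<odot>\<^bsub>res_module R M k\<^esub> res_boundary R x \<oplus>\<^bsub>res_module R M k\<^esub> res_boundary R y"
        using restrict_module_homD[OF mod bd_hom[of k]] xy rx that(3) unfolding Suc by simp
      then show ?thesis
        using that xy rx F.M.a_closed[OF rx xy(2)] unfolding eq
        by (simp add: Z_def Suc) (simp add: res_module_def free_module_simps)
    qed
  qed
  have exact: "res_boundary R ` carrier (res_module R M (Suc n)) = Z n" for n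
  proof
    show "Z n \<subseteq> res_boundary R ` carrier (res_module R M (Suc n))"
    proof
      fix z assume z: "z \<in> Z n"
      then have b: "cycle_generator R z \<in> res_basis R M (Suc n)"
        by (simp add: basis del: res_basis.simps)
      have "res_boundary R (free_unit R (cycle_generator R z)) = z"
        using free_lift_unit[OF modU, of "generator_cycle R" "cycle_generator R z"] cycU[OF b] cyc[OF z] by (simp add: res_boundary_def)
      then show "z \<in> res_boundary R ` carrier (res_module R M (Suc n))"
        using unit[OF b] by (metis imageI)
    qed
    show "res_boundary R ` carrier (res_module R M (Suc n)) \<subseteq> Z n"
    proof clarify
      fix x assume x: "x \<in> carrier (res_module R M (Suc n))"
      interpret U: module R "free_module R (UNIV :: ('r, 'm) generator set)" by (rule modU)
      let ?t = "\<lambda>b. x b \<odot>\<^bsub>free_module R UNIV\<^esub> generator_cycle R b"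
      have supp: "finite A \<Longrightarrow> A \<subseteq> {b. x b \<noteq> \<zero>\<^bsub>R\<^esub>} \<Longrightarrow> finsum (free_module R UNIV) ?t A \<in> Z n" for A
      proof (induction A rule: finite_induct)
        case empty
        then show ?case using Z_zero[of n] by (simp add: free_module_simps)
      next
        case (insert a A)
        have xb: "x b \<in> carrier R" for b
          using x by (auto simp: res_module_def free_module_carrier)
        have ba: "b \<in> res_basis R M (Suc n)" if "b \<in> insert a A" for b
          using x insert.prems that by (auto simp: res_module_def free_module_carrier simp del: res_basis.simps)
        have "?t \<in> insert a A \<rightarrow> carrier (free_module R UNIV)"
          using cycU ba xb by (auto intro!: U.smult_closed simp del: res_basis.simps)
        then have "finsum (free_module R UNIV) ?t (insert a A)
            = (\<lambda>b. x a \<otimes>\<^bsub>R\<^esub> generator_cycle R a b \<oplus>\<^bsub>R\<^esub> finsum (free_module R UNIV) ?t A b)"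
          using insert.hyps by (simp add: U.M.finsum_insert) (simp add: free_module_simps)
        then show ?case
          using Z_lin[OF cycZ[OF ba] insert.IH xb, of a a] insert.prems by simp
      qed
      show "res_boundary R x \<in> Z n"
        unfolding res_boundary_def free_lift_def
        by (rule supp) (use x in \<open>auto simp: res_module_def free_module_carrier\<close>)
    qed
  qed
  show "res_boundary R ` carrier (res_module R M (Suc 0))
        = {x \<in> carrier (res_module R M 0). res_augmentation R M x = \<zero>\<^bsub>M\<^esub>}"
    by (simp add: exact Z_def)
  show "res_boundary R ` carrier (res_module R M (Suc (Suc n)))
        = {x \<in> carrier (res_module R M (Suc n)). res_boundary R x = \<zero>\<^bsub>res_module R M n\<^esub>}"
    by (simp add: exact Z_def) (simp add: res_module_def free_module_simps)
qed


section \<open>Ext is a module\<close>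

lemma Hom_module_simps:
  "carrier (Hom_module R M N) = module_hom R M N"
  "\<zero>\<^bsub>Hom_module R M N\<^esub> = (\<lambda>x \<in> carrier M. \<zero>\<^bsub>N\<^esub>)"
  "f \<oplus>\<^bsub>Hom_module R M N\<^esub> g = (\<lambda>x \<in> carrier M. f x \<oplus>\<^bsub>N\<^esub> g x)"
  "r \<odot>\<^bsub>Hom_module R M N\<^esub> f = (\<lambda>x \<in> carrier M. r \<odot>\<^bsub>N\<^esub> f x)"
  by (simp_all add: Hom_module_def)

lemma module_homD:
  assumes "f \<in> module_hom R M N"
  shows "x \<in> carrier M \<Longrightarrow> f x \<in> carrier N"
    and "x \<in> carrier M \<Longrightarrow> y \<in> carrier M \<Longrightarrow> f (x \<oplus>\<^bsub>M\<^esub> y) = f x \<oplus>\<^bsub>N\<^esub> f y"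
    and "r \<in> carrier R \<Longrightarrow> x \<in> carrier M \<Longrightarrow> f (r \<odot>\<^bsub>M\<^esub> x) = r \<odot>\<^bsub>N\<^esub> f x"
    and "x \<notin> carrier M \<Longrightarrow> f x = undefined"
  using assms by (auto simp: module_hom_def)

lemma module_homI:
  assumes "\<And>x. x \<in> carrier M \<Longrightarrow> f x \<in> carrier N"
    and "\<And>x y. x \<in> carrier M \<Longrightarrow> y \<in> carrier M \<Longrightarrow> f (x \<oplus>\<^bsub>M\<^esub> y) = f x \<oplus>\<^bsub>N\<^esub> f y"
    and "\<And>r x. r \<in> carrier R \<Longrightarrow> x \<in> carrier M \<Longrightarrow> f (r \<odot>\<^bsub>M\<^esub> x) = r \<odot>\<^bsub>N\<^esub> f x"
    and "\<And>x. x \<notin> carrier M \<Longrightarrow> f x = undefined"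
  shows "f \<in> module_hom R M N"
  using assms by (auto simp: module_hom_def)

lemma Hom_module_module:
  assumes "module R M" "module R N"
  shows "module R (Hom_module R M N)"
proof -
  interpret M: module R M by fact
  interpret N: module R N by fact
  let ?H = "Hom_module R M N"
  note D = module_homD[where R = R and M = M and N = N]
  have ext: "f = g" if "f \<in> module_hom R M N" "g \<in> module_hom R M N"
      "\<And>x. x \<in> carrier M \<Longrightarrow> f x = g x" for f g
    using that by (metis ext D(4))
  have zero: "\<zero>\<^bsub>?H\<^esub> \<in> module_hom R M N"
    unfolding Hom_module_simps by (rule module_homI) auto
  have add: "f \<oplus>\<^bsub>?H\<^esub> g \<in> module_hom R M N"
    if f: "f \<in> module_hom R M N" and g: "g \<in> module_hom R M N" for f g
    unfolding Hom_module_simps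
    by (rule module_homI) (auto simp: D[OF f] D[OF g] N.M.a_ac N.smult_r_distr)
  have smult: "r \<odot>\<^bsub>?H\<^esub> f \<in> module_hom R M N" if r: "r \<in> carrier R" and f: "f \<in> module_hom R M N" for r f
    unfolding Hom_module_simps
    by (rule module_homI) (auto simp: r D[OF f] N.smult_r_distr N.smult_assoc1[symmetric] M.R.m_comm)
  have ag: "abelian_group ?H"
  proof (rule abelian_groupI; (unfold Hom_module_simps(1))?)
    fix f assume f: "f \<in> module_hom R M N"
    let ?g = "\<ominus>\<^bsub>R\<^esub> \<one>\<^bsub>R\<^esub> \<odot>\<^bsub>?H\<^esub> f"
    have "?g \<in> module_hom R M N" using f smult by blast
    moreover have "?g \<oplus>\<^bsub>?H\<^esub> f = \<zero>\<^bsub>?H\<^esub>"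
      by (rule ext) (auto simp: f zero add smult, auto simp: Hom_module_simps D[OF f] N.smult_l_minus N.M.l_neg)
    ultimately show "\<exists>g \<in> module_hom R M N. g \<oplus>\<^bsub>?H\<^esub> f = \<zero>\<^bsub>?H\<^esub>"
      by (rule bexI[of _ ?g, rotated])
    show "\<zero>\<^bsub>?H\<^esub> \<oplus>\<^bsub>?H\<^esub> f = f"
      by (rule ext) (auto simp: f zero add, auto simp: Hom_module_simps D[OF f])
  next
    fix f g assume f: "f \<in> module_hom R M N" and g: "g \<in> module_hom R M N"
    show "f \<oplus>\<^bsub>?H\<^esub> g = g \<oplus>\<^bsub>?H\<^esub> f"
      by (rule ext) (auto simp: f g add, auto simp: Hom_module_simps D[OF f] D[OF g] N.M.a_comm)
    fix h assume h: "h \<in> module_hom R M N"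
    show "f \<oplus>\<^bsub>?H\<^esub> g \<oplus>\<^bsub>?H\<^esub> h = f \<oplus>\<^bsub>?H\<^esub> (g \<oplus>\<^bsub>?H\<^esub> h)"
      by (rule ext) (auto simp: f g h add, auto simp: Hom_module_simps D[OF f] D[OF g] D[OF h] N.M.a_assoc)
  qed (use zero add in auto)
  show ?thesis
  proof (rule moduleI; (unfold Hom_module_simps(1))?)
    fix f assume f: "f \<in> module_hom R M N"
    show "\<one>\<^bsub>R\<^esub> \<odot>\<^bsub>?H\<^esub> f = f"
      by (rule ext) (auto simp: f smult, auto simp: Hom_module_simps D[OF f])
    fix a b assume a: "a \<in> carrier R" and b: "b \<in> carrier R"
    show "(a \<oplus>\<^bsub>R\<^esub> b) \<odot>\<^bsub>?H\<^esub> f = a \<odot>\<^bsub>?H\<^esub> f \<oplus>\<^bsub>?H\<^esub> b \<odot>\<^bsub>?H\<^esub> f"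
      by (rule ext) (auto simp: f a b smult add, auto simp: Hom_module_simps D[OF f] a b N.smult_l_distr)
    show "(a \<otimes>\<^bsub>R\<^esub> b) \<odot>\<^bsub>?H\<^esub> f = a \<odot>\<^bsub>?H\<^esub> (b \<odot>\<^bsub>?H\<^esub> f)"
      by (rule ext) (auto simp: f a b smult, auto simp: Hom_module_simps D[OF f] a b N.smult_assoc1)
    fix g assume g: "g \<in> module_hom R M N"
    show "a \<odot>\<^bsub>?H\<^esub> (f \<oplus>\<^bsub>?H\<^esub> g) = a \<odot>\<^bsub>?H\<^esub> f \<oplus>\<^bsub>?H\<^esub> a \<odot>\<^bsub>?H\<^esub> g"
      by (rule ext) (auto simp: f g a smult add, auto simp: Hom_module_simps D[OF f] D[OF g] a N.smult_r_distr)
  qed (use ag smult M.R.cring_axioms in auto)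
qed

lemma quotient_module_module:
  assumes "module R M" "submodule U R M"
  shows "module R (quotient_module M U)"
proof -
  interpret M: module R M by fact
  interpret U: submodule U R M by fact
  interpret A: abelian_subgroup U M
    by (rule abelian_subgroupI3[OF additive_subgroup.intro[OF U.subgroup_axioms] M.M.abelian_group_axioms])
  let ?Q = "quotient_module M U"
  have sub: "subgroup U (add_monoid M)" by (rule U.subgroup_axioms)
  have cl: "U +>\<^bsub>M\<^esub> x \<in> carrier ?Q" if "x \<in> carrier M" for x
    using that by (auto simp: quotient_module_def A_RCOSETS_def')
  have ex: "\<exists>x \<in> carrier M. C = U +>\<^bsub>M\<^esub> x" if "C \<in> carrier ?Q" for C
    using that by (auto simp: quotient_module_def A_RCOSETS_def')
  have add: "(U +>\<^bsub>M\<^esub> x) \<oplus>\<^bsub>?Q\<^esub> (U +>\<^bsub>M\<^esub> y) = U +>\<^bsub>M\<^esub> (x \<oplus>\<^bsub>M\<^esub> y)"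
    if "x \<in> carrier M" "y \<in> carrier M" for x y
    using that A.a_rcos_sum by (simp add: quotient_module_def)
  have zero: "\<zero>\<^bsub>?Q\<^esub> = U +>\<^bsub>M\<^esub> \<zero>\<^bsub>M\<^esub>"
    using U.subset by (simp add: quotient_module_def)
  have smult: "r \<odot>\<^bsub>?Q\<^esub> (U +>\<^bsub>M\<^esub> x) = U +>\<^bsub>M\<^esub> (r \<odot>\<^bsub>M\<^esub> x)"
    if r: "r \<in> carrier R" and x: "x \<in> carrier M" for r x
  proof -
    have "U +>\<^bsub>M\<^esub> (r \<odot>\<^bsub>M\<^esub> y) = U +>\<^bsub>M\<^esub> (r \<odot>\<^bsub>M\<^esub> x)" if "y \<in> U +>\<^bsub>M\<^esub> x" for y
    proof -
      from that obtain u where u: "u \<in> U" "y = u \<oplus>\<^bsub>M\<^esub> x"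
        by (auto simp: a_r_coset_def')
      then have "r \<odot>\<^bsub>M\<^esub> y = r \<odot>\<^bsub>M\<^esub> u \<oplus>\<^bsub>M\<^esub> r \<odot>\<^bsub>M\<^esub> x" "r \<odot>\<^bsub>M\<^esub> u \<in> U"
        using r x U.mem_carrier[OF u(1)] by (auto simp: M.smult_r_distr)
      then have "r \<odot>\<^bsub>M\<^esub> y \<in> U +>\<^bsub>M\<^esub> (r \<odot>\<^bsub>M\<^esub> x)"
        by (auto simp: a_r_coset_def')
      then show ?thesis
        using M.M.a_repr_independence[OF _ _ sub, symmetric] M.smult_closed[OF r x] by blast
    qed
    moreover have "x \<in> U +>\<^bsub>M\<^esub> x"
      using x A.a_rcos_self by blast
    ultimately have "(\<Union>y \<in> U +>\<^bsub>M\<^esub> x. U +>\<^bsub>M\<^esub> (r \<odot>\<^bsub>M\<^esub> y)) = U +>\<^bsub>M\<^esub> (r \<odot>\<^bsub>M\<^esub> x)"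
      by blast
    then show ?thesis
      by (simp add: quotient_module_def)
  qed
  have ag: "abelian_group ?Q"
  proof (rule abelian_groupI)
    fix C D assume C: "C \<in> carrier ?Q" and D: "D \<in> carrier ?Q"
    then obtain x y where x: "x \<in> carrier M" "C = U +>\<^bsub>M\<^esub> x" and y: "y \<in> carrier M" "D = U +>\<^bsub>M\<^esub> y"
      using ex by metis
    show "C \<oplus>\<^bsub>?Q\<^esub> D \<in> carrier ?Q" "C \<oplus>\<^bsub>?Q\<^esub> D = D \<oplus>\<^bsub>?Q\<^esub> C"
      using x y by (auto simp: add cl M.M.a_comm)
    show "\<zero>\<^bsub>?Q\<^esub> \<oplus>\<^bsub>?Q\<^esub> C = C" using x by (simp add: zero add)
    show "\<exists>D \<in> carrier ?Q. D \<oplus>\<^bsub>?Q\<^esub> C = \<zero>\<^bsub>?Q\<^esub>"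
      by (rule bexI[of _ "U +>\<^bsub>M\<^esub> (\<ominus>\<^bsub>M\<^esub> x)"]) (use x in \<open>auto simp: zero add cl M.M.l_neg\<close>)
    fix E assume "E \<in> carrier ?Q"
    then obtain z where "z \<in> carrier M" "E = U +>\<^bsub>M\<^esub> z" using ex by metis
    then show "C \<oplus>\<^bsub>?Q\<^esub> D \<oplus>\<^bsub>?Q\<^esub> E = C \<oplus>\<^bsub>?Q\<^esub> (D \<oplus>\<^bsub>?Q\<^esub> E)"
      using x y by (simp add: add M.M.a_assoc)
  qed (auto simp: zero cl)
  show ?thesis
  proof (rule moduleI)
    fix C assume C: "C \<in> carrier ?Q"
    then obtain x where x: "x \<in> carrier M" "C = U +>\<^bsub>M\<^esub> x" using ex by metis
    show "\<one>\<^bsub>R\<^esub> \<odot>\<^bsub>?Q\<^esub> C = C" using x by (simp add: smult)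
    fix a b assume a: "a \<in> carrier R" and b: "b \<in> carrier R"
    show "a \<odot>\<^bsub>?Q\<^esub> C \<in> carrier ?Q"
      using x a by (simp add: smult cl)
    show "(a \<oplus>\<^bsub>R\<^esub> b) \<odot>\<^bsub>?Q\<^esub> C = a \<odot>\<^bsub>?Q\<^esub> C \<oplus>\<^bsub>?Q\<^esub> b \<odot>\<^bsub>?Q\<^esub> C"
      using x a b by (simp add: smult add M.smult_l_distr)
    show "(a \<otimes>\<^bsub>R\<^esub> b) \<odot>\<^bsub>?Q\<^esub> C = a \<odot>\<^bsub>?Q\<^esub> (b \<odot>\<^bsub>?Q\<^esub> C)"
      using x a b by (simp add: smult M.smult_assoc1)
    fix D assume D: "D \<in> carrier ?Q"
    then obtain y where "y \<in> carrier M" "D = U +>\<^bsub>M\<^esub> y" using ex by metis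
    then show "a \<odot>\<^bsub>?Q\<^esub> (C \<oplus>\<^bsub>?Q\<^esub> D) = a \<odot>\<^bsub>?Q\<^esub> C \<oplus>\<^bsub>?Q\<^esub> a \<odot>\<^bsub>?Q\<^esub> D"
      using x a by (simp add: smult add M.smult_r_distr)
  qed (use ag M.R.cring_axioms in auto)
qed

lemma submodule_subset_module:
  assumes "module R M" "submodule U R M" "submodule V R M" "V \<subseteq> U"
  shows "submodule V R (M\<lparr>carrier := U\<rparr>)"
proof -
  interpret M: module R M by fact
  interpret U: module R "M\<lparr>carrier := U\<rparr>"
    by (rule submodule.submodule_is_module) fact+
  have "module R ((M\<lparr>carrier := U\<rparr>)\<lparr>carrier := V\<rparr>)"
    using submodule.submodule_is_module[OF assms(3,1)] by simp
  then show ?thesis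
    using assms(4) by (intro U.module_incl_imp_submodule) auto
qed

lemma (in module) submoduleI':
  assumes "U \<subseteq> carrier M" "\<zero>\<^bsub>M\<^esub> \<in> U" "\<And>x y. x \<in> U \<Longrightarrow> y \<in> U \<Longrightarrow> x \<oplus>\<^bsub>M\<^esub> y \<in> U"
    "\<And>r x. r \<in> carrier R \<Longrightarrow> x \<in> U \<Longrightarrow> r \<odot>\<^bsub>M\<^esub> x \<in> U"
  shows "submodule U R M"
proof (rule submoduleI)
  fix x assume x: "x \<in> U"
  then have "\<ominus>\<^bsub>M\<^esub> x = (\<ominus> \<one>) \<odot>\<^bsub>M\<^esub> x"
    using assms(1) by (subst smult_l_minus) auto
  then show "\<ominus>\<^bsub>M\<^esub> x \<in> U"
    using assms(4)[OF _ x, of "\<ominus> \<one>"] by simp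
qed (use assms in auto)

theorem Ext_module:
  assumes M: "module R M" and N: "module R N"
  shows "module R (Ext R l M N)"
proof -
  interpret M: module R M by fact
  interpret N: module R N by fact
  interpret F: module R "res_module R M n" for n
    using M by (rule res_module_module)
  interpret H: module R "Hom_module R (res_module R M n) N" for n
    by (rule Hom_module_module[OF F.module_axioms N])
  note bd = restrict_module_homD[OF F.module_axioms res_boundary_hom[OF M]]
  have bd_bd: "res_boundary R (res_boundary R x) = \<zero>\<^bsub>res_module R M n\<^esub>"
    if "x \<in> carrier (res_module R M (Suc (Suc n)))" for x n
    using res_exact_Suc[OF M, of n] that by blast
  have hom_zero: "f \<zero>\<^bsub>res_module R M n\<^esub> = \<zero>\<^bsub>N\<^esub>" if "f \<in> module_hom R (res_module R M n) N" for f n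
  proof -
    have "f (\<zero>\<^bsub>R\<^esub> \<odot>\<^bsub>res_module R M n\<^esub> \<zero>\<^bsub>res_module R M n\<^esub>) = \<zero>\<^bsub>R\<^esub> \<odot>\<^bsub>N\<^esub> f \<zero>\<^bsub>res_module R M n\<^esub>"
      by (rule module_homD(3)[OF that]) auto
    then show ?thesis
      using module_homD(1)[OF that] by simp
  qed
  have Z: "submodule (ext_cocycles R l M N) R (Hom_module R (res_module R M l) N)"
    by (rule H.submoduleI')
      (use H.M.zero_closed H.M.a_closed H.smult_closed in
        \<open>auto simp: ext_cocycles_def bd Hom_module_simps\<close>)
  have pull: "(\<lambda>x \<in> carrier (res_module R M (Suc n)). f (res_boundary R x))
      \<in> ext_cocycles R (Suc n) M N" if f: "f \<in> module_hom R (res_module R M n) N" for f n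
    unfolding ext_cocycles_def
    by (auto intro!: module_homI simp: module_homD[OF f] bd bd_bd hom_zero[OF f])
  have B: "submodule (ext_coboundaries R l M N) R (Hom_module R (res_module R M l) N)
      \<and> ext_coboundaries R l M N \<subseteq> ext_cocycles R l M N"
  proof (cases l)
    case 0
    have "submodule {\<zero>\<^bsub>Hom_module R (res_module R M 0) N\<^esub>} R (Hom_module R (res_module R M 0) N)"
      by (rule H.submoduleI') auto
    moreover have "\<zero>\<^bsub>Hom_module R (res_module R M 0) N\<^esub> \<in> ext_cocycles R 0 M N"
      using H.M.zero_closed[of 0] by (auto simp: ext_cocycles_def bd Hom_module_simps)
    ultimately show ?thesis
      by (simp add: 0 Hom_module_simps)
  next
    case (Suc k)
    have "submodule (ext_coboundaries R (Suc k) M N) R (Hom_module R (res_module R M (Suc k)) N)"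
    proof (rule H.submoduleI')
      show "ext_coboundaries R (Suc k) M N \<subseteq> carrier (Hom_module R (res_module R M (Suc k)) N)"
        using pull by (auto simp: Hom_module_simps ext_cocycles_def)
      show "\<zero>\<^bsub>Hom_module R (res_module R M (Suc k)) N\<^esub> \<in> ext_coboundaries R (Suc k) M N"
        using H.M.zero_closed[of k]
        by (auto simp: Hom_module_simps bd intro!: exI[of _ "\<zero>\<^bsub>Hom_module R (res_module R M k) N\<^esub>"])
    next
      fix x y assume "x \<in> ext_coboundaries R (Suc k) M N" "y \<in> ext_coboundaries R (Suc k) M N"
      then obtain f g where f: "f \<in> module_hom R (res_module R M k) N"
          "x = (\<lambda>x \<in> carrier (res_module R M (Suc k)). f (res_boundary R x))"
        and g: "g \<in> module_hom R (res_module R M k) N"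
          "y = (\<lambda>x \<in> carrier (res_module R M (Suc k)). g (res_boundary R x))"
        by auto
      then show "x \<oplus>\<^bsub>Hom_module R (res_module R M (Suc k)) N\<^esub> y \<in> ext_coboundaries R (Suc k) M N"
        using H.M.a_closed[of f k g]
        by (auto simp: Hom_module_simps bd
            intro!: exI[of _ "f \<oplus>\<^bsub>Hom_module R (res_module R M k) N\<^esub> g"])
    next
      fix r x assume r: "r \<in> carrier R" and "x \<in> ext_coboundaries R (Suc k) M N"
      then obtain f where f: "f \<in> module_hom R (res_module R M k) N"
          "x = (\<lambda>x \<in> carrier (res_module R M (Suc k)). f (res_boundary R x))"
        by auto
      then show "r \<odot>\<^bsub>Hom_module R (res_module R M (Suc k)) N\<^esub> x \<in> ext_coboundaries R (Suc k) M N"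
        using H.smult_closed[of r f k] r
        by (auto simp: Hom_module_simps bd
            intro!: exI[of _ "r \<odot>\<^bsub>Hom_module R (res_module R M k) N\<^esub> f"])
    qed
    then show ?thesis
      using pull by (auto simp: Suc)
  qed
  show ?thesis
    unfolding Ext_def
    by (rule quotient_module_module[OF submodule.submodule_is_module[OF Z H.module_axioms]
          submodule_subset_module[OF H.module_axioms Z]]) (use B in auto)
qed

end

theory Submission
  imports "HOL-Algebra.Left_Coset" "HOL-Algebra.Sylow" "HOL-Algebra.Multiplicative_Group"
    "HOL-Algebra.Zassenhaus" "HOL-Number_Theory.Cong" Defs
begin

text \<open>
  For square-free \<open>|G|\<close> the marks identify \<open>A(G)\<close> with the functions on conjugacy classes of subgroups
  that satisfy \<open>f K \<equiv> f L (mod p)\<close> whenever \<open>K\<close> is normal of prime index \<open>p\<close> in \<open>L\<close>.  For given \<open>p\<close>,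
  the subgroups linked to \<open>H\<close> in this way, from either side, form at most one conjugacy class.  Let \<open>m\<close>
  be the product of the primes \<open>p\<close> for which there is one.  The element \<open>y\<close> with mark \<open>m\<close> at \<open>H\<close> and \<open>0\<close>
  elsewhere, and a suitable element \<open>x\<close> with mark \<open>0\<close> at \<open>H\<close>, \<open>p\<close> times a unit modulo \<open>|G|\<close> at the
  \<open>p\<close>-neighbours of \<open>H\<close> and \<open>1\<close> elsewhere, lie in \<open>A(G)\<close>.  Then \<open>ker x = y A(G)\<close>, which is isomorphic to
  \<open>\<int>\<^sub>H\<close>, and \<open>x A(G)\<close> has finite index prime to \<open>m\<close> in the kernel of the mark at \<open>H\<close>.  As \<open>m\<close> acts on
  \<open>\<int>\<^sub>H\<close> through the free module \<open>A(G)\<close>, this index is harmless, and \<open>\<int>\<^sub>H\<close> is stably isomorphic to its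
  second syzygy.
\<close>

text \<open>The unit factors in x are forced: a \<open>p\<close>-neighbour \<open>K\<close> of
  \<open>H\<close> may have \<open>q\<close>-neighbours, \<open>q \<noteq> p\<close>, at which the
  mark of x is 1 modulo \<open>q\<close>, so its mark at \<open>K\<close> must be 1 modulo
  \<open>q\<close> besides being 0 modulo \<open>p\<close>. Their price is that the ideal of x is
  too small, up to factors prime to m. The repair: \<open>1 \<mapsto> y\<close> maps
  \<open>\<int>\<^sub>H\<close> into A(G) and the mark at \<open>H\<close> sends y back to m, so
  multiplication by m factors through a free module and is stably zero. A Bezout relation with m
  makes the surplus factor stably invertible. Square-freeness makes the smaller group of a normal
  inclusion of prime index \<open>p\<close> have order prime to \<open>p\<close>, whence the
  uniqueness of neighbours; it makes Weyl groups have square-free order, so that congruences at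
  single primes give all divisibilities; and it provides the units. The modules of the standard
  resolution are too large for explicit computation, so syzygies are compared instead, by maps
  defined on the whole \<open>F n\<close>. Ext in degree \<open>Suc a\<close> is governed by
  \<open>cycles a\<close>, the syzygy of index \<open>a + 1\<close>, so periodicity in all degrees
  \<open>l \<ge> 1\<close> comes from comparing \<open>cycles 0\<close> with
  \<open>cycles 2\<close>.\<close>

section \<open>Linear maps\<close>

text \<open>Unlike \<^const>\<open>module_hom\<close>, this does not ask for extensionality, so that linear maps can be
  composed and combined as plain functions.\<close>

definition linear_map ::
  "('r, 'k) ring_scheme \<Rightarrow> ('r, 'm, 'p) module_scheme \<Rightarrow> ('r, 'n, 'q) module_scheme \<Rightarrow> ('m \<Rightarrow> 'n) \<Rightarrow> bool" where
  "linear_map R M N f \<longleftrightarrow> (\<forall>x \<in> carrier M. f x \<in> carrier N) \<and>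
     (\<forall>x \<in> carrier M. \<forall>y \<in> carrier M. f (x \<oplus>\<^bsub>M\<^esub> y) = f x \<oplus>\<^bsub>N\<^esub> f y) \<and>
     (\<forall>r \<in> carrier R. \<forall>x \<in> carrier M. f (r \<odot>\<^bsub>M\<^esub> x) = r \<odot>\<^bsub>N\<^esub> f x)"

lemma linear_mapI:
  assumes "\<And>x. x \<in> carrier M \<Longrightarrow> f x \<in> carrier N"
    and "\<And>x y. x \<in> carrier M \<Longrightarrow> y \<in> carrier M \<Longrightarrow> f (x \<oplus>\<^bsub>M\<^esub> y) = f x \<oplus>\<^bsub>N\<^esub> f y"
    and "\<And>r x. r \<in> carrier R \<Longrightarrow> x \<in> carrier M \<Longrightarrow> f (r \<odot>\<^bsub>M\<^esub> x) = r \<odot>\<^bsub>N\<^esub> f x"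
  shows "linear_map R M N f"
  using assms by (auto simp: linear_map_def)

lemma linear_mapD:
  assumes "linear_map R M N f"
  shows "x \<in> carrier M \<Longrightarrow> f x \<in> carrier N"
    and "x \<in> carrier M \<Longrightarrow> y \<in> carrier M \<Longrightarrow> f (x \<oplus>\<^bsub>M\<^esub> y) = f x \<oplus>\<^bsub>N\<^esub> f y"
    and "r \<in> carrier R \<Longrightarrow> x \<in> carrier M \<Longrightarrow> f (r \<odot>\<^bsub>M\<^esub> x) = r \<odot>\<^bsub>N\<^esub> f x"
  using assms by (auto simp: linear_map_def)

lemma module_hom_linear: "f \<in> module_hom R M N \<Longrightarrow> linear_map R M N f"
  by (auto simp: linear_map_def module_hom_def)

lemma linear_map_restrict:
  assumes "module R M"
  shows "restrict f (carrier M) \<in> module_hom R M N \<longleftrightarrow> linear_map R M N f"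
proof
  assume "restrict f (carrier M) \<in> module_hom R M N"
  from restrict_module_homD[OF assms this] show "linear_map R M N f"
    by (rule linear_mapI)
next
  interpret M: module R M by fact
  assume "linear_map R M N f"
  from linear_mapD[OF this] show "restrict f (carrier M) \<in> module_hom R M N"
    by (auto intro!: module_homI)
qed

lemma linear_map_zero:
  assumes "module R M" "module R N" "linear_map R M N f"
  shows "f \<zero>\<^bsub>M\<^esub> = \<zero>\<^bsub>N\<^esub>"
proof -
  interpret M: module R M by fact
  interpret N: module R N by fact
  have "f (\<zero>\<^bsub>R\<^esub> \<odot>\<^bsub>M\<^esub> \<zero>\<^bsub>M\<^esub>) = \<zero>\<^bsub>R\<^esub> \<odot>\<^bsub>N\<^esub> f \<zero>\<^bsub>M\<^esub>"
    by (rule linear_mapD(3)[OF assms(3)]) auto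
  then show ?thesis
    using linear_mapD(1)[OF assms(3)] by simp
qed

lemma linear_map_minus:
  assumes "module R M" "module R N" "linear_map R M N f" "x \<in> carrier M" "y \<in> carrier M"
  shows "f (x \<ominus>\<^bsub>M\<^esub> y) = f x \<ominus>\<^bsub>N\<^esub> f y"
proof -
  interpret M: module R M by fact
  interpret N: module R N by fact
  note D = linear_mapD[OF assms(3)]
  have "f (\<ominus>\<^bsub>M\<^esub> y) \<oplus>\<^bsub>N\<^esub> f y = \<zero>\<^bsub>N\<^esub>"
    using D(2)[of "\<ominus>\<^bsub>M\<^esub> y" y] linear_map_zero[OF assms(1-3)] assms(5) by (simp add: M.M.l_neg)
  then have "f (\<ominus>\<^bsub>M\<^esub> y) = \<ominus>\<^bsub>N\<^esub> f y"
    using D(1) assms(5) by (simp add: N.M.minus_equality[symmetric])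
  then show ?thesis
    using assms(4,5) D by (simp add: M.M.minus_eq N.M.minus_eq)
qed

lemma linear_map_comp:
  "linear_map R M N f \<Longrightarrow> linear_map R N P g \<Longrightarrow> linear_map R M P (\<lambda>x. g (f x))"
  by (simp add: linear_map_def)

lemma linear_map_id: "linear_map R M M (\<lambda>x. x)"
  by (simp add: linear_map_def)

context
  fixes R :: "('r, 'k) ring_scheme" and N :: "('r, 'n, 'q) module_scheme"
  assumes N: "module R N"
begin

interpretation N: module R N by (rule N)

lemma linear_map_add:
  "linear_map R M N f \<Longrightarrow> linear_map R M N g \<Longrightarrow> linear_map R M N (\<lambda>x. f x \<oplus>\<^bsub>N\<^esub> g x)"
  by (rule linear_mapI) (simp_all add: linear_mapD N.smult_r_distr N.M.a_ac)

lemma linear_map_smult: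
  "a \<in> carrier R \<Longrightarrow> linear_map R M N f \<Longrightarrow> linear_map R M N (\<lambda>x. a \<odot>\<^bsub>N\<^esub> f x)"
  by (rule linear_mapI) (simp_all add: linear_mapD N.smult_r_distr N.smult_assoc1[symmetric] N.R.m_comm)

lemma linear_map_diff:
  assumes "linear_map R M N f" "linear_map R M N g"
  shows "linear_map R M N (\<lambda>x. f x \<ominus>\<^bsub>N\<^esub> g x)"
  by (rule linear_mapI)
    (simp_all add: linear_mapD[OF assms(1)] linear_mapD[OF assms(2)] N.smult_r_distr N.smult_r_minus
      N.M.minus_eq N.M.minus_add N.M.a_ac)

end

definition regular_module :: "('r, 'k) ring_scheme \<Rightarrow> ('r, 'r) module" where
  "regular_module R = \<lparr>carrier = carrier R, monoid.mult = monoid.mult R, one = one R, zero = zero R, add = add R,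
     smult = monoid.mult R\<rparr>"

lemma regular_module_simps:
  "carrier (regular_module R) = carrier R"
  "\<zero>\<^bsub>regular_module R\<^esub> = \<zero>\<^bsub>R\<^esub>"
  "a \<oplus>\<^bsub>regular_module R\<^esub> b = a \<oplus>\<^bsub>R\<^esub> b"
  "a \<odot>\<^bsub>regular_module R\<^esub> b = a \<otimes>\<^bsub>R\<^esub> b"
  by (simp_all add: regular_module_def)

lemma regular_module_module:
  assumes "cring R"
  shows "module R (regular_module R)"
proof -
  interpret R: cring R by fact
  have "abelian_group (regular_module R)"
    by (rule abelian_groupI) (auto simp: regular_module_simps R.a_ac intro: R.l_neg)
  then show ?thesis
    using assms by (intro moduleI) (auto simp: regular_module_simps R.l_distr R.r_distr R.m_assoc)
qed

lemma linear_map_scale: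
  assumes "module R N" "n \<in> carrier N" "linear_map R M (regular_module R) c"
  shows "linear_map R M N (\<lambda>x. c x \<odot>\<^bsub>N\<^esub> n)"
proof -
  interpret N: module R N by fact
  show ?thesis
    using linear_mapD[OF assms(3)] assms(2)
    by (intro linear_mapI) (auto simp: regular_module_simps N.smult_l_distr N.smult_assoc1)
qed


section \<open>Free modules are projective\<close>

text \<open>Induction on the support: \<open>u\<close> is a multiple of one basis vector plus a
  function with one point less in its support.\<close>

lemma free_module_linear_ext:
  assumes "cring R" "module R C"
    and f: "linear_map R (free_module R B) C f" and g: "linear_map R (free_module R B) C g"
    and eq: "\<And>b. b \<in> B \<Longrightarrow> f (free_unit R b) = g (free_unit R b)"
    and u: "u \<in> carrier (free_module R B)"
  shows "f u = g u"
proof -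
  interpret R: cring R by fact
  interpret C: module R C by fact
  let ?F = "free_module R B"
  interpret F: module R ?F using assms(1) by (rule free_module_module)
  have "finite A \<Longrightarrow> u \<in> carrier ?F \<Longrightarrow> {b. u b \<noteq> \<zero>\<^bsub>R\<^esub>} = A \<Longrightarrow> f u = g u" for A u
  proof (induction A arbitrary: u rule: finite_induct)
    case empty
    then have "u = \<zero>\<^bsub>?F\<^esub>" by (auto simp: free_module_simps)
    then show ?case
      using linear_map_zero[OF F.module_axioms assms(2) f] linear_map_zero[OF F.module_axioms assms(2) g] by simp
  next
    case (insert a A)
    let ?v = "u(a := \<zero>\<^bsub>R\<^esub>)" and ?w = "u a \<odot>\<^bsub>?F\<^esub> free_unit R a"
    have car: "u b \<in> carrier R" for b using insert.prems by (simp add: free_module_carrier)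
    have a: "a \<in> B" using insert.prems by (auto simp: free_module_carrier)
    have e: "free_unit R a \<in> carrier ?F" by (rule free_unit_closed[OF assms(1) a])
    have supp: "{b. ?v b \<noteq> \<zero>\<^bsub>R\<^esub>} = A" using insert by auto
    have v: "?v \<in> carrier ?F"
      using insert.prems supp insert.hyps by (auto simp: free_module_carrier)
    have "u = ?w \<oplus>\<^bsub>?F\<^esub> ?v"
      by (rule HOL.ext) (simp add: free_module_simps free_unit_def car)
    then have "f u = f (?w \<oplus>\<^bsub>?F\<^esub> ?v)" "g u = g (?w \<oplus>\<^bsub>?F\<^esub> ?v)"
      by (rule arg_cong)+
    note u = trans[OF this(1) linear_mapD(2)[OF f F.smult_closed[OF car e] v]]
      trans[OF this(2) linear_mapD(2)[OF g F.smult_closed[OF car e] v]]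
    have "f ?w = g ?w"
      using linear_mapD(3)[OF f car e] linear_mapD(3)[OF g car e] eq[OF a] by simp
    then show ?case
      using u insert.IH[OF v supp] by (simp only:)
  qed
  moreover have "finite {b. u b \<noteq> \<zero>\<^bsub>R\<^esub>}" using u by (simp add: free_module_carrier)
  ultimately show ?thesis using u by blast
qed

text \<open>Projectivity in a relative form: \<open>g\<close> has to reach only the values of
  \<open>f\<close>. This suits lifting along a boundary map, whose image is a module of
  cycles.\<close>

lemma free_module_lift:
  assumes R: "cring R" and A: "module R A" and C: "module R C"
    and f: "linear_map R (free_module R B) C f" and g: "linear_map R A C g"
    and im: "\<And>u. u \<in> carrier (free_module R B) \<Longrightarrow> f u \<in> g ` carrier A"
  shows "\<exists>h. linear_map R (free_module R B) A h \<and> (\<forall>u \<in> carrier (free_module R B). g (h u) = f u)"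
proof -
  let ?F = "free_module R B"
  define h where "h b = inv_into (carrier A) g (f (free_unit R b))" for b
  have h: "h b \<in> carrier A" "g (h b) = f (free_unit R b)" if "b \<in> B" for b
    unfolding h_def by (rule inv_into_into[OF im[OF free_unit_closed[OF R that]]])
      (rule f_inv_into_f[OF im[OF free_unit_closed[OF R that]]])
  have L: "linear_map R ?F A (free_lift R A h)"
    by (rule iffD1[OF linear_map_restrict[OF free_module_module[OF R]] free_lift_hom[OF A h(1)]])
  have "g (free_lift R A h u) = f u" if "u \<in> carrier ?F" for u
    by (rule free_module_linear_ext[OF R C linear_map_comp[OF L g] f _ that])
      (simp add: free_lift_unit[OF A] h)
  with L show ?thesis by blast
qed

section \<open>Isomorphisms of quotient modules\<close>

lemma submodule_coset_eq_iff:
  assumes "module R M" "submodule U R M" "x \<in> carrier M" "y \<in> carrier M"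
  shows "U +>\<^bsub>M\<^esub> x = U +>\<^bsub>M\<^esub> y \<longleftrightarrow> x \<ominus>\<^bsub>M\<^esub> y \<in> U"
proof -
  interpret M: module R M by fact
  interpret U: submodule U R M by fact
  interpret A: abelian_subgroup U M
    by (rule abelian_subgroupI3[OF additive_subgroup.intro[OF U.subgroup_axioms] M.M.abelian_group_axioms])
  have "U +>\<^bsub>M\<^esub> x = U +>\<^bsub>M\<^esub> y \<longleftrightarrow> x \<in> U +>\<^bsub>M\<^esub> y"
    using A.a_rcos_self[OF assms(3)] A.a_repr_independence'[of x y] assms(3,4) by metis
  also have "\<dots> \<longleftrightarrow> x \<ominus>\<^bsub>M\<^esub> y \<in> U"
    using A.a_rcos_module[OF assms(4,3)] assms(3,4) by (simp add: M.M.minus_eq)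
  finally show ?thesis .
qed

lemma submodule_coset_add:
  assumes "module R M" "submodule U R M" "x \<in> carrier M" "u \<in> U"
  shows "U +>\<^bsub>M\<^esub> (u \<oplus>\<^bsub>M\<^esub> x) = U +>\<^bsub>M\<^esub> x"
proof -
  interpret M: module R M by fact
  interpret U: submodule U R M by fact
  have u: "u \<in> carrier M" using U.mem_carrier[OF assms(4)] by simp
  then have "u \<oplus>\<^bsub>M\<^esub> x \<ominus>\<^bsub>M\<^esub> x = u"
    using assms(3) by (simp add: M.M.minus_eq M.M.a_assoc M.M.r_neg)
  then show ?thesis
    using u assms by (subst submodule_coset_eq_iff[OF assms(1,2)]) auto
qed

lemma quotient_module_carrier:
  "carrier (quotient_module M U) = {U +>\<^bsub>M\<^esub> x | x. x \<in> carrier M}"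
  by (auto simp: quotient_module_def A_RCOSETS_def')

lemma quotient_module_ops:
  assumes "module R M" "submodule U R M" "x \<in> carrier M"
  shows quotient_module_add: "y \<in> carrier M \<Longrightarrow>
      (U +>\<^bsub>M\<^esub> x) \<oplus>\<^bsub>quotient_module M U\<^esub> (U +>\<^bsub>M\<^esub> y) = U +>\<^bsub>M\<^esub> (x \<oplus>\<^bsub>M\<^esub> y)"
    and quotient_module_smult: "r \<in> carrier R \<Longrightarrow>
      r \<odot>\<^bsub>quotient_module M U\<^esub> (U +>\<^bsub>M\<^esub> x) = U +>\<^bsub>M\<^esub> (r \<odot>\<^bsub>M\<^esub> x)"
proof -
  interpret M: module R M by fact
  interpret U: submodule U R M by fact
  interpret A: abelian_subgroup U M
    by (rule abelian_subgroupI3[OF additive_subgroup.intro[OF U.subgroup_axioms] M.M.abelian_group_axioms])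
  show "(U +>\<^bsub>M\<^esub> x) \<oplus>\<^bsub>quotient_module M U\<^esub> (U +>\<^bsub>M\<^esub> y) = U +>\<^bsub>M\<^esub> (x \<oplus>\<^bsub>M\<^esub> y)"
    if "y \<in> carrier M"
    using A.a_rcos_sum[OF assms(3) that] by (simp add: quotient_module_def)
  show "r \<odot>\<^bsub>quotient_module M U\<^esub> (U +>\<^bsub>M\<^esub> x) = U +>\<^bsub>M\<^esub> (r \<odot>\<^bsub>M\<^esub> x)" if r: "r \<in> carrier R"
  proof -
    have "U +>\<^bsub>M\<^esub> (r \<odot>\<^bsub>M\<^esub> y) = U +>\<^bsub>M\<^esub> (r \<odot>\<^bsub>M\<^esub> x)" if "y \<in> U +>\<^bsub>M\<^esub> x" for y
    proof -
      from that obtain u where u: "u \<in> U" "y = u \<oplus>\<^bsub>M\<^esub> x"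
        by (auto simp: a_r_coset_def')
      have uM: "u \<in> carrier M" using U.mem_carrier[OF u(1)] by simp
      have "r \<odot>\<^bsub>M\<^esub> y \<ominus>\<^bsub>M\<^esub> r \<odot>\<^bsub>M\<^esub> x = r \<odot>\<^bsub>M\<^esub> u"
        using u(2) uM assms(3) r by (simp add: M.smult_r_distr M.M.minus_eq M.M.a_assoc M.M.r_neg)
      then show ?thesis
        using u uM r assms(3) U.smult_closed[OF r u(1)]
        by (subst submodule_coset_eq_iff[OF assms(1,2)]) auto
    qed
    moreover have "x \<in> U +>\<^bsub>M\<^esub> x"
      using assms(3) A.a_rcos_self by blast
    ultimately have "(\<Union>y \<in> U +>\<^bsub>M\<^esub> x. U +>\<^bsub>M\<^esub> (r \<odot>\<^bsub>M\<^esub> y)) = U +>\<^bsub>M\<^esub> (r \<odot>\<^bsub>M\<^esub> x)"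
      by blast
    then show ?thesis
      by (simp add: quotient_module_def)
  qed
qed

text \<open>Maps on representatives that are inverse to each other modulo the submodules suffice, so
  Ext can be compared by pulling back cocycles, without handling cosets.\<close>

lemma quotient_module_iso:
  assumes M: "module R M" "submodule U R M" and N: "module R N" "submodule V R N"
    and f: "linear_map R M N f" "\<And>x. x \<in> U \<Longrightarrow> f x \<in> V"
    and g: "linear_map R N M g" "\<And>x. x \<in> V \<Longrightarrow> g x \<in> U"
    and gf: "\<And>x. x \<in> carrier M \<Longrightarrow> \<exists>u \<in> U. g (f x) = u \<oplus>\<^bsub>M\<^esub> x"
    and fg: "\<And>x. x \<in> carrier N \<Longrightarrow> \<exists>v \<in> V. f (g x) = v \<oplus>\<^bsub>N\<^esub> x"
  shows "module_iso R (quotient_module M U) (quotient_module N V)"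
proof -
  interpret M: module R M by fact
  interpret N: module R N by fact
  interpret U: submodule U R M by fact
  interpret A: abelian_subgroup U M
    by (rule abelian_subgroupI3[OF additive_subgroup.intro[OF U.subgroup_axioms] M.M.abelian_group_axioms])
  note ceM = submodule_coset_eq_iff[OF M] and ceN = submodule_coset_eq_iff[OF N]
  note fc = linear_mapD(1)[OF f(1)] and gc = linear_mapD(1)[OF g(1)]
  have gfU: "U +>\<^bsub>M\<^esub> g (f x) = U +>\<^bsub>M\<^esub> x" if "x \<in> carrier M" for x
    using gf[OF that] that submodule_coset_add[OF M] by metis
  have fgV: "V +>\<^bsub>N\<^esub> f (g x) = V +>\<^bsub>N\<^esub> x" if "x \<in> carrier N" for x
    using fg[OF that] that submodule_coset_add[OF N] by metis
  \<comment> \<open>For a coset \<open>C\<close> all sets in this union coincide, so no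
    representative has to be chosen.\<close>
  define \<Phi> where "\<Phi> C = (\<Union>x \<in> C. V +>\<^bsub>N\<^esub> f x)" for C
  have eq: "V +>\<^bsub>N\<^esub> f x = V +>\<^bsub>N\<^esub> f y \<longleftrightarrow> U +>\<^bsub>M\<^esub> x = U +>\<^bsub>M\<^esub> y"
    if x: "x \<in> carrier M" and y: "y \<in> carrier M" for x y
  proof -
    have "f (x \<ominus>\<^bsub>M\<^esub> y) = f x \<ominus>\<^bsub>N\<^esub> f y"
      by (rule linear_map_minus[OF M(1) N(1) f(1) x y])
    then have "f x \<ominus>\<^bsub>N\<^esub> f y \<in> V" if "x \<ominus>\<^bsub>M\<^esub> y \<in> U"
      using f(2)[OF that] by simp
    moreover have "U +>\<^bsub>M\<^esub> x = U +>\<^bsub>M\<^esub> y" if "f x \<ominus>\<^bsub>N\<^esub> f y \<in> V"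
    proof -
      have "g (f x) \<ominus>\<^bsub>M\<^esub> g (f y) \<in> U"
        using g(2)[OF that] linear_map_minus[OF N(1) M(1) g(1) fc[OF x] fc[OF y]] by simp
      then have "U +>\<^bsub>M\<^esub> g (f x) = U +>\<^bsub>M\<^esub> g (f y)"
        using ceM x y fc gc by blast
      then show ?thesis using x y gfU by simp
    qed
    ultimately show ?thesis
      using ceM[OF x y] ceN[OF fc[OF x] fc[OF y]] by blast
  qed
  have \<Phi>: "\<Phi> (U +>\<^bsub>M\<^esub> x) = V +>\<^bsub>N\<^esub> f x" if x: "x \<in> carrier M" for x
  proof -
    have "y \<in> carrier M" "U +>\<^bsub>M\<^esub> y = U +>\<^bsub>M\<^esub> x" if "y \<in> U +>\<^bsub>M\<^esub> x" for y
      using that x A.a_repr_independence'[OF that x] A.a_elemrcos_carrier[OF x that] by auto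
    then have "V +>\<^bsub>N\<^esub> f y = V +>\<^bsub>N\<^esub> f x" if "y \<in> U +>\<^bsub>M\<^esub> x" for y
      using eq[OF _ x] that by blast
    moreover have "x \<in> U +>\<^bsub>M\<^esub> x" by (rule A.a_rcos_self[OF x])
    ultimately show ?thesis unfolding \<Phi>_def by blast
  qed
  have lin: "linear_map R (quotient_module M U) (quotient_module N V) \<Phi>"
  proof (rule linear_mapI)
    fix C D assume "C \<in> carrier (quotient_module M U)" "D \<in> carrier (quotient_module M U)"
    then obtain x y where "x \<in> carrier M" "C = U +>\<^bsub>M\<^esub> x" "y \<in> carrier M" "D = U +>\<^bsub>M\<^esub> y"
      by (auto simp: quotient_module_carrier)
    then show "\<Phi> (C \<oplus>\<^bsub>quotient_module M U\<^esub> D) = \<Phi> C \<oplus>\<^bsub>quotient_module N V\<^esub> \<Phi> D"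
      by (simp add: quotient_module_add[OF M] quotient_module_add[OF N] \<Phi> fc linear_mapD(2)[OF f(1)])
  next
    fix r C assume "r \<in> carrier R" "C \<in> carrier (quotient_module M U)"
    then show "\<Phi> (r \<odot>\<^bsub>quotient_module M U\<^esub> C) = r \<odot>\<^bsub>quotient_module N V\<^esub> \<Phi> C"
      by (auto simp: quotient_module_carrier quotient_module_smult[OF M] quotient_module_smult[OF N] \<Phi> fc
          linear_mapD(3)[OF f(1)])
  qed (use \<Phi> fc in \<open>auto simp: quotient_module_carrier\<close>)
  have "bij_betw \<Phi> (carrier (quotient_module M U)) (carrier (quotient_module N V))"
  proof (rule bij_betw_imageI)
    show "inj_on \<Phi> (carrier (quotient_module M U))"
      by (rule inj_onI) (auto simp: quotient_module_carrier \<Phi> eq)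
    show "\<Phi> ` carrier (quotient_module M U) = carrier (quotient_module N V)"
    proof
      show "\<Phi> ` carrier (quotient_module M U) \<subseteq> carrier (quotient_module N V)"
        using linear_mapD(1)[OF lin] by blast
      show "carrier (quotient_module N V) \<subseteq> \<Phi> ` carrier (quotient_module M U)"
      proof
        fix D assume "D \<in> carrier (quotient_module N V)"
        then obtain y where y: "y \<in> carrier N" "D = V +>\<^bsub>N\<^esub> y" by (auto simp: quotient_module_carrier)
        then have "D = \<Phi> (U +>\<^bsub>M\<^esub> g y)"
          using fgV[OF y(1)] \<Phi>[OF gc[OF y(1)]] by simp
        then show "D \<in> \<Phi> ` carrier (quotient_module M U)"
          using gc[OF y(1)] by (auto simp: quotient_module_carrier)
      qed
    qed
  qed
  moreover have "restrict \<Phi> (carrier (quotient_module M U)) \<in> module_hom R (quotient_module M U) (quotient_module N V)"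
    using linear_map_restrict[OF quotient_module_module[OF M]] lin by blast
  moreover have "bij_betw (restrict \<Phi> (carrier (quotient_module M U))) (carrier (quotient_module M U))
      (carrier (quotient_module N V)) = bij_betw \<Phi> (carrier (quotient_module M U)) (carrier (quotient_module N V))"
    by (rule bij_betw_cong) simp
  ultimately show ?thesis
    unfolding module_iso_def by blast
qed

section \<open>Syzygies of the standard resolution\<close>

locale resolved_module = module R M for R (structure) and M (structure)
begin

abbreviation F where "F n \<equiv> res_module R M n"
abbreviation bd where "bd \<equiv> res_boundary R"
abbreviation eps where "eps \<equiv> res_augmentation R M"

text \<open>The syzygy of index \<open>n + 1\<close>. As an image it is uniform in \<open>n\<close>;
  as a kernel it involves the augmentation when \<open>n = 0\<close>.\<close>

definition cycles where "cycles n = bd ` carrier (F (Suc n))"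

lemma F_module: "module R (F n)"
  by (rule res_module_module[OF module_axioms])

sublocale F: module R "F n" for n
  by (rule F_module)

lemma bd_linear: "linear_map R (F (Suc n)) (F n) bd"
  by (rule iffD1[OF linear_map_restrict[OF F_module] res_boundary_hom[OF module_axioms]])

lemma eps_linear: "linear_map R (F 0) M eps"
  by (rule iffD1[OF linear_map_restrict[OF F_module] res_augmentation_hom[OF module_axioms]])

lemmas bd_simps = linear_mapD[OF bd_linear] linear_map_zero[OF F_module F_module bd_linear]
  linear_map_minus[OF F_module F_module bd_linear]

lemmas eps_simps = linear_mapD[OF eps_linear] linear_map_zero[OF F_module module_axioms eps_linear]
  linear_map_minus[OF F_module module_axioms eps_linear]

lemma cycles_0: "cycles 0 = {u \<in> carrier (F 0). eps u = \<zero>\<^bsub>M\<^esub>}"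
  unfolding cycles_def by (rule res_exact_0[OF module_axioms])

lemma cycles_Suc: "cycles (Suc n) = {u \<in> carrier (F (Suc n)). bd u = \<zero>\<^bsub>F n\<^esub>}"
  unfolding cycles_def by (rule res_exact_Suc[OF module_axioms])

lemma cycles_closed: "u \<in> cycles n \<Longrightarrow> u \<in> carrier (F n)"
  by (cases n) (simp_all add: cycles_0 cycles_Suc)

lemma bd_cycles: "u \<in> carrier (F (Suc n)) \<Longrightarrow> bd u \<in> cycles n"
  by (simp add: cycles_def)

lemma bd_bd: "u \<in> carrier (F (Suc (Suc n))) \<Longrightarrow> bd (bd u) = \<zero>\<^bsub>F n\<^esub>"
  using bd_cycles[of u "Suc n"] by (simp add: cycles_Suc)

lemma eps_bd: "u \<in> carrier (F (Suc 0)) \<Longrightarrow> eps (bd u) = \<zero>\<^bsub>M\<^esub>"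
  using bd_cycles[of u 0] by (simp add: cycles_0)

lemma res_lift:
  assumes "module R A" "module R C" "linear_map R (F n) C f" "linear_map R A C g"
    "\<And>u. u \<in> carrier (F n) \<Longrightarrow> f u \<in> g ` carrier A"
  shows "\<exists>h. linear_map R (F n) A h \<and> (\<forall>u \<in> carrier (F n). g (h u) = f u)"
  using assms free_module_lift[OF R.cring_axioms, of A C "res_basis R M n" f g] unfolding res_module_def by blast

lemma cycles_lift:
  assumes "linear_map R (F n) (F m) f" "\<And>u. u \<in> carrier (F n) \<Longrightarrow> f u \<in> cycles m"
  shows "\<exists>h. linear_map R (F n) (F (Suc m)) h \<and> (\<forall>u \<in> carrier (F n). bd (h u) = f u)"
  by (rule res_lift[OF F_module F_module assms(1) bd_linear]) (use assms(2) in \<open>simp add: cycles_def\<close>)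

text \<open>The maps witness an isomorphism of the syzygies \<open>cycles a\<close> and \<open>cycles b\<close> in the stable
  category: they are inverse to each other up to maps that factor through a free module.\<close>

definition half_stable_inverse where
  "half_stable_inverse a b \<alpha> \<gamma> \<longleftrightarrow> linear_map R (F a) (F b) \<alpha> \<and> (\<forall>u \<in> cycles a. \<alpha> u \<in> cycles b) \<and>
     (\<exists>k. linear_map R (F a) (F a) k \<and> (\<forall>u \<in> carrier (F a). k u \<in> cycles a) \<and>
       (\<forall>u \<in> cycles a. \<gamma> (\<alpha> u) = u \<oplus>\<^bsub>F a\<^esub> k u))"

definition stably_iso where
  "stably_iso a b \<longleftrightarrow> (\<exists>\<alpha> \<gamma>. half_stable_inverse a b \<alpha> \<gamma> \<and> half_stable_inverse b a \<gamma> \<alpha>)"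

text \<open>The shift of syzygies on maps: \<open>\<alpha>\<close> takes boundaries to boundaries,
  so freeness of \<open>F (Suc a)\<close> lifts it one degree up.\<close>

lemma lift_step:
  assumes "linear_map R (F a) (F b) \<alpha>" "\<And>u. u \<in> cycles a \<Longrightarrow> \<alpha> u \<in> cycles b"
  shows "\<exists>\<alpha>'. linear_map R (F (Suc a)) (F (Suc b)) \<alpha>' \<and> (\<forall>u \<in> carrier (F (Suc a)). bd (\<alpha>' u) = \<alpha> (bd u))"
  by (rule cycles_lift[OF linear_map_comp[OF bd_linear assms(1)]]) (use assms(2) bd_cycles in blast)

text \<open>As \<open>k\<close> has values in cycles, it lifts along the boundary to
  \<open>\<kappa>\<close>. The difference of \<open>\<gamma>' \<circ> \<alpha>'\<close> and the
  identity has the same boundary as \<open>\<kappa> \<circ> bd\<close>, so what remains is a cycle.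
  The equation holds on all of \<open>F (Suc a)\<close>, as the comparison of cocycles
  requires.\<close>

lemma homotopy_step:
  assumes \<alpha>': "linear_map R (F (Suc a)) (F (Suc b)) \<alpha>'" "\<And>u. u \<in> carrier (F (Suc a)) \<Longrightarrow> bd (\<alpha>' u) = \<alpha> (bd u)"
    and \<gamma>': "linear_map R (F (Suc b)) (F (Suc a)) \<gamma>'" "\<And>u. u \<in> carrier (F (Suc b)) \<Longrightarrow> bd (\<gamma>' u) = \<gamma> (bd u)"
    and "half_stable_inverse a b \<alpha> \<gamma>"
  shows "\<exists>\<kappa> k. linear_map R (F a) (F (Suc a)) \<kappa> \<and> linear_map R (F (Suc a)) (F (Suc a)) k \<and>
    (\<forall>u \<in> carrier (F (Suc a)). k u \<in> cycles (Suc a) \<and>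
      \<gamma>' (\<alpha>' u) = (u \<oplus>\<^bsub>F (Suc a)\<^esub> \<kappa> (bd u)) \<oplus>\<^bsub>F (Suc a)\<^esub> k u)"
proof -
  obtain k where k: "linear_map R (F a) (F a) k" "\<And>u. u \<in> carrier (F a) \<Longrightarrow> k u \<in> cycles a"
      "\<And>u. u \<in> cycles a \<Longrightarrow> \<gamma> (\<alpha> u) = u \<oplus>\<^bsub>F a\<^esub> k u"
    using assms(5) unfolding half_stable_inverse_def by blast
  obtain \<kappa> where \<kappa>: "linear_map R (F a) (F (Suc a)) \<kappa>" "\<And>u. u \<in> carrier (F a) \<Longrightarrow> bd (\<kappa> u) = k u"
    using cycles_lift[OF k(1,2)] by blast
  let ?s = "\<lambda>u. u \<oplus>\<^bsub>F (Suc a)\<^esub> \<kappa> (bd u)"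
  let ?k = "\<lambda>u. \<gamma>' (\<alpha>' u) \<ominus>\<^bsub>F (Suc a)\<^esub> ?s u"
  have sl: "linear_map R (F (Suc a)) (F (Suc a)) ?s"
    by (rule linear_map_add[OF F_module linear_map_id linear_map_comp[OF bd_linear \<kappa>(1)]])
  have kl: "linear_map R (F (Suc a)) (F (Suc a)) ?k"
    by (rule linear_map_diff[OF F_module linear_map_comp[OF \<alpha>'(1) \<gamma>'(1)] sl])
  have "?k u \<in> cycles (Suc a)" "\<gamma>' (\<alpha>' u) = ?s u \<oplus>\<^bsub>F (Suc a)\<^esub> ?k u" if u: "u \<in> carrier (F (Suc a))" for u
  proof -
    have c: "\<gamma>' (\<alpha>' u) \<in> carrier (F (Suc a))" "?s u \<in> carrier (F (Suc a))" "\<kappa> (bd u) \<in> carrier (F (Suc a))"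
      using linear_mapD(1)[OF linear_map_comp[OF \<alpha>'(1) \<gamma>'(1)] u] linear_mapD(1)[OF sl u]
        linear_mapD(1)[OF linear_map_comp[OF bd_linear \<kappa>(1)] u] .
    have "bd (\<gamma>' (\<alpha>' u)) = bd u \<oplus>\<^bsub>F a\<^esub> k (bd u)"
      using \<gamma>'(2)[OF linear_mapD(1)[OF \<alpha>'(1) u]] \<alpha>'(2)[OF u] k(3)[OF bd_cycles[OF u]] by simp
    also have "\<dots> = bd (?s u)"
      using u c bd_simps(1)[OF u] by (simp add: bd_simps \<kappa>(2))
    finally have "bd (?k u) = \<zero>\<^bsub>F a\<^esub>"
      using bd_simps(5)[OF c(1,2)] bd_simps(1)[OF c(1)] bd_simps(1)[OF c(2)]
      by (simp add: F.M.minus_eq F.M.r_neg)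
    then show "?k u \<in> cycles (Suc a)"
      using linear_mapD(1)[OF kl u] by (simp add: cycles_Suc)
    show "\<gamma>' (\<alpha>' u) = ?s u \<oplus>\<^bsub>F (Suc a)\<^esub> ?k u"
      using c by (simp add: F.M.minus_eq F.M.a_lcomm F.M.r_neg)
  qed
  then show ?thesis using \<kappa>(1) kl by blast
qed

text \<open>On cycles the term \<open>\<kappa> \<circ> bd\<close> of the homotopy vanishes, which
  leaves only \<open>k\<close>.\<close>

lemma stable_inverse_step:
  assumes \<alpha>': "linear_map R (F (Suc a)) (F (Suc b)) \<alpha>'" "\<And>u. u \<in> carrier (F (Suc a)) \<Longrightarrow> bd (\<alpha>' u) = \<alpha> (bd u)"
    and \<gamma>': "linear_map R (F (Suc b)) (F (Suc a)) \<gamma>'" "\<And>u. u \<in> carrier (F (Suc b)) \<Longrightarrow> bd (\<gamma>' u) = \<gamma> (bd u)"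
    and "half_stable_inverse a b \<alpha> \<gamma>"
  shows "half_stable_inverse (Suc a) (Suc b) \<alpha>' \<gamma>'"
proof -
  obtain \<kappa> k where \<kappa>: "linear_map R (F a) (F (Suc a)) \<kappa>" and k: "linear_map R (F (Suc a)) (F (Suc a)) k"
      "\<And>u. u \<in> carrier (F (Suc a)) \<Longrightarrow> k u \<in> cycles (Suc a)"
      "\<And>u. u \<in> carrier (F (Suc a)) \<Longrightarrow> \<gamma>' (\<alpha>' u) = (u \<oplus>\<^bsub>F (Suc a)\<^esub> \<kappa> (bd u)) \<oplus>\<^bsub>F (Suc a)\<^esub> k u"
    using homotopy_step[OF assms] by blast
  have \<alpha>: "linear_map R (F a) (F b) \<alpha>"
    using assms(5) unfolding half_stable_inverse_def by blast
  have "\<gamma>' (\<alpha>' u) = u \<oplus>\<^bsub>F (Suc a)\<^esub> k u" "\<alpha>' u \<in> cycles (Suc b)" if "u \<in> cycles (Suc a)" for u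
  proof -
    have u: "u \<in> carrier (F (Suc a))" "bd u = \<zero>\<^bsub>F a\<^esub>" using that by (simp_all add: cycles_Suc)
    show "\<gamma>' (\<alpha>' u) = u \<oplus>\<^bsub>F (Suc a)\<^esub> k u"
      using k(3)[OF u(1)] u linear_map_zero[OF F_module F_module \<kappa>] by simp
    show "\<alpha>' u \<in> cycles (Suc b)"
      using \<alpha>'(2)[OF u(1)] u linear_mapD(1)[OF \<alpha>'(1) u(1)] linear_map_zero[OF F_module F_module \<alpha>]
      by (simp add: cycles_Suc)
  qed
  then show ?thesis
    unfolding half_stable_inverse_def using \<alpha>'(1) k(1,2) by blast
qed

text \<open>One pair of lifts serves both directions, so that the two homotopies concern the same
  maps.\<close>

lemma stable_lifts:
  assumes "stably_iso a b"
  shows "\<exists>\<alpha> \<gamma> \<alpha>' \<gamma>'. half_stable_inverse a b \<alpha> \<gamma> \<and> half_stable_inverse b a \<gamma> \<alpha> \<and>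
     linear_map R (F (Suc a)) (F (Suc b)) \<alpha>' \<and> (\<forall>u \<in> carrier (F (Suc a)). bd (\<alpha>' u) = \<alpha> (bd u)) \<and>
     linear_map R (F (Suc b)) (F (Suc a)) \<gamma>' \<and> (\<forall>u \<in> carrier (F (Suc b)). bd (\<gamma>' u) = \<gamma> (bd u))"
proof -
  obtain \<alpha> \<gamma> where h: "half_stable_inverse a b \<alpha> \<gamma>" "half_stable_inverse b a \<gamma> \<alpha>"
    using assms unfolding stably_iso_def by blast
  then show ?thesis
    using lift_step[of a b \<alpha>] lift_step[of b a \<gamma>] unfolding half_stable_inverse_def by blast
qed

lemma stably_iso_Suc:
  assumes "stably_iso a b"
  shows "stably_iso (Suc a) (Suc b)"
  using stable_lifts[OF assms] stable_inverse_step unfolding stably_iso_def by metis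

lemma stably_iso_add:
  "stably_iso a b \<Longrightarrow> stably_iso (n + a) (n + b)"
  by (induction n) (simp_all add: stably_iso_Suc)

section \<open>Invariance of Ext under stable isomorphism of syzygies\<close>

lemma ext_cocycles_submodule:
  assumes N: "module R N"
  shows "submodule (ext_cocycles R n M N) R (Hom_module R (F n) N)"
proof -
  interpret N: module R N by fact
  interpret H: module R "Hom_module R (F n) N" by (rule Hom_module_module[OF F_module N])
  show ?thesis
    by (rule H.submoduleI')
      (use H.M.zero_closed H.M.a_closed H.smult_closed bd_simps(1) in
        \<open>auto simp: ext_cocycles_def Hom_module_simps\<close>)
qed

lemma pullback_coboundary:
  assumes f: "linear_map R (F n) N f"
  shows "(\<lambda>x \<in> carrier (F (Suc n)). f (bd x)) \<in> ext_coboundaries R (Suc n) M N"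
proof -
  have "restrict f (carrier (F n)) \<in> module_hom R (F n) N"
    using f linear_map_restrict[OF F_module] by blast
  moreover have "(\<lambda>x \<in> carrier (F (Suc n)). f (bd x)) = (\<lambda>x \<in> carrier (F (Suc n)). restrict f (carrier (F n)) (bd x))"
    by (rule restrict_ext) (simp add: bd_simps(1))
  ultimately show ?thesis unfolding ext_coboundaries.simps by blast
qed

lemma pullback_cocycle:
  assumes f: "linear_map R (F n) N f" "\<And>x. x \<in> cycles n \<Longrightarrow> f x = \<zero>\<^bsub>N\<^esub>"
  shows "restrict f (carrier (F n)) \<in> ext_cocycles R n M N"
proof -
  have "restrict f (carrier (F n)) \<in> module_hom R (F n) N"
    using f(1) linear_map_restrict[OF F_module] by blast
  then show ?thesis
    using f(2) bd_cycles by (simp add: ext_cocycles_def bd_simps(1))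
qed

lemma ext_cocyclesD:
  assumes "f \<in> ext_cocycles R n M N"
  shows "linear_map R (F n) N f" "x \<in> cycles n \<Longrightarrow> f x = \<zero>\<^bsub>N\<^esub>" "f \<in> extensional (carrier (F n))"
  using assms module_hom_linear[of f R "F n" N]
  by (auto simp: ext_cocycles_def cycles_def module_hom_def PiE_def)

lemma ext_coboundariesE:
  assumes "f \<in> ext_coboundaries R (Suc n) M N"
  obtains g where "linear_map R (F n) N g" "f = (\<lambda>x \<in> carrier (F (Suc n)). g (bd x))"
  using assms module_hom_linear[of _ R "F n" N] unfolding ext_coboundaries.simps by blast

lemma ext_coboundaries_submodule:
  assumes N: "module R N"
  shows "submodule (ext_coboundaries R (Suc n) M N) R
    ((Hom_module R (F (Suc n)) N)\<lparr>carrier := ext_cocycles R (Suc n) M N\<rparr>)"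
proof -
  interpret N: module R N by fact
  interpret H: module R "Hom_module R (F (Suc n)) N" by (rule Hom_module_module[OF F_module N])
  have sub: "ext_coboundaries R (Suc n) M N \<subseteq> ext_cocycles R (Suc n) M N"
  proof
    fix f assume "f \<in> ext_coboundaries R (Suc n) M N"
    then obtain g where g: "linear_map R (F n) N g" "f = (\<lambda>x \<in> carrier (F (Suc n)). g (bd x))"
      by (rule ext_coboundariesE)
    show "f \<in> ext_cocycles R (Suc n) M N"
      unfolding g(2) by (rule pullback_cocycle[OF linear_map_comp[OF bd_linear g(1)]])
        (simp add: cycles_Suc linear_map_zero[OF F_module N g(1)])
  qed
  have "submodule (ext_coboundaries R (Suc n) M N) R (Hom_module R (F (Suc n)) N)"
  proof (rule H.submoduleI')
    show "ext_coboundaries R (Suc n) M N \<subseteq> carrier (Hom_module R (F (Suc n)) N)"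
      using sub by (auto simp: Hom_module_simps ext_cocycles_def)
    show "\<zero>\<^bsub>Hom_module R (F (Suc n)) N\<^esub> \<in> ext_coboundaries R (Suc n) M N"
      unfolding Hom_module_simps
      using pullback_coboundary[where n = n and N = N and f = "\<lambda>x. \<zero>\<^bsub>N\<^esub>"] by (simp add: linear_map_def)
  next
    fix f g assume f: "f \<in> ext_coboundaries R (Suc n) M N" and g: "g \<in> ext_coboundaries R (Suc n) M N"
    obtain f' where f': "linear_map R (F n) N f'" "f = (\<lambda>x \<in> carrier (F (Suc n)). f' (bd x))"
      using f by (rule ext_coboundariesE)
    obtain g' where g': "linear_map R (F n) N g'" "g = (\<lambda>x \<in> carrier (F (Suc n)). g' (bd x))"
      using g by (rule ext_coboundariesE)
    have "f \<oplus>\<^bsub>Hom_module R (F (Suc n)) N\<^esub> g = (\<lambda>x \<in> carrier (F (Suc n)). f' (bd x) \<oplus>\<^bsub>N\<^esub> g' (bd x))"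
      unfolding Hom_module_simps f'(2) g'(2) by (rule restrict_ext) simp
    then show "f \<oplus>\<^bsub>Hom_module R (F (Suc n)) N\<^esub> g \<in> ext_coboundaries R (Suc n) M N"
      using pullback_coboundary[OF linear_map_add[OF N f'(1) g'(1)]] by simp
  next
    fix r f assume r: "r \<in> carrier R" and f: "f \<in> ext_coboundaries R (Suc n) M N"
    obtain f' where f': "linear_map R (F n) N f'" "f = (\<lambda>x \<in> carrier (F (Suc n)). f' (bd x))"
      using f by (rule ext_coboundariesE)
    have "r \<odot>\<^bsub>Hom_module R (F (Suc n)) N\<^esub> f = (\<lambda>x \<in> carrier (F (Suc n)). r \<odot>\<^bsub>N\<^esub> f' (bd x))"
      unfolding Hom_module_simps f'(2) by (rule restrict_ext) simp
    then show "r \<odot>\<^bsub>Hom_module R (F (Suc n)) N\<^esub> f \<in> ext_coboundaries R (Suc n) M N"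
      using pullback_coboundary[OF linear_map_smult[OF N r f'(1)]] by simp
  qed
  then show ?thesis
    by (rule submodule_subset_module[OF H.module_axioms ext_cocycles_submodule[OF N] _ sub])
qed

definition pullback where
  "pullback n \<alpha> f = (\<lambda>x \<in> carrier (F n). f (\<alpha> x))"

lemma pullback_linear:
  assumes \<alpha>: "linear_map R (F n) (F m) \<alpha>" "\<And>x. x \<in> cycles n \<Longrightarrow> \<alpha> x \<in> cycles m"
  shows "linear_map R ((Hom_module R (F m) N)\<lparr>carrier := ext_cocycles R m M N\<rparr>)
    ((Hom_module R (F n) N)\<lparr>carrier := ext_cocycles R n M N\<rparr>) (pullback n \<alpha>)"
proof (rule linear_mapI)
  fix f assume "f \<in> carrier ((Hom_module R (F m) N)\<lparr>carrier := ext_cocycles R m M N\<rparr>)"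
  then have f: "f \<in> ext_cocycles R m M N" by simp
  show "pullback n \<alpha> f \<in> carrier ((Hom_module R (F n) N)\<lparr>carrier := ext_cocycles R n M N\<rparr>)"
    using pullback_cocycle[OF linear_map_comp[OF \<alpha>(1) ext_cocyclesD(1)[OF f]]]
      ext_cocyclesD(2)[OF f] \<alpha>(2) unfolding pullback_def by simp
qed (auto simp: pullback_def Hom_module_simps linear_mapD(1)[OF \<alpha>(1)])

lemma pullback_coboundaries:
  assumes \<alpha>: "linear_map R (F n) (F m) \<alpha>"
    and \<alpha>': "linear_map R (F (Suc n)) (F (Suc m)) \<alpha>'" "\<And>x. x \<in> carrier (F (Suc n)) \<Longrightarrow> bd (\<alpha>' x) = \<alpha> (bd x)"
    and f: "f \<in> ext_coboundaries R (Suc m) M N"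
  shows "pullback (Suc n) \<alpha>' f \<in> ext_coboundaries R (Suc n) M N"
proof -
  obtain g where g: "linear_map R (F m) N g" "f = (\<lambda>x \<in> carrier (F (Suc m)). g (bd x))"
    using f by (rule ext_coboundariesE)
  have "pullback (Suc n) \<alpha>' f = (\<lambda>x \<in> carrier (F (Suc n)). g (\<alpha> (bd x)))"
    unfolding pullback_def g(2) by (rule restrict_ext) (simp add: linear_mapD(1)[OF \<alpha>'(1)] \<alpha>'(2))
  then show ?thesis
    using pullback_coboundary[OF linear_map_comp[OF \<alpha> g(1)]] by simp
qed

text \<open>A cocycle kills the values of \<open>k\<close>, which are cycles, and its composite with
  \<open>\<kappa> \<circ> bd\<close> is a coboundary.\<close>

lemma pullback_homotopic:
  assumes N: "module R N" and f: "f \<in> ext_cocycles R (Suc a) M N"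
    and \<kappa>: "linear_map R (F a) (F (Suc a)) \<kappa>"
    and k: "\<And>u. u \<in> carrier (F (Suc a)) \<Longrightarrow> k u \<in> cycles (Suc a) \<and>
      \<gamma> (\<alpha> u) = (u \<oplus>\<^bsub>F (Suc a)\<^esub> \<kappa> (bd u)) \<oplus>\<^bsub>F (Suc a)\<^esub> k u"
    and \<alpha>: "linear_map R (F (Suc a)) (F m) \<alpha>"
  shows "\<exists>g \<in> ext_coboundaries R (Suc a) M N. pullback (Suc a) \<alpha> (pullback m \<gamma> f) = g \<oplus>\<^bsub>Hom_module R (F (Suc a)) N\<^esub> f"
proof -
  interpret N: module R N by fact
  note f' = ext_cocyclesD[OF f]
  let ?g = "\<lambda>u \<in> carrier (F (Suc a)). f (\<kappa> (bd u))"
  have "pullback (Suc a) \<alpha> (pullback m \<gamma> f) = ?g \<oplus>\<^bsub>Hom_module R (F (Suc a)) N\<^esub> f"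
    unfolding pullback_def Hom_module_simps
  proof (rule restrict_ext)
    fix u assume u: "u \<in> carrier (F (Suc a))"
    have c: "\<kappa> (bd u) \<in> carrier (F (Suc a))" "k u \<in> carrier (F (Suc a))"
      using linear_mapD(1)[OF \<kappa> bd_simps(1)[OF u]] k[OF u] cycles_closed by blast+
    have "f (\<gamma> (\<alpha> u)) = (f u \<oplus>\<^bsub>N\<^esub> f (\<kappa> (bd u))) \<oplus>\<^bsub>N\<^esub> f (k u)"
      using k[OF u] c u by (simp add: linear_mapD(2)[OF f'(1)])
    also have "f (k u) = \<zero>\<^bsub>N\<^esub>" using k[OF u] f'(2) by blast
    finally show "(\<lambda>x \<in> carrier (F m). f (\<gamma> x)) (\<alpha> u) = ?g u \<oplus>\<^bsub>N\<^esub> f u"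
      using c u linear_mapD(1)[OF \<alpha> u] by (simp add: linear_mapD(1)[OF f'(1)] N.M.a_comm)
  qed
  moreover have "?g \<in> ext_coboundaries R (Suc a) M N"
    by (rule pullback_coboundary[OF linear_map_comp[OF \<kappa> f'(1)]])
  ultimately show ?thesis by blast
qed

text \<open>A cocycle in degree \<open>Suc a\<close> kills \<open>cycles (Suc a)\<close>, so it
  amounts to a map on \<open>cycles a\<close>; coboundaries are the ones that extend to
  \<open>F a\<close>. The lifts preserve cycles and commute with the boundary, hence act on both,
  and the homotopies make the two actions inverse on the quotients.\<close>

theorem stably_iso_Ext:
  assumes "stably_iso a b" and N: "module R N"
  shows "module_iso R (Ext R (Suc a) M N) (Ext R (Suc b) M N)"
proof -
  obtain \<alpha> \<gamma> \<alpha>' \<gamma>' where h: "half_stable_inverse a b \<alpha> \<gamma>" "half_stable_inverse b a \<gamma> \<alpha>"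
    and \<alpha>': "linear_map R (F (Suc a)) (F (Suc b)) \<alpha>'" "\<And>u. u \<in> carrier (F (Suc a)) \<Longrightarrow> bd (\<alpha>' u) = \<alpha> (bd u)"
    and \<gamma>': "linear_map R (F (Suc b)) (F (Suc a)) \<gamma>'" "\<And>u. u \<in> carrier (F (Suc b)) \<Longrightarrow> bd (\<gamma>' u) = \<gamma> (bd u)"
    using stable_lifts[OF assms(1)] by blast
  have lin: "linear_map R (F a) (F b) \<alpha>" "linear_map R (F b) (F a) \<gamma>"
    using h unfolding half_stable_inverse_def by blast+
  have "half_stable_inverse (Suc a) (Suc b) \<alpha>' \<gamma>'" "half_stable_inverse (Suc b) (Suc a) \<gamma>' \<alpha>'"
    using stable_inverse_step[OF \<alpha>' \<gamma>' h(1)] stable_inverse_step[OF \<gamma>' \<alpha>' h(2)] by simp_all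
  then have cyc: "\<And>u. u \<in> cycles (Suc a) \<Longrightarrow> \<alpha>' u \<in> cycles (Suc b)" "\<And>u. u \<in> cycles (Suc b) \<Longrightarrow> \<gamma>' u \<in> cycles (Suc a)"
    unfolding half_stable_inverse_def by blast+
  have coc: "module R ((Hom_module R (F n) N)\<lparr>carrier := ext_cocycles R n M N\<rparr>)" for n
    by (rule submodule.submodule_is_module[OF ext_cocycles_submodule[OF N] Hom_module_module[OF F_module N]])
  show ?thesis
    unfolding Ext_def
  proof (rule quotient_module_iso[OF coc ext_coboundaries_submodule[OF N] coc ext_coboundaries_submodule[OF N]
        pullback_linear[OF \<gamma>'(1) cyc(2)] pullback_coboundaries[OF lin(2) \<gamma>']
        pullback_linear[OF \<alpha>'(1) cyc(1)] pullback_coboundaries[OF lin(1) \<alpha>']], assumption+)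
    fix f assume "f \<in> carrier ((Hom_module R (F (Suc a)) N)\<lparr>carrier := ext_cocycles R (Suc a) M N\<rparr>)"
    then have f: "f \<in> ext_cocycles R (Suc a) M N" by simp
    obtain \<kappa> k where "linear_map R (F a) (F (Suc a)) \<kappa>"
      "\<And>u. u \<in> carrier (F (Suc a)) \<Longrightarrow> k u \<in> cycles (Suc a) \<and>
        \<gamma>' (\<alpha>' u) = (u \<oplus>\<^bsub>F (Suc a)\<^esub> \<kappa> (bd u)) \<oplus>\<^bsub>F (Suc a)\<^esub> k u"
      using homotopy_step[OF \<alpha>' \<gamma>' h(1)] by blast
    from pullback_homotopic[OF N f this \<alpha>'(1)]
    show "\<exists>g \<in> ext_coboundaries R (Suc a) M N. pullback (Suc a) \<alpha>' (pullback (Suc b) \<gamma>' f)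
        = g \<oplus>\<^bsub>(Hom_module R (F (Suc a)) N)\<lparr>carrier := ext_cocycles R (Suc a) M N\<rparr>\<^esub> f"
      by simp
  next
    fix f assume "f \<in> carrier ((Hom_module R (F (Suc b)) N)\<lparr>carrier := ext_cocycles R (Suc b) M N\<rparr>)"
    then have f: "f \<in> ext_cocycles R (Suc b) M N" by simp
    obtain \<kappa> k where "linear_map R (F b) (F (Suc b)) \<kappa>"
      "\<And>u. u \<in> carrier (F (Suc b)) \<Longrightarrow> k u \<in> cycles (Suc b) \<and>
        \<alpha>' (\<gamma>' u) = (u \<oplus>\<^bsub>F (Suc b)\<^esub> \<kappa> (bd u)) \<oplus>\<^bsub>F (Suc b)\<^esub> k u"
      using homotopy_step[OF \<gamma>' \<alpha>' h(2)] by blast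
    from pullback_homotopic[OF N f this \<gamma>'(1)]
    show "\<exists>g \<in> ext_coboundaries R (Suc b) M N. pullback (Suc b) \<gamma>' (pullback (Suc a) \<alpha>' f)
        = g \<oplus>\<^bsub>(Hom_module R (F (Suc b)) N)\<lparr>carrier := ext_cocycles R (Suc b) M N\<rparr>\<^esub> f"
      by simp
  qed
qed

end

section \<open>Cyclic modules whose resolution begins periodically\<close>

lemma (in abelian_group) add_minus_cancel:
  "a \<in> carrier G \<Longrightarrow> b \<in> carrier G \<Longrightarrow> a \<oplus> (b \<ominus> a) = b"
  using a_lcomm[of a b "\<ominus> a"] by (simp add: minus_eq r_neg)

lemma (in abelian_group) minus_eq_zero_iff:
  assumes "a \<in> carrier G" "b \<in> carrier G"
  shows "a \<ominus> b = \<zero> \<longleftrightarrow> a = b"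
proof
  assume "a \<ominus> b = \<zero>"
  then show "a = b"
    using add_minus_cancel[OF assms(2,1)] assms by simp
qed (use assms in \<open>simp add: minus_eq r_neg\<close>)

context resolved_module
begin

text \<open>On all of \<open>F a\<close>, the composite is comparable with the identity only after a
  correction \<open>p\<close> that vanishes on cycles. The remainder then has values in cycles
  everywhere and serves as \<open>k\<close>.\<close>

lemma half_stable_inverseI:
  assumes \<alpha>: "linear_map R (F a) (F b) \<alpha>" "\<And>u. u \<in> cycles a \<Longrightarrow> \<alpha> u \<in> cycles b"
    and \<gamma>: "linear_map R (F b) (F a) \<gamma>"
    and p: "linear_map R (F a) (F a) p" "\<And>u. u \<in> cycles a \<Longrightarrow> p u = \<zero>\<^bsub>F a\<^esub>"
    and k: "\<And>u. u \<in> carrier (F a) \<Longrightarrow> \<gamma> (\<alpha> u) \<ominus>\<^bsub>F a\<^esub> (u \<oplus>\<^bsub>F a\<^esub> p u) \<in> cycles a"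
  shows "half_stable_inverse a b \<alpha> \<gamma>"
proof -
  let ?k = "\<lambda>u. \<gamma> (\<alpha> u) \<ominus>\<^bsub>F a\<^esub> (u \<oplus>\<^bsub>F a\<^esub> p u)"
  have "linear_map R (F a) (F a) ?k"
    by (rule linear_map_diff[OF F_module linear_map_comp[OF \<alpha>(1) \<gamma>] linear_map_add[OF F_module linear_map_id p(1)]])
  moreover have "\<gamma> (\<alpha> u) = u \<oplus>\<^bsub>F a\<^esub> ?k u" if u: "u \<in> cycles a" for u
    using cycles_closed[OF u] linear_mapD(1)[OF linear_map_comp[OF \<alpha>(1) \<gamma>]] p(2)[OF u]
    by (simp add: F.M.add_minus_cancel)
  ultimately show ?thesis
    unfolding half_stable_inverse_def using \<alpha> k by blast
qed

text \<open>
  The hypotheses say that \<open>R \<rightarrow> R \<rightarrow> R \<rightarrow> M\<close>, with maps \<open>y\<close>, \<open>x\<close> and \<open>1 \<mapsto> m\<close>, begins a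
  resolution of \<open>M\<close> whose second syzygy is again \<open>M\<close>, except that \<open>x R\<close> only exhausts the
  annihilator of \<open>m\<close> up to the factor \<open>r\<close>.  On Ext this factor is invertible, as \<open>t y\<close>, which acts on \<open>M\<close>
  through a free module, vanishes there.
\<close>

lemma cyclic_stably_iso:
  assumes m: "m \<in> carrier M" and gen: "\<And>n. n \<in> carrier M \<Longrightarrow> \<exists>a \<in> carrier R. n = a \<odot>\<^bsub>M\<^esub> m"
    and R: "x \<in> carrier R" "y \<in> carrier R" "r \<in> carrier R" "t \<in> carrier R"
    and xm: "x \<odot>\<^bsub>M\<^esub> m = \<zero>\<^bsub>M\<^esub>"
    and ann: "\<And>a. a \<in> carrier R \<Longrightarrow> a \<odot>\<^bsub>M\<^esub> m = \<zero>\<^bsub>M\<^esub> \<longleftrightarrow> a \<otimes> y = \<zero>"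
    and ker: "\<And>a. a \<in> carrier R \<Longrightarrow> x \<otimes> a = \<zero> \<Longrightarrow> \<exists>b \<in> carrier R. a = b \<otimes> y"
    and cok: "\<And>a. a \<in> carrier R \<Longrightarrow> a \<odot>\<^bsub>M\<^esub> m = \<zero>\<^bsub>M\<^esub> \<Longrightarrow> \<exists>b \<in> carrier R. r \<otimes> a = x \<otimes> b"
    and unit: "(r \<oplus> t \<otimes> y) \<odot>\<^bsub>M\<^esub> m = m"
  shows "stably_iso 0 2"
proof -
  let ?R = "regular_module R"
  have Rm: "module R ?R" by (rule regular_module_module[OF R.cring_axioms])
  have two: "(2::nat) = Suc (Suc 0)" by simp
  have minus: "a \<otimes> z \<ominus> b \<otimes> z = (a \<ominus> b) \<otimes> z" if "a \<in> carrier R" "b \<in> carrier R" "z \<in> carrier R" for a b z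
    using that by algebra
  \<comment> \<open>\<open>M\<close> is isomorphic to the ideal of \<open>y\<close>, by
    \<open>a \<odot> m \<mapsto> a \<otimes> y\<close>.\<close>
  have cancel: "a \<odot>\<^bsub>M\<^esub> m = b \<odot>\<^bsub>M\<^esub> m \<longleftrightarrow> a \<otimes> y = b \<otimes> y" if ab: "a \<in> carrier R" "b \<in> carrier R" for a b
  proof -
    have "a \<odot>\<^bsub>M\<^esub> m = b \<odot>\<^bsub>M\<^esub> m \<longleftrightarrow> (a \<ominus> b) \<odot>\<^bsub>M\<^esub> m = \<zero>\<^bsub>M\<^esub>"
      using ab m by (simp add: R.minus_eq smult_l_distr smult_l_minus M.minus_eq[symmetric] M.minus_eq_zero_iff)
    also have "\<dots> \<longleftrightarrow> (a \<ominus> b) \<otimes> y = \<zero>" using ann ab by simp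
    also have "\<dots> \<longleftrightarrow> a \<otimes> y = b \<otimes> y"
      using ab R by (simp add: minus[symmetric] R.minus_eq_zero_iff)
    finally show ?thesis .
  qed
  have xy: "x \<otimes> y = \<zero>" using ann[OF R(1)] xm by simp
  \<comment> \<open>\<open>c\<close> compares \<open>F 0\<close> with the first copy of
    \<open>R\<close>, and \<open>g1\<close> below compares \<open>F (Suc 0)\<close> with the second;
    \<open>f0\<close> and \<open>f1\<close> are the images of 1 under the maps backwards.\<close>
  have "linear_map R ?R M (\<lambda>a. a \<odot>\<^bsub>M\<^esub> m)"
    by (rule linear_map_scale[OF module_axioms m linear_map_id])
  moreover have "eps u \<in> (\<lambda>a. a \<odot>\<^bsub>M\<^esub> m) ` carrier ?R" if "u \<in> carrier (F 0)" for u
    using gen[OF eps_simps(1)[OF that]] by (auto simp: regular_module_simps)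
  ultimately obtain c where c: "linear_map R (F 0) ?R c" "\<And>u. u \<in> carrier (F 0) \<Longrightarrow> c u \<odot>\<^bsub>M\<^esub> m = eps u"
    using res_lift[OF Rm module_axioms eps_linear] by blast
  note cD = linear_mapD[OF c(1), unfolded regular_module_simps]
  have "m \<in> eps ` carrier (F 0)"
    using m by (simp add: res_augmentation_surj[OF module_axioms])
  then obtain f0 where f0: "f0 \<in> carrier (F 0)" "eps f0 = m"
    by blast
  have cf0: "c f0 \<otimes> y = y"
    using cancel[OF cD(1)[OF f0(1)] R.one_closed] c(2)[OF f0(1)] f0 m R by simp
  have "x \<odot>\<^bsub>F 0\<^esub> f0 \<in> cycles 0"
    using f0 R xm by (simp add: cycles_0 eps_simps)
  then obtain f1 where f1: "f1 \<in> carrier (F (Suc 0))" "bd f1 = x \<odot>\<^bsub>F 0\<^esub> f0"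
    by (auto simp: cycles_def)
  have cbd: "c (bd v) \<odot>\<^bsub>M\<^esub> m = \<zero>\<^bsub>M\<^esub>" "c (bd v) \<in> carrier R" if "v \<in> carrier (F (Suc 0))" for v
    using c(2) cD(1) bd_simps(1)[OF that] eps_bd[OF that] by auto
  have "linear_map R (F (Suc 0)) ?R (\<lambda>v. r \<otimes> c (bd v))"
    using linear_map_smult[OF Rm R(3) linear_map_comp[OF bd_linear c(1)]] by (simp add: regular_module_simps)
  moreover have "linear_map R ?R ?R (\<lambda>a. x \<otimes> a)"
    using linear_map_smult[OF Rm R(1) linear_map_id] by (simp add: regular_module_simps)
  \<comment> \<open>The factor \<open>r\<close> enters here: by \<open>cok\<close> it turns
    \<open>c (bd v)\<close>, an annihilator of \<open>m\<close>, into a multiple of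
    \<open>x\<close>.\<close>
  moreover have "r \<otimes> c (bd v) \<in> (\<lambda>a. x \<otimes> a) ` carrier ?R" if "v \<in> carrier (F (Suc 0))" for v
    using cok[OF cbd(2)[OF that] cbd(1)[OF that]] by (auto simp: regular_module_simps)
  ultimately obtain g1 where g1: "linear_map R (F (Suc 0)) ?R g1"
      "\<And>v. v \<in> carrier (F (Suc 0)) \<Longrightarrow> x \<otimes> g1 v = r \<otimes> c (bd v)"
    using res_lift[OF Rm Rm, where n = "Suc 0" and f = "\<lambda>v. r \<otimes> c (bd v)" and g = "\<lambda>a. x \<otimes> a"] by blast
  note g1D = linear_mapD[OF g1(1), unfolded regular_module_simps]
  have g1_0: "g1 \<zero>\<^bsub>F (Suc 0)\<^esub> = \<zero>" and c_0: "c \<zero>\<^bsub>F 0\<^esub> = \<zero>"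
    using linear_map_zero[OF F_module Rm g1(1)] linear_map_zero[OF F_module Rm c(1)]
    by (simp_all only: regular_module_simps)
  \<comment> \<open>The two composites agree after multiplication by \<open>x\<close>, so by
    \<open>ker\<close> they differ by a multiple \<open>b \<otimes> y\<close>.\<close>
  have "x \<otimes> g1 f1 = x \<otimes> (r \<otimes> c f0)"
    using g1(2)[OF f1(1)] f1(2) f0 R cD by (simp add: m_lcomm)
  moreover have g1c: "g1 f1 \<in> carrier R" "r \<otimes> c f0 \<in> carrier R"
    using g1D(1)[OF f1(1)] cD(1)[OF f0(1)] R by auto
  moreover have "x \<otimes> (d \<ominus> e) = x \<otimes> d \<ominus> x \<otimes> e" if "d \<in> carrier R" "e \<in> carrier R" for d e
    using that R(1) by algebra
  ultimately have "x \<otimes> (g1 f1 \<ominus> r \<otimes> c f0) = \<zero>"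
    using R(1) by (simp add: R.minus_eq_zero_iff)
  from ker[OF _ this] obtain b where b: "b \<in> carrier R" "g1 f1 \<ominus> r \<otimes> c f0 = b \<otimes> y"
    using g1c by auto
  have g1f1: "g1 f1 = r \<otimes> c f0 \<oplus> b \<otimes> y"
    using b(2)[symmetric] g1c by (simp add: R.add_minus_cancel)
  \<comment> \<open>\<open>F 0\<close> takes the third place:
    \<open>u \<mapsto> c u \<otimes> y\<close> has the ideal of \<open>y\<close> as its image, a
    copy of \<open>M\<close>. So the standard resolution is spliced to itself, and
    \<open>\<gamma>\<close> is the comparison map in degree 2.\<close>
  have "linear_map R (F 2) ?R (\<lambda>w. g1 (bd w))"
    unfolding two by (rule linear_map_comp[OF bd_linear g1(1)])
  moreover have "linear_map R (F 0) ?R (\<lambda>u. c u \<otimes> y)"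
    using linear_map_scale[OF Rm _ c(1), of y] R by (simp add: regular_module_simps)
  moreover have "g1 (bd w) \<in> (\<lambda>u. c u \<otimes> y) ` carrier (F 0)" if "w \<in> carrier (F 2)" for w
  proof -
    have w: "bd w \<in> carrier (F (Suc 0))" "bd (bd w) = \<zero>\<^bsub>F 0\<^esub>"
      using that bd_bd[of w 0] bd_simps(1)[of w "Suc 0"] unfolding two by auto
    have "x \<otimes> g1 (bd w) = \<zero>"
      using g1(2)[OF w(1)] w(2) c_0 R by simp
    then obtain a where a: "a \<in> carrier R" "g1 (bd w) = a \<otimes> y"
      using ker[OF g1D(1)[OF w(1)]] by blast
    have "g1 (bd w) = c (a \<odot>\<^bsub>F 0\<^esub> f0) \<otimes> y"
      using a cf0 cD(1)[OF f0(1)] f0(1) R by (simp add: cD m_assoc)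
    then show ?thesis using a f0(1) by auto
  qed
  ultimately obtain \<gamma> where \<gamma>: "linear_map R (F 2) (F 0) \<gamma>" "\<And>w. w \<in> carrier (F 2) \<Longrightarrow> c (\<gamma> w) \<otimes> y = g1 (bd w)"
    using res_lift[OF F_module Rm, where n = 2 and f = "\<lambda>w. g1 (bd w)" and g = "\<lambda>u. c u \<otimes> y"] by blast
  have "linear_map R (F 0) (F (Suc 0)) (\<lambda>u. (c u \<otimes> y) \<odot>\<^bsub>F (Suc 0)\<^esub> f1)"
    by (rule linear_map_scale[OF F_module f1(1)]) fact
  moreover have "(c u \<otimes> y) \<odot>\<^bsub>F (Suc 0)\<^esub> f1 \<in> cycles (Suc 0)" if "u \<in> carrier (F 0)" for u
  proof -
    have "(c u \<otimes> y) \<odot>\<^bsub>F 0\<^esub> (x \<odot>\<^bsub>F 0\<^esub> f0) = (c u \<otimes> (x \<otimes> y)) \<odot>\<^bsub>F 0\<^esub> f0"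
      using cD(1)[OF that] R f0(1) by (simp add: F.smult_assoc1[symmetric] m_ac)
    then show ?thesis
      using that f1 R f0(1) cD(1)[OF that] xy by (simp add: cycles_Suc bd_simps)
  qed
  ultimately obtain \<alpha> where \<alpha>: "linear_map R (F 0) (F 2) \<alpha>"
      "\<And>u. u \<in> carrier (F 0) \<Longrightarrow> bd (\<alpha> u) = (c u \<otimes> y) \<odot>\<^bsub>F (Suc 0)\<^esub> f1"
    unfolding two using cycles_lift[where n = 0 and m = "Suc 0" and f = "\<lambda>u. (c u \<otimes> y) \<odot>\<^bsub>F (Suc 0)\<^esub> f1"] by blast
  note \<alpha>D = linear_mapD[OF \<alpha>(1)] and \<gamma>D = linear_mapD[OF \<gamma>(1)]
  have cy0: "c u \<otimes> y = \<zero>" if "u \<in> cycles 0" for u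
    using that ann[OF cD(1)[of u]] c(2)[of u] by (simp add: cycles_0)
  have "half_stable_inverse 0 2 \<alpha> \<gamma>"
  proof (rule half_stable_inverseI[OF \<alpha>(1) _ \<gamma>(1)])
    \<comment> \<open>The composite acts on \<open>M\<close> as
      \<open>r \<oplus> b \<otimes> y\<close>, whereas the identity is
      \<open>r \<oplus> t \<otimes> y\<close>. The difference is a multiple of \<open>y\<close>;
      \<open>?p\<close> absorbs it and vanishes on cycles because \<open>c u \<otimes> y\<close>
      does.\<close>
    let ?p = "\<lambda>u. (c u \<otimes> (y \<otimes> (b \<ominus> t))) \<odot>\<^bsub>F 0\<^esub> f0"
    show "linear_map R (F 0) (F 0) ?p"
      using linear_map_scale[OF F_module f0(1)] linear_map_scale[OF Rm _ c(1), of "y \<otimes> (b \<ominus> t)"] R b(1)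
      by (simp add: regular_module_simps)
    fix u assume u: "u \<in> carrier (F 0)"
    note car = cD(1)[OF u] cD(1)[OF f0(1)] R b(1)
    have ga: "\<gamma> (\<alpha> u) \<in> carrier (F 0)" using \<alpha>D \<gamma>D u by blast
    have "c (\<gamma> (\<alpha> u)) \<otimes> y = (c u \<otimes> y) \<otimes> g1 f1"
      using \<gamma>(2)[OF \<alpha>D(1)[OF u]] \<alpha>(2)[OF u] g1D(3)[OF _ f1(1)] car by simp
    also have "\<dots> = (c u \<otimes> r) \<otimes> (c f0 \<otimes> y) \<oplus> (c u \<otimes> (b \<otimes> y)) \<otimes> y"
      unfolding g1f1 using car by algebra
    also have "\<dots> = (c u \<otimes> (r \<oplus> b \<otimes> y)) \<otimes> y"
      unfolding cf0 using car by algebra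
    finally have "c (\<gamma> (\<alpha> u)) \<odot>\<^bsub>M\<^esub> m = (c u \<otimes> (r \<oplus> b \<otimes> y)) \<odot>\<^bsub>M\<^esub> m"
      using cancel[OF cD(1)[OF ga], of "c u \<otimes> (r \<oplus> b \<otimes> y)"] car by simp
    then have e1: "eps (\<gamma> (\<alpha> u)) = (c u \<otimes> (r \<oplus> b \<otimes> y)) \<odot>\<^bsub>M\<^esub> m"
      using c(2)[OF ga] by simp
    have "eps (u \<oplus>\<^bsub>F 0\<^esub> ?p u) = c u \<odot>\<^bsub>M\<^esub> ((r \<oplus> t \<otimes> y) \<odot>\<^bsub>M\<^esub> m) \<oplus>\<^bsub>M\<^esub> (c u \<otimes> (y \<otimes> (b \<ominus> t))) \<odot>\<^bsub>M\<^esub> m"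
      using u f0 car by (simp add: eps_simps unit c(2))
    also have "\<dots> = (c u \<otimes> (r \<oplus> t \<otimes> y) \<oplus> c u \<otimes> (y \<otimes> (b \<ominus> t))) \<odot>\<^bsub>M\<^esub> m"
      using car m by (simp add: smult_assoc1 smult_l_distr)
    also have "c u \<otimes> (r \<oplus> t \<otimes> y) \<oplus> c u \<otimes> (y \<otimes> (b \<ominus> t)) = c u \<otimes> (r \<oplus> b \<otimes> y)"
      using car by algebra
    finally have "eps (\<gamma> (\<alpha> u) \<ominus>\<^bsub>F 0\<^esub> (u \<oplus>\<^bsub>F 0\<^esub> ?p u)) = \<zero>\<^bsub>M\<^esub>"
      using e1 ga u f0(1) car m by (simp add: eps_simps(5) M.minus_eq_zero_iff)
    then show "\<gamma> (\<alpha> u) \<ominus>\<^bsub>F 0\<^esub> (u \<oplus>\<^bsub>F 0\<^esub> ?p u) \<in> cycles 0"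
      using ga u f0(1) car by (simp add: cycles_0)
  next
    fix u assume u: "u \<in> cycles 0"
    note cu = cD(1)[OF cycles_closed[OF u]]
    have "c u \<otimes> (y \<otimes> (b \<ominus> t)) = (c u \<otimes> y) \<otimes> (b \<ominus> t)"
      using cu R b(1) by (simp add: m_assoc)
    then show "(c u \<otimes> (y \<otimes> (b \<ominus> t))) \<odot>\<^bsub>F 0\<^esub> f0 = \<zero>\<^bsub>F 0\<^esub>"
      using cy0[OF u] f0(1) R b(1) by simp
    show "\<alpha> u \<in> cycles 2"
      using \<alpha>(2)[OF cycles_closed[OF u]] cy0[OF u] f1(1) \<alpha>D(1)[OF cycles_closed[OF u]]
      unfolding two cycles_Suc by simp
  qed
  moreover have "half_stable_inverse 2 0 \<gamma> \<alpha>"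
  proof -
    let ?e = "r \<oplus> t \<otimes> y"
    \<comment> \<open>\<open>?e\<close> acts on \<open>M\<close> as the identity, so
      \<open>?l0\<close> has values in cycles. \<open>L0\<close> and \<open>L1\<close> form a chain
      homotopy built degree by degree; in degree 1 it uses that \<open>?e\<close> and
      \<open>r\<close> agree on \<open>c (bd v)\<close>, which \<open>y\<close> annihilates.\<close>
    let ?l0 = "\<lambda>u. (c u \<otimes> ?e) \<odot>\<^bsub>F 0\<^esub> f0 \<ominus>\<^bsub>F 0\<^esub> u"
    have e: "?e \<in> carrier R" using R by simp
    have "linear_map R (F 0) (F 0) ?l0"
      using linear_map_diff[OF F_module linear_map_scale[OF F_module f0(1)] linear_map_id]
        linear_map_scale[OF Rm _ c(1), of ?e] e
      by (simp add: regular_module_simps)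
    moreover have "?l0 u \<in> cycles 0" if u: "u \<in> carrier (F 0)" for u
    proof -
      have "(c u \<otimes> ?e) \<odot>\<^bsub>M\<^esub> m = c u \<odot>\<^bsub>M\<^esub> (?e \<odot>\<^bsub>M\<^esub> m)"
        using cD(1)[OF u] e m by (simp add: smult_assoc1)
      then have "(c u \<otimes> ?e) \<odot>\<^bsub>M\<^esub> m = eps u" by (simp add: unit c(2)[OF u])
      then show ?thesis
        using u e cD(1)[OF u] f0 by (simp add: cycles_0 eps_simps M.minus_eq_zero_iff)
    qed
    ultimately obtain L0 where L0: "linear_map R (F 0) (F (Suc 0)) L0" "\<And>u. u \<in> carrier (F 0) \<Longrightarrow> bd (L0 u) = ?l0 u"
      using cycles_lift[where n = 0 and m = 0 and f = ?l0] by blast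
    let ?l1 = "\<lambda>v. g1 v \<odot>\<^bsub>F (Suc 0)\<^esub> f1 \<ominus>\<^bsub>F (Suc 0)\<^esub> (v \<oplus>\<^bsub>F (Suc 0)\<^esub> L0 (bd v))"
    have "linear_map R (F (Suc 0)) (F (Suc 0)) ?l1"
      by (rule linear_map_diff[OF F_module linear_map_scale[OF F_module f1(1) g1(1)]
            linear_map_add[OF F_module linear_map_id linear_map_comp[OF bd_linear L0(1)]]])
    moreover have "?l1 v \<in> cycles (Suc 0)" if v: "v \<in> carrier (F (Suc 0))" for v
    proof -
      have bv: "bd v \<in> carrier (F 0)" "bd v \<in> cycles 0" using v bd_simps(1) bd_cycles by auto
      have car: "g1 v \<in> carrier R" "c (bd v) \<in> carrier R" "L0 (bd v) \<in> carrier (F (Suc 0))"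
        using g1D(1)[OF v] cD(1)[OF bv(1)] linear_mapD(1)[OF L0(1) bv(1)] .
      have "bd (v \<oplus>\<^bsub>F (Suc 0)\<^esub> L0 (bd v)) = (c (bd v) \<otimes> ?e) \<odot>\<^bsub>F 0\<^esub> f0"
        using v bv car f0(1) e by (simp add: bd_simps L0(2) F.M.add_minus_cancel)
      also have "c (bd v) \<otimes> ?e = r \<otimes> c (bd v) \<oplus> t \<otimes> (c (bd v) \<otimes> y)"
        using car R by algebra
      also have "\<dots> = g1 v \<otimes> x"
        using cy0[OF bv(2)] g1(2)[OF v, symmetric] car R by (simp add: m_comm)
      also have "(g1 v \<otimes> x) \<odot>\<^bsub>F 0\<^esub> f0 = bd (g1 v \<odot>\<^bsub>F (Suc 0)\<^esub> f1)"
        using car R f0(1) f1 by (simp add: bd_simps F.smult_assoc1)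
      finally have "bd (?l1 v) = \<zero>\<^bsub>F 0\<^esub>"
        using v car f1(1) bd_simps(1) by (simp add: bd_simps(5) F.M.minus_eq_zero_iff)
      then show ?thesis
        using v car f1(1) by (simp add: cycles_Suc)
    qed
    ultimately obtain L1 where L1: "linear_map R (F (Suc 0)) (F (Suc (Suc 0))) L1"
        "\<And>v. v \<in> carrier (F (Suc 0)) \<Longrightarrow> bd (L1 v) = ?l1 v"
      using cycles_lift[where n = "Suc 0" and m = "Suc 0" and f = ?l1] by blast
    show ?thesis
    proof (rule half_stable_inverseI[OF \<gamma>(1) _ \<alpha>(1)])
      show "linear_map R (F 2) (F 2) (\<lambda>w. L1 (bd w))"
        unfolding two by (rule linear_map_comp[OF bd_linear L1(1)])
      fix w assume w: "w \<in> carrier (F 2)"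
      then have w': "w \<in> carrier (F (Suc (Suc 0)))" unfolding two .
      have bw: "bd w \<in> carrier (F (Suc 0))" "bd (bd w) = \<zero>\<^bsub>F 0\<^esub>"
        using w' bd_simps(1) bd_bd by auto
      have car: "L1 (bd w) \<in> carrier (F (Suc (Suc 0)))" "\<alpha> (\<gamma> w) \<in> carrier (F (Suc (Suc 0)))" "\<gamma> w \<in> carrier (F 0)"
          "g1 (bd w) \<in> carrier R"
        using linear_mapD(1)[OF L1(1) bw(1)] \<alpha>D(1)[OF \<gamma>D(1)[OF w]] \<gamma>D(1)[OF w] g1D(1)[OF bw(1)]
        unfolding two by auto
      have "L0 (bd (bd w)) = \<zero>\<^bsub>F (Suc 0)\<^esub>"
        using bw(2) linear_map_zero[OF F_module F_module L0(1)] by simp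
      then have "bd (w \<oplus>\<^bsub>F (Suc (Suc 0))\<^esub> L1 (bd w)) = g1 (bd w) \<odot>\<^bsub>F (Suc 0)\<^esub> f1"
        using w' bw car f1(1) by (simp add: bd_simps L1(2) F.M.add_minus_cancel)
      then have "bd (\<alpha> (\<gamma> w)) = bd (w \<oplus>\<^bsub>F (Suc (Suc 0))\<^esub> L1 (bd w))"
        using \<alpha>(2)[OF car(3)] \<gamma>(2)[OF w] by simp
      then show "\<alpha> (\<gamma> w) \<ominus>\<^bsub>F 2\<^esub> (w \<oplus>\<^bsub>F 2\<^esub> L1 (bd w)) \<in> cycles 2"
        unfolding two cycles_Suc using w' car bd_simps(1) by (simp add: bd_simps(5) F.M.minus_eq_zero_iff)
    next
      fix w assume "w \<in> cycles 2"
      then have w: "w \<in> carrier (F 2)" "bd w = \<zero>\<^bsub>F (Suc 0)\<^esub>" unfolding two cycles_Suc by auto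
      show "L1 (bd w) = \<zero>\<^bsub>F 2\<^esub>"
        using w(2) linear_map_zero[OF F_module F_module L1(1)] unfolding two by simp
      have "c (\<gamma> w) \<otimes> y = \<zero>" using \<gamma>(2)[OF w(1)] w(2) g1_0 by simp
      then have "c (\<gamma> w) \<odot>\<^bsub>M\<^esub> m = \<zero>\<^bsub>M\<^esub>"
        using ann[OF cD(1)[OF \<gamma>D(1)[OF w(1)]]] by simp
      then show "\<gamma> w \<in> cycles 0"
        using c(2)[OF \<gamma>D(1)[OF w(1)]] \<gamma>D(1)[OF w(1)] by (simp add: cycles_0)
    qed
  qed
  ultimately show ?thesis unfolding stably_iso_def by blast
qed

text \<open>Degree \<open>l = Suc n\<close> is governed by \<open>cycles n\<close>, which the
  isomorphism, shifted \<open>n\<close> times, relates to \<open>cycles (n + 2)\<close>.\<close>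

lemma stably_iso_imp_Ext_periodic:
  assumes "stably_iso 0 2" "module R N" "l \<ge> 1"
  shows "module_iso R (Ext R l M N) (Ext R (l + 2) M N)"
proof -
  from assms(3) obtain n where "l = Suc n" by (cases l) auto
  then show ?thesis
    using stably_iso_Ext[OF stably_iso_add[OF assms(1), of n] assms(2)] by simp
qed

end

section \<open>Normal inclusions of prime index\<close>

lemma squarefree_not_square_dvd:
  assumes "squarefree (n::nat)" "prime p" "p * k dvd n"
  shows "\<not> p dvd k"
proof
  assume "p dvd k"
  then have "p ^ 2 dvd n"
    using assms(3) by (metis dvd_trans mult_dvd_mono dvd_refl power2_eq_square)
  then have "is_unit p" using assms(1) squarefreeD by blast
  then show False using assms(2) not_prime_unit by blast
qed

context group
begin

definition conjugate where
  "conjugate g K = (\<lambda>k. g \<otimes> k \<otimes> inv g) ` K"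

definition normal_step where
  "normal_step p K L \<longleftrightarrow> subgroup K G \<and> subgroup L G \<and> K \<subseteq> L \<and> card L = p * card K \<and>
     (\<forall>g \<in> L. conjugate g K = K)"

lemma conjugate_mult:
  "g \<in> carrier G \<Longrightarrow> h \<in> carrier G \<Longrightarrow> K \<subseteq> carrier G \<Longrightarrow> conjugate (g \<otimes> h) K = conjugate g (conjugate h K)"
  unfolding conjugate_def image_image by (rule image_cong) (auto simp: inv_mult_group m_assoc)

lemma conjugate_one: "K \<subseteq> carrier G \<Longrightarrow> conjugate \<one> K = K"
  by (force simp: conjugate_def)

lemma conjugate_inv:
  assumes "g \<in> carrier G" "K \<subseteq> carrier G"
  shows "conjugate (inv g) (conjugate g K) = K" "conjugate g (conjugate (inv g) K) = K"
  using assms by (simp_all add: conjugate_mult[symmetric] conjugate_one)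

lemma card_conjugate:
  assumes "g \<in> carrier G" "K \<subseteq> carrier G"
  shows "card (conjugate g K) = card K"
proof -
  have "inj_on (\<lambda>k. g \<otimes> k \<otimes> inv g) K"
    using assms by (intro inj_onI) (auto simp: subset_iff)
  then show ?thesis unfolding conjugate_def by (rule card_image)
qed

lemma conjugate_subgroup:
  assumes "g \<in> carrier G" "subgroup K G"
  shows "subgroup (conjugate g K) G"
proof -
  interpret K: subgroup K G by fact
  show ?thesis
  proof (rule subgroupI)
    show "conjugate g K \<noteq> {}" using K.one_closed unfolding conjugate_def by blast
    fix a assume "a \<in> conjugate g K"
    then obtain k where k: "k \<in> K" "a = g \<otimes> k \<otimes> inv g" by (auto simp: conjugate_def)
    have "inv a = g \<otimes> inv k \<otimes> inv g"
      using k assms(1) by (simp add: inv_mult_group m_assoc)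
    then show "inv a \<in> conjugate g K" using k by (auto simp: conjugate_def)
    fix b assume "b \<in> conjugate g K"
    then obtain l where l: "l \<in> K" "b = g \<otimes> l \<otimes> inv g" by (auto simp: conjugate_def)
    have "a \<otimes> b = g \<otimes> (k \<otimes> l) \<otimes> inv g"
    proof -
      have "inv g \<otimes> (g \<otimes> (l \<otimes> inv g)) = l \<otimes> inv g"
        using l assms(1) by (simp add: m_assoc[symmetric])
      then show ?thesis using k l assms(1) by (simp add: m_assoc)
    qed
    then show "a \<otimes> b \<in> conjugate g K" using k l by (auto simp: conjugate_def)
  qed (use assms(1) in \<open>auto simp: conjugate_def\<close>)
qed

lemma subgroup_card_dvd:
  assumes "subgroup K G" "subgroup L G" "K \<subseteq> L"
  shows "card K dvd card L"
proof -
  interpret L: group "G\<lparr>carrier := L\<rparr>" by (rule subgroup_imp_group[OF assms(2)])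
  have "card (rcosets\<^bsub>G\<lparr>carrier := L\<rparr>\<^esub> K) * card K = card L"
    using L.lagrange[OF subgroup_incl[OF assms]] by (simp add: order_def)
  then show ?thesis by (metis dvd_triv_right)
qed

definition normalizing where
  "normalizing K = {g \<in> carrier G. conjugate g K = K}"

lemma normalizing_subgroup:
  assumes "K \<subseteq> carrier G"
  shows "subgroup (normalizing K) G"
proof (rule subgroupI)
  show "normalizing K \<noteq> {}" using conjugate_one[OF assms] by (auto simp: normalizing_def)
  fix g assume g: "g \<in> normalizing K"
  then show "inv g \<in> normalizing K"
    using conjugate_inv(1)[of g K] assms by (simp add: normalizing_def)
  fix h assume "h \<in> normalizing K"
  with g show "g \<otimes> h \<in> normalizing K"
    using assms by (simp add: normalizing_def conjugate_mult)
qed (auto simp: normalizing_def)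

lemma subset_normalizing:
  assumes "subgroup K G"
  shows "K \<subseteq> normalizing K"
proof
  interpret K: subgroup K G by fact
  fix g assume g: "g \<in> K"
  have "conjugate h K \<subseteq> K" if "h \<in> K" for h
    using that by (auto simp: conjugate_def)
  from this[OF g] this[OF K.m_inv_closed[OF g]] have "conjugate g K \<subseteq> K" "conjugate (inv g) K \<subseteq> K" .
  moreover have "K = conjugate g (conjugate (inv g) K)"
    using conjugate_inv(2)[of g K] K.mem_carrier[OF g] K.subset by simp
  moreover have "conjugate g A \<subseteq> conjugate g B" if "A \<subseteq> B" for A B
    using that by (auto simp: conjugate_def)
  ultimately have "conjugate g K = K" by blast
  then show "g \<in> normalizing K" using g by (simp add: normalizing_def)
qed

lemma normal_step_conjugate:
  assumes "normal_step p K L" "g \<in> carrier G"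
  shows "normal_step p (conjugate g K) (conjugate g L)"
proof -
  have K: "subgroup K G" "K \<subseteq> carrier G" and L: "subgroup L G" "L \<subseteq> carrier G" "K \<subseteq> L"
    and n: "\<And>h. h \<in> L \<Longrightarrow> conjugate h K = K"
    using assms(1) subgroup.subset unfolding normal_step_def by blast+
  have "conjugate h (conjugate g K) = conjugate g K" if h: "h \<in> conjugate g L" for h
  proof -
    obtain l where l: "l \<in> L" "h = g \<otimes> l \<otimes> inv g" using h by (auto simp: conjugate_def)
    then have "conjugate h (conjugate g K) = conjugate g (conjugate l (conjugate (inv g) (conjugate g K)))"
      using assms(2) subsetD[OF L(2) l(1)] subgroup.subset[OF conjugate_subgroup[OF assms(2) K(1)]]
        subgroup.subset[OF conjugate_subgroup[OF inv_closed conjugate_subgroup[OF assms(2) K(1)]]]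
      by (simp add: conjugate_mult)
    then show ?thesis using conjugate_inv(1)[OF assms(2) K(2)] n[OF l(1)] by simp
  qed
  moreover have "conjugate g K \<subseteq> conjugate g L" using L(3) by (auto simp: conjugate_def)
  ultimately show ?thesis
    using assms K L conjugate_subgroup[OF assms(2)] card_conjugate[OF assms(2)]
    unfolding normal_step_def by auto
qed

text \<open>If \<open>p\<close> does not divide the order of \<open>K\<close>, then \<open>K\<close> is a normal Hall subgroup of \<open>L\<close>.\<close>

lemma normal_step_unique_below:
  assumes fin: "finite (carrier G)" and st: "normal_step p K L" and p: "prime p" "\<not> p dvd card K"
    and H: "subgroup H G" "H \<subseteq> L" "card H = card K"
  shows "H = K"
proof -
  have K: "subgroup K G" and L: "subgroup L G" "K \<subseteq> L" "card L = p * card K"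
    and n: "\<And>g. g \<in> L \<Longrightarrow> conjugate g K = K"
    using st unfolding normal_step_def by blast+
  let ?L = "G\<lparr>carrier := L\<rparr>"
  interpret L: group ?L by (rule subgroup_imp_group[OF L(1)])
  have nor: "K \<lhd> ?L"
    unfolding L.normal_inv_iff
  proof (intro conjI ballI)
    show "subgroup K ?L" by (rule subgroup_incl[OF K L(1,2)])
    fix g k assume g: "g \<in> carrier ?L" and k: "k \<in> K"
    then show "g \<otimes>\<^bsub>?L\<^esub> k \<otimes>\<^bsub>?L\<^esub> inv\<^bsub>?L\<^esub> g \<in> K"
      using n[of g] m_inv_consistent[OF L(1)] by (auto simp: conjugate_def)
  qed
  interpret K: normal K ?L by (rule nor)
  interpret Q: group "?L Mod K" by (rule K.factorgroup_is_group)
  have cK: "card K > 0"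
    using K.one_closed finite_subset[OF subgroup.subset[OF K] fin] by (auto simp: card_gt_0_iff)
  have "order (?L Mod K) * card K = card L"
    using L.lagrange[OF K.subgroup_axioms] by (simp add: order_def FactGroup_def)
  then have oQ: "order (?L Mod K) = p" using cK L(3) by simp
  have "H \<subseteq> K"
  proof
    fix h assume h: "h \<in> H"
    interpret hom: group_hom ?L "?L Mod K" "\<lambda>a. K #>\<^bsub>?L\<^esub> a"
      by unfold_locales (rule K.r_coset_hom_Mod)
    interpret H: group "G\<lparr>carrier := H\<rparr>" by (rule subgroup_imp_group[OF H(1)])
    have hL: "h \<in> carrier ?L" using h H(2) by auto
    let ?q = "K #>\<^bsub>?L\<^esub> h"
    have q: "?q \<in> carrier (?L Mod K)" using hom.hom_closed[OF hL] .
    \<comment> \<open>The order of the image of \<open>h\<close> in the quotient divides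
      \<open>card H = card K\<close> and also \<open>p\<close>, and these are coprime.\<close>
    have "h [^]\<^bsub>G\<lparr>carrier := H\<rparr>\<^esub> card H = \<one>"
      using H.pow_order_eq_1[of h] h by (simp add: order_def)
    then have "h [^]\<^bsub>?L\<^esub> card H = \<one>"
      by (simp add: nat_pow_consistent[symmetric])
    then have "?q [^]\<^bsub>?L Mod K\<^esub> card K = \<one>\<^bsub>?L Mod K\<^esub>"
      using hom.hom_nat_pow[OF hL, of "card H"] hom.hom_one H(3) by simp
    then have "Q.ord ?q dvd card K" using Q.pow_eq_id[OF q] by blast
    moreover have "Q.ord ?q dvd p" using Q.ord_dvd_group_order[OF q] oQ by simp
    ultimately have "Q.ord ?q = 1"
      using p by (metis prime_nat_iff)
    then have "?q = \<one>\<^bsub>?L Mod K\<^esub>" using Q.ord_eq_1[OF q] by blast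
    then have "K #>\<^bsub>?L\<^esub> h = K" by (simp add: FactGroup_def)
    then show "h \<in> K"
      using L.coset_join1[OF _ hL K.subgroup_axioms] by blast
  qed
  then show ?thesis
    using H(3) finite_subset[OF subgroup.subset[OF K] fin] card_subset_eq by blast
qed

text \<open>Cauchy's theorem in the Weyl group of \<open>K\<close>, stated without forming the quotient.\<close>

lemma normal_step_exists:
  assumes fin: "finite (carrier G)" and K: "subgroup K G"
    and p: "prime p" "p * card K dvd card (normalizing K)" "\<not> p dvd card K"
  shows "\<exists>L. normal_step p K L"
proof -
  let ?N = "normalizing K"
  let ?NG = "G\<lparr>carrier := ?N\<rparr>"
  have N: "subgroup ?N G" by (rule normalizing_subgroup[OF subgroup.subset[OF K]])
  interpret N: group ?NG by (rule subgroup_imp_group[OF N])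
  have KN: "K \<subseteq> ?N" by (rule subset_normalizing[OF K])
  have nor: "K \<lhd> ?NG"
    unfolding N.normal_inv_iff
  proof (intro conjI ballI)
    show "subgroup K ?NG" by (rule subgroup_incl[OF K N KN])
    fix g k assume g: "g \<in> carrier ?NG" and k: "k \<in> K"
    then show "g \<otimes>\<^bsub>?NG\<^esub> k \<otimes>\<^bsub>?NG\<^esub> inv\<^bsub>?NG\<^esub> g \<in> K"
      using m_inv_consistent[OF N] by (auto simp: normalizing_def conjugate_def)
  qed
  obtain c where "card ?N = p * card K * c" using p(2) by (auto elim: dvdE)
  then have "order ?NG = p ^ 1 * (card K * c)" by (simp add: order_def)
  then obtain P where P: "subgroup P ?NG" "card P = p"
    using sylow_thm[OF p(1) N.group_axioms, of 1] finite_subset[OF subgroup.subset[OF N] fin] by auto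
  define L where "L = K <#>\<^bsub>?NG\<^esub> P"
  have LN: "subgroup L ?NG"
    unfolding L_def by (rule N.mult_norm_subgroup[OF nor P(1)])
  have L: "subgroup L G" by (rule incl_subgroup[OF N LN])
  have PG: "subgroup P G" by (rule incl_subgroup[OF N P(1)])
  have Leq: "L = (\<lambda>(k, q). k \<otimes> q) ` (K \<times> P)" by (auto simp: L_def set_mult_def)
  have KL: "K \<subseteq> L"
  proof
    fix k assume k: "k \<in> K"
    then have "k = k \<otimes> \<one>" using subgroup.mem_carrier[OF K] by simp
    then show "k \<in> L" using k subgroup.one_closed[OF PG] unfolding Leq by force
  qed
  have PL: "P \<subseteq> L"
  proof
    fix q assume q: "q \<in> P"
    then have "q = \<one> \<otimes> q" using subgroup.mem_carrier[OF PG] by simp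
    then show "q \<in> L" using q subgroup.one_closed[OF K] unfolding Leq by force
  qed
  have finK: "finite K" "finite P" "finite L"
    using finite_subset[OF subgroup.subset[OF K] fin] finite_subset[OF subgroup.subset[OF PG] fin]
      finite_subset[OF subgroup.subset[OF L] fin] .
  \<comment> \<open>Coprimality of the orders of \<open>K\<close> and \<open>P\<close> bounds the
    order of their product from below, the number of pairs bounds it from above.\<close>
  have "coprime p (card K)" using p by (simp add: prime_imp_coprime)
  then have "p * card K dvd card L"
    using subgroup_card_dvd[OF K L KL] subgroup_card_dvd[OF PG L PL] P(2) by (simp add: divides_mult)
  moreover have "card L \<le> p * card K"
    using card_image_le[of "K \<times> P" "\<lambda>(k, q). k \<otimes> q"] finK P(2)
    unfolding Leq[symmetric] by (simp add: card_cartesian_product mult.commute)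
  moreover have "card L > 0" using finK subgroup.one_closed[OF L] by (auto simp: card_gt_0_iff)
  ultimately have "card L = p * card K" by (metis dvd_imp_le le_antisym)
  moreover have "L \<subseteq> ?N" using subgroup.subset[OF LN] by simp
  ultimately have "normal_step p K L"
    using K L KL unfolding normal_step_def normalizing_def by blast
  then show ?thesis by blast
qed

end

section \<open>Fixed points and cosets\<close>

context group
begin

lemma fixed_points_mono: "K \<subseteq> L \<Longrightarrow> fixed_points L X \<subseteq> fixed_points K X"
  by (auto simp: fixed_points_def)

lemma fixed_points_invariant:
  assumes X: "finite_gset G X" and K: "K \<subseteq> carrier G" and g: "g \<in> carrier G" and "x \<in> fixed_points K X"
  shows "snd X g x \<in> fixed_points (conjugate g K) X"
proof -
  have x: "x \<in> fst X" "\<And>k. k \<in> K \<Longrightarrow> snd X k x = x" using assms(4) by (auto simp: fixed_points_def)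
  have "snd X (g \<otimes> k \<otimes> inv g) (snd X g x) = snd X g x" if k: "k \<in> K" for k
  proof -
    have kc: "k \<in> carrier G" using k K by blast
    have "g \<otimes> k \<otimes> inv g \<otimes> g = g \<otimes> k" using g kc by (simp add: m_assoc)
    then have "snd X (g \<otimes> k \<otimes> inv g) (snd X g x) = snd X (g \<otimes> k) x"
      using finite_gsetD(4)[OF X, of "g \<otimes> k \<otimes> inv g" g x] g kc x(1) by simp
    also have "\<dots> = snd X g x"
      using finite_gsetD(4)[OF X g kc x(1)] x(2)[OF k] by simp
    finally show ?thesis .
  qed
  then show ?thesis
    using group_action_closed[OF X g x(1)] by (auto simp: fixed_points_def conjugate_def)
qed

lemma card_fixed_points_conjugate:
  assumes X: "finite_gset G X" and K: "K \<subseteq> carrier G" and g: "g \<in> carrier G"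
  shows "card (fixed_points (conjugate g K) X) = card (fixed_points K X)"
proof -
  have le: "card (fixed_points K X) \<le> card (fixed_points (conjugate g K) X)"
    if K: "K \<subseteq> carrier G" and g: "g \<in> carrier G" for K g
  proof (rule card_inj_on_le)
    show "inj_on (snd X g) (fixed_points K X)"
    proof (rule inj_onI)
      fix x y assume "x \<in> fixed_points K X" "y \<in> fixed_points K X" and eq: "snd X g x = snd X g y"
      then have xy: "x \<in> fst X" "y \<in> fst X" by (auto simp: fixed_points_def)
      have "snd X (inv g) (snd X g z) = z" if "z \<in> fst X" for z
        using finite_gsetD(4)[OF X inv_closed[OF g] g that] finite_gsetD(3)[OF X that] g by simp
      then show "x = y" using eq xy by metis
    qed
    show "snd X g ` fixed_points K X \<subseteq> fixed_points (conjugate g K) X"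
      using fixed_points_invariant[OF X K g] by blast
  qed (rule fixed_points_finite[OF X])
  have "conjugate g K \<subseteq> carrier G" using K g by (auto simp: conjugate_def)
  from le[OF this inv_closed[OF g]] le[OF K g] show ?thesis
    by (simp add: conjugate_inv(1)[OF g K])
qed

text \<open>As \<open>K\<close> is normal in \<open>L\<close>, the group \<open>L\<close> acts on
  the \<open>K\<close>-fixed points. Stabilizers contain \<open>K\<close>, so orbits have length 1
  or \<open>p\<close>, and those of length 1 are the \<open>L\<close>-fixed points.\<close>

lemma card_fixed_points_cong:
  assumes X: "finite_gset G X" and st: "normal_step p K L" and p: "prime p" and fin: "finite (carrier G)"
  shows "[card (fixed_points K X) = card (fixed_points L X)] (mod p)"
proof -
  have K: "subgroup K G" and L: "subgroup L G" "K \<subseteq> L" "card L = p * card K"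
    and n: "\<And>g. g \<in> L \<Longrightarrow> conjugate g K = K"
    using st unfolding normal_step_def by blast+
  have Lc: "g \<in> carrier G" if "g \<in> L" for g using that subgroup.subset[OF L(1)] by blast
  let ?L = "G\<lparr>carrier := L\<rparr>" and ?E = "fixed_points K X" and ?A = "fixed_points L X"
  interpret L: group ?L by (rule subgroup_imp_group[OF L(1)])
  define \<phi> where "\<phi> g = restrict (snd X g) ?E" for g
  have EX: "x \<in> fst X" if "x \<in> ?E" for x using that by (simp add: fixed_points_def)
  have cl: "snd X g x \<in> ?E" if "g \<in> L" "x \<in> ?E" for g x
    using fixed_points_invariant[OF X subgroup.subset[OF K] Lc[OF that(1)] that(2)] n[OF that(1)] by simp
  interpret act: group_action ?L ?E \<phi>
    by (rule group_action_intro[OF L.group_axioms])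
      (use cl in \<open>auto simp: \<phi>_def EX Lc finite_gsetD(3,4)[OF X]\<close>)
  have AE: "?A \<subseteq> ?E" by (rule fixed_points_mono[OF L(2)])
  have finE: "finite ?E" by (rule fixed_points_finite[OF X])
  have orb: "p dvd card (orbit ?L \<phi> x) \<and> orbit ?L \<phi> x \<subseteq> ?E - ?A" if x: "x \<in> ?E - ?A" for x
  proof
    have xE: "x \<in> ?E" using x by blast
    let ?S = "stabilizer ?L \<phi> x"
    have S: "subgroup ?S G"
      by (rule incl_subgroup[OF L(1) act.stabilizer_subgroup[OF xE]])
    have "K \<subseteq> ?S"
      using xE L(2) by (auto simp: stabilizer_def \<phi>_def fixed_points_def)
    then obtain s where s: "card ?S = card K * s"
      using subgroup_card_dvd[OF K S] by (auto elim: dvdE)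
    have "card K > 0"
      using subgroup.one_closed[OF K] finite_subset[OF subgroup.subset[OF K] fin] by (auto simp: card_gt_0_iff)
    moreover have "card (orbit ?L \<phi> x) * (card K * s) = p * card K"
      using act.orbit_stabilizer_theorem[OF xE] L(3) s by (simp add: order_def)
    ultimately have "card (orbit ?L \<phi> x) * s = p" by (simp add: ac_simps)
    then have "card (orbit ?L \<phi> x) dvd p" by (metis dvd_triv_left)
    moreover have "card (orbit ?L \<phi> x) \<noteq> 1"
    proof
      assume "card (orbit ?L \<phi> x) = 1"
      then obtain z where z: "orbit ?L \<phi> x = {z}" by (auto simp: card_1_singleton_iff)
      have "\<phi> g x = z" if "g \<in> L" for g
        using z that by (auto simp: orbit_def)
      moreover have "x = z" using act.orbit_refl[OF xE] z by blast
      ultimately have "x \<in> ?A"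
        using xE by (auto simp: fixed_points_def \<phi>_def)
      then show False using x by blast
    qed
    ultimately show "p dvd card (orbit ?L \<phi> x)" using p by (auto simp: prime_nat_iff)
    show "orbit ?L \<phi> x \<subseteq> ?E - ?A"
    proof
      fix z assume "z \<in> orbit ?L \<phi> x"
      then obtain g where g: "g \<in> L" "z = snd X g x" using xE by (auto simp: orbit_def \<phi>_def)
      have "x \<in> ?A" if "z \<in> ?A"
      proof -
        have "snd X (inv g) z = z" using that subgroup.m_inv_closed[OF L(1) g(1)] by (simp add: fixed_points_def)
        moreover have "snd X (inv g) z = x"
          using finite_gsetD(4)[OF X inv_closed[OF Lc[OF g(1)]] Lc[OF g(1)] EX[OF xE]] finite_gsetD(3)[OF X EX[OF xE]]
            g Lc[OF g(1)] by simp
        ultimately show ?thesis using that by simp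
      qed
      then show "z \<in> ?E - ?A" using x cl[OF g(1) xE] g(2) by blast
    qed
  qed
  let ?C = "orbit ?L \<phi> ` (?E - ?A)"
  have "\<Union>?C = ?E - ?A"
    using orb act.orbit_refl by blast
  moreover have "p dvd card (\<Union>?C)"
  proof (rule dvd_partition)
    show "finite (\<Union>?C)" using \<open>\<Union>?C = ?E - ?A\<close> finE by simp
    show "\<forall>c \<in> ?C. p dvd card c" using orb by blast
    have "?C \<subseteq> orbits ?L ?E \<phi>" by (auto simp: orbits_def)
    then show "\<forall>c1 \<in> ?C. \<forall>c2 \<in> ?C. c1 \<noteq> c2 \<longrightarrow> c1 \<inter> c2 = {}"
      using act.disjoint_union by blast
  qed
  ultimately have "p dvd card ?E - card ?A"
    using card_Diff_subset[OF finite_subset[OF AE finE] AE] by simp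
  then show ?thesis
    using card_mono[OF finE AE] by (simp add: cong_altdef_nat cong_sym_eq)
qed

section \<open>Marks of coset spaces\<close>

definition coset_gset where
  "coset_gset K = (lcosets K, \<lambda>g. restrict (\<lambda>C. g <# C) (lcosets K))"

lemma coset_gset_finite:
  assumes "finite (carrier G)" "subgroup K G"
  shows "finite_gset G (coset_gset K)"
proof -
  have K: "K \<subseteq> carrier G" by (rule subgroup.subset[OF assms(2)])
  have cl: "g <# C \<in> lcosets K" if "g \<in> carrier G" "C \<in> lcosets K" for g C
    using that lcos_m_assoc[OF K] by (auto simp: LCOSETS_def)
  have C: "C \<subseteq> carrier G" if "C \<in> lcosets K" for C
    using lcosets_subset_PowG[OF assms(2)] that by blast
  show ?thesis
    unfolding finite_gset_def coset_gset_def fst_conv snd_conv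
  proof (intro conjI group_action_intro[OF is_group])
    show "finite (lcosets K)" using assms(1) by (simp add: LCOSETS_def)
  qed (use cl C in \<open>auto simp: lcos_mult_one lcos_m_assoc\<close>)
qed

text \<open>The union of the left cosets of \<open>K\<close> that \<open>L\<close> fixes, if
  \<open>K\<close> is a subgroup: marks of coset spaces can thus be counted inside the
  group.\<close>

definition transporter where
  "transporter L K = {g \<in> carrier G. conjugate (inv g) L \<subseteq> K}"

text \<open>\<open>l\<close> fixes the coset of \<open>g\<close> exactly when
  \<open>inv g \<otimes> l \<otimes> g \<in> K\<close>, so the fixed cosets partition the
  transporter into sets of size \<open>card K\<close>.\<close>

lemma card_fixed_points_coset:
  assumes fin: "finite (carrier G)" and K: "subgroup K G" and L: "L \<subseteq> carrier G"
  shows "card (fixed_points L (coset_gset K)) * card K = card (transporter L K)"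
proof -
  have Kc: "K \<subseteq> carrier G" by (rule subgroup.subset[OF K])
  have fixed_iff: "g <# K \<in> fixed_points L (coset_gset K) \<longleftrightarrow> g \<in> transporter L K" if g: "g \<in> carrier G" for g
  proof -
    have "l <# (g <# K) = g <# K \<longleftrightarrow> inv g \<otimes> l \<otimes> g \<in> K" if l: "l \<in> L" for l
    proof -
      have lc: "l \<in> carrier G" using l L by blast
      have "l <# (g <# K) = (l \<otimes> g) <# K" by (rule lcos_m_assoc[OF Kc lc g])
      moreover have "(l \<otimes> g) <# K = g <# K \<longleftrightarrow> l \<otimes> g \<in> g <# K"
        using lcos_self[OF _ K, of "l \<otimes> g"] l_repr_independence[OF _ g K, of "l \<otimes> g"] lc g by auto
      moreover have "l \<otimes> g \<in> g <# K \<longleftrightarrow> inv g \<otimes> (l \<otimes> g) \<in> K"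
        using subgroup.lcos_module_imp[OF K is_group g, of "l \<otimes> g"]
          subgroup.lcos_module_rev[OF K is_group g, of "l \<otimes> g"] lc g by auto
      ultimately show ?thesis using lc g by (simp add: m_assoc)
    qed
    moreover have "g <# K \<in> lcosets K" using g by (auto simp: LCOSETS_def)
    ultimately show ?thesis
      using g by (auto simp: fixed_points_def coset_gset_def transporter_def conjugate_def)
  qed
  have sub: "fixed_points L (coset_gset K) \<subseteq> lcosets K" by (auto simp: fixed_points_def coset_gset_def)
  have "\<Union>(fixed_points L (coset_gset K)) = transporter L K"
  proof
    show "\<Union>(fixed_points L (coset_gset K)) \<subseteq> transporter L K"
    proof clarify
      fix g C assume g: "g \<in> C" and C: "C \<in> fixed_points L (coset_gset K)"
      then obtain h where h: "h \<in> carrier G" "C = h <# K" using sub by (auto simp: LCOSETS_def)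
      have "g \<in> carrier G" using g h l_coset_carrier[OF _ h(1) K] by blast
      moreover have "C = g <# K" using l_repr_independence[OF _ h(1) K] g h(2) by blast
      ultimately show "g \<in> transporter L K" using fixed_iff C by blast
    qed
    show "transporter L K \<subseteq> \<Union>(fixed_points L (coset_gset K))"
    proof
      fix g assume g: "g \<in> transporter L K"
      then have "g \<in> carrier G" by (simp add: transporter_def)
      then show "g \<in> \<Union>(fixed_points L (coset_gset K))" using fixed_iff g lcos_self[OF _ K] by blast
    qed
  qed
  moreover have "card K * card (fixed_points L (coset_gset K)) = card (\<Union>(fixed_points L (coset_gset K)))"
  proof (rule card_partition)
    show "finite (fixed_points L (coset_gset K))"
      by (rule fixed_points_finite[OF coset_gset_finite[OF fin K]])
    show "finite (\<Union>(fixed_points L (coset_gset K)))"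
      using calculation fin by (simp add: transporter_def)
    show "card C = card K" if "C \<in> fixed_points L (coset_gset K)" for C
      using l_card_cosets_equal[OF subsetD[OF sub that] Kc fin] by simp
    show "C \<inter> D = {}" if "C \<in> fixed_points L (coset_gset K)" "D \<in> fixed_points L (coset_gset K)" "C \<noteq> D" for C D
      by (rule lcos_disjoint[OF K subsetD[OF sub that(1)] subsetD[OF sub that(2)] that(3)])
  qed
  ultimately show ?thesis by (simp add: mult.commute)
qed

lemma transporter_self:
  assumes "finite (carrier G)" "subgroup K G" "subgroup L G" "card L = card K" "g \<in> transporter L K"
  shows "conjugate g K = L"
proof -
  have g: "g \<in> carrier G" "conjugate (inv g) L \<subseteq> K" using assms(5) by (auto simp: transporter_def)
  have "conjugate (inv g) L = K"
    by (rule card_subset_eq[OF finite_subset[OF subgroup.subset[OF assms(2)] assms(1)] g(2)])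
      (use card_conjugate[OF inv_closed[OF g(1)] subgroup.subset[OF assms(3)]] assms(4) in simp)
  then show ?thesis
    using conjugate_inv(2)[OF g(1) subgroup.subset[OF assms(3)]] by simp
qed

lemma card_le_of_transporter:
  assumes "finite (carrier G)" "subgroup K G" "subgroup L G" "g \<in> transporter L K"
  shows "card L \<le> card K"
proof -
  have g: "g \<in> carrier G" "conjugate (inv g) L \<subseteq> K" using assms(4) by (auto simp: transporter_def)
  show ?thesis
    using card_mono[OF finite_subset[OF subgroup.subset[OF assms(2)] assms(1)] g(2)]
      card_conjugate[OF inv_closed[OF g(1)] subgroup.subset[OF assms(3)]] by simp
qed

lemma transporter_normalizing:
  assumes "finite (carrier G)" "subgroup K G"
  shows "transporter K K = normalizing K"
proof
  show "transporter K K \<subseteq> normalizing K"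
  proof
    fix g assume g: "g \<in> transporter K K"
    then have "g \<in> carrier G" by (simp add: transporter_def)
    then show "g \<in> normalizing K"
      using transporter_self[OF assms(1,2,2) refl g] by (simp add: normalizing_def)
  qed
  show "normalizing K \<subseteq> transporter K K"
  proof
    fix g assume "g \<in> normalizing K"
    then have "inv g \<in> normalizing K" "g \<in> carrier G"
      using subgroup.m_inv_closed[OF normalizing_subgroup[OF subgroup.subset[OF assms(2)]]]
      by (simp_all add: normalizing_def)
    then show "g \<in> transporter K K" by (simp add: normalizing_def transporter_def)
  qed
qed

text \<open>The argument counts marks of the coset space of \<open>L2\<close>. As \<open>K\<close>
  is the only subgroup of its order in \<open>L2\<close>, the mark at \<open>K\<close> is the order
  of the normalizer divided by \<open>card L2\<close>. It is prime to \<open>p\<close>, since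
  \<open>p\<close> divides \<open>card L2\<close> and the group order is square-free. By the
  congruence the mark at \<open>L1\<close> is nonzero, so \<open>L1\<close> is conjugate into
  \<open>L2\<close>, and the orders agree.\<close>

lemma normal_step_unique_above:
  assumes fin: "finite (carrier G)" and sq: "squarefree (order G)" and p: "prime p"
    and st: "normal_step p K L1" "normal_step p K L2"
  shows "\<exists>g \<in> carrier G. conjugate g L2 = L1"
proof -
  have K: "subgroup K G" and L1: "subgroup L1 G" "K \<subseteq> L1" "card L1 = p * card K"
    and L2: "subgroup L2 G" "K \<subseteq> L2" "card L2 = p * card K"
    using st unfolding normal_step_def by blast+
  have pK: "\<not> p dvd card K"
    using squarefree_not_square_dvd[OF sq p] subgroup_card_dvd[OF L1(1) subgroup_self subgroup.subset[OF L1(1)]] L1(3)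
    by (simp add: order_def)
  have "transporter K L2 \<subseteq> normalizing K"
  proof
    fix g assume "g \<in> transporter K L2"
    then have g: "g \<in> carrier G" "conjugate (inv g) K \<subseteq> L2" by (auto simp: transporter_def)
    have "conjugate (inv g) K = K"
      using normal_step_unique_below[OF fin st(2) p pK conjugate_subgroup[OF inv_closed[OF g(1)] K] g(2)]
        card_conjugate[OF inv_closed[OF g(1)] subgroup.subset[OF K]] by blast
    then show "g \<in> normalizing K"
      using conjugate_inv(2)[OF g(1) subgroup.subset[OF K]] g(1) by (simp add: normalizing_def)
  qed
  moreover have "normalizing K \<subseteq> transporter K L2"
    using transporter_normalizing[OF fin K] L2(2) by (auto simp: transporter_def)
  ultimately have "card (fixed_points K (coset_gset L2)) * card L2 = card (normalizing K)"
    using card_fixed_points_coset[OF fin L2(1) subgroup.subset[OF K]] by simp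
  moreover have "card (normalizing K) dvd order G"
    using subgroup_card_dvd[OF normalizing_subgroup[OF subgroup.subset[OF K]] subgroup_self]
    by (simp add: order_def normalizing_def)
  ultimately have "p * (card (fixed_points K (coset_gset L2)) * card K) dvd order G"
    using L2(3) by (simp add: ac_simps)
  then have "\<not> p dvd card (fixed_points K (coset_gset L2))"
    using squarefree_not_square_dvd[OF sq p] by (meson dvd_mult2)
  then have "\<not> p dvd card (fixed_points L1 (coset_gset L2))"
    using card_fixed_points_cong[OF coset_gset_finite[OF fin L2(1)] st(1) p fin] cong_dvd_iff by blast
  then have "card (fixed_points L1 (coset_gset L2)) > 0"
    by (auto intro: gr0I)
  moreover have "card L2 > 0"
    using subgroup.one_closed[OF L2(1)] finite_subset[OF subgroup.subset[OF L2(1)] fin] by (auto simp: card_gt_0_iff)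
  ultimately have "card (transporter L1 L2) > 0"
    using card_fixed_points_coset[OF fin L2(1) subgroup.subset[OF L1(1)]] by (metis nat_0_less_mult_iff)
  then have "transporter L1 L2 \<noteq> {}" by (auto simp: card_gt_0_iff)
  then obtain g where g: "g \<in> transporter L1 L2" by blast
  then have "conjugate g L2 = L1"
    using transporter_self[OF fin L2(1) L1(1)] L1(3) L2(3) by simp
  then show ?thesis using g by (auto simp: transporter_def)
qed

end

section \<open>Marks determine finite G-sets\<close>

definition gset_restrict :: "('g, 'x) gset \<Rightarrow> 'x set \<Rightarrow> ('g, 'x) gset" where
  "gset_restrict X A = (A, \<lambda>g. restrict (snd X g) A)"

context group
begin

lemma gset_restrict_finite:
  assumes X: "finite_gset G X" and A: "A \<subseteq> fst X" "\<And>g x. g \<in> carrier G \<Longrightarrow> x \<in> A \<Longrightarrow> snd X g x \<in> A"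
  shows "finite_gset G (gset_restrict X A)"
  unfolding finite_gset_def gset_restrict_def fst_conv snd_conv
proof (intro conjI group_action_intro[OF is_group])
  show "finite A" using finite_subset[OF A(1) finite_gsetD(2)[OF X]] .
  fix g h x assume "g \<in> carrier G" "h \<in> carrier G" "x \<in> A"
  then show "restrict (snd X (g \<otimes> h)) A x = restrict (snd X g) A (restrict (snd X h) A x)"
    using A finite_gsetD(4)[OF X] by auto
qed (use A finite_gsetD(3)[OF X] in auto)

lemma card_fixed_points_restrict:
  assumes X: "finite_gset G X" and A: "A \<subseteq> fst X"
  shows "card (fixed_points K X)
    = card (fixed_points K (gset_restrict X A)) + card (fixed_points K (gset_restrict X (fst X - A)))"
proof -
  have "fixed_points K X = fixed_points K (gset_restrict X A) \<union> fixed_points K (gset_restrict X (fst X - A))"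
    using A by (auto simp: fixed_points_def gset_restrict_def)
  moreover have "finite (fixed_points K X)" by (rule fixed_points_finite[OF X])
  moreover have "fixed_points K (gset_restrict X A) \<inter> fixed_points K (gset_restrict X (fst X - A)) = {}"
    by (auto simp: fixed_points_def gset_restrict_def)
  ultimately show ?thesis by (simp add: card_Un_disjoint)
qed

lemma gset_iso_restrictE:
  assumes "gset_iso G (gset_restrict X A) (gset_restrict Y B)"
  obtains f where "bij_betw f A B" "\<And>g x. g \<in> carrier G \<Longrightarrow> x \<in> A \<Longrightarrow> f (snd X g x) = snd Y g (f x)"
proof -
  obtain f where f: "bij_betw f A B"
      "\<forall>g \<in> carrier G. \<forall>x \<in> A. f (restrict (snd X g) A x) = restrict (snd Y g) B (f x)"
    using assms unfolding gset_iso_def gset_restrict_def fst_conv snd_conv by blast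
  have "f (snd X g x) = snd Y g (f x)" if "g \<in> carrier G" "x \<in> A" for g x
    using f(2)[rule_format, OF that] bij_betw_apply[OF f(1) that(2)] that(2) by simp
  with f(1) show ?thesis by (rule that)
qed

lemma gset_iso_glue:
  assumes A: "A \<subseteq> fst X" "\<And>g x. g \<in> carrier G \<Longrightarrow> x \<in> A \<Longrightarrow> snd X g x \<in> A"
    and X: "finite_gset G X" and B: "B \<subseteq> fst Y"
    and iso: "gset_iso G (gset_restrict X A) (gset_restrict Y B)"
      "gset_iso G (gset_restrict X (fst X - A)) (gset_restrict Y (fst Y - B))"
  shows "gset_iso G X Y"
proof -
  obtain f where f: "bij_betw f A B" "\<And>g x. g \<in> carrier G \<Longrightarrow> x \<in> A \<Longrightarrow> f (snd X g x) = snd Y g (f x)"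
    using iso(1) by (rule gset_iso_restrictE) blast
  obtain h where h: "bij_betw h (fst X - A) (fst Y - B)"
      "\<And>g x. g \<in> carrier G \<Longrightarrow> x \<in> fst X - A \<Longrightarrow> h (snd X g x) = snd Y g (h x)"
    using iso(2) by (rule gset_iso_restrictE) blast
  let ?f = "\<lambda>x. if x \<in> A then f x else h x"
  have "bij_betw ?f (A \<union> (fst X - A)) (B \<union> (fst Y - B))"
  proof (rule bij_betw_combine)
    show "bij_betw ?f A B" using f(1) by (rule bij_betw_cong[THEN iffD1, rotated]) simp
    show "bij_betw ?f (fst X - A) (fst Y - B)" using h(1) by (rule bij_betw_cong[THEN iffD1, rotated]) simp
  qed auto
  then have "bij_betw ?f (fst X) (fst Y)" using A(1) B by (simp add: Un_absorb1)
  moreover have "?f (snd X g x) = snd Y g (?f x)" if g: "g \<in> carrier G" and x: "x \<in> fst X" for g x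
  proof (cases "x \<in> A")
    case True
    then show ?thesis using A(2) f(2) g by simp
  next
    case False
    have "snd X g x \<notin> A"
    proof
      assume "snd X g x \<in> A"
      then have "snd X (inv g) (snd X g x) \<in> A" using A(2) g by simp
      moreover have "snd X (inv g) (snd X g x) = x"
        using finite_gsetD(4)[OF X inv_closed[OF g] g x] finite_gsetD(3)[OF X x] g by simp
      ultimately show False using False by simp
    qed
    then show ?thesis using False h(2) g x by simp
  qed
  ultimately show ?thesis by (rule gset_isoI)
qed

text \<open>Whether \<open>g\<close> and \<open>h\<close> move a point to the same place depends
  only on its stabilizer, so sending the translate of \<open>x\<close> by \<open>g\<close> to that
  of \<open>y\<close> by \<open>g\<close> is well defined and injective.\<close>

lemma gset_iso_orbits:
  assumes X: "finite_gset G X" "x \<in> fst X" and Y: "finite_gset G Y" "y \<in> fst Y"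
    and stab: "stabilizer G (snd X) x = stabilizer G (snd Y) y"
  shows "gset_iso G (gset_restrict X (orbit G (snd X) x)) (gset_restrict Y (orbit G (snd Y) y))"
proof -
  have same: "snd X g x = snd X h x \<longleftrightarrow> inv h \<otimes> g \<in> stabilizer G (snd X) x"
    if X: "finite_gset G X" "x \<in> fst X" and g: "g \<in> carrier G" and h: "h \<in> carrier G" for X :: "('a, 'x) gset" and x g h
  proof -
    have "snd X (inv h \<otimes> g) x = snd X (inv h) (snd X g x)"
      using finite_gsetD(4)[OF X(1) inv_closed[OF h] g X(2)] .
    moreover have "snd X (inv h) (snd X h x) = x" and "snd X h (snd X (inv h) (snd X g x)) = snd X g x"
      using finite_gsetD(4)[OF X(1) inv_closed[OF h] h X(2)] finite_gsetD(3)[OF X(1)] X(2) h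
        finite_gsetD(4)[OF X(1) h inv_closed[OF h] group_action_closed[OF X(1) g X(2)]]
        group_action_closed[OF X(1) g X(2)] by simp_all
    ultimately show ?thesis using g h unfolding stabilizer_def by auto
  qed
  have iff: "snd X g x = snd X h x \<longleftrightarrow> snd Y g y = snd Y h y" if "g \<in> carrier G" "h \<in> carrier G" for g h
    using same[OF X that] same[OF Y that] stab by simp
  define f where "f z = snd Y (SOME g. g \<in> carrier G \<and> snd X g x = z) y" for z
  have f: "f (snd X g x) = snd Y g y" if g: "g \<in> carrier G" for g
  proof -
    let ?h = "SOME h. h \<in> carrier G \<and> snd X h x = snd X g x"
    have "?h \<in> carrier G \<and> snd X ?h x = snd X g x"
      by (rule someI[of _ g]) (use g in simp)
    then show ?thesis using iff[of ?h g] g by (simp add: f_def)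
  qed
  have "bij_betw f (orbit G (snd X) x) (orbit G (snd Y) y)"
  proof (rule bij_betw_imageI)
    show "inj_on f (orbit G (snd X) x)"
      by (rule inj_onI) (auto simp: orbit_def f iff)
    show "f ` orbit G (snd X) x = orbit G (snd Y) y"
      unfolding orbit_def using f by force
  qed
  moreover have "f (snd X h (snd X g x)) = snd Y h (f (snd X g x))" if "g \<in> carrier G" "h \<in> carrier G" for g h
    using that f[OF m_closed[OF that(2,1)]] f[OF that(1)] finite_gsetD(4)[OF X(1) that(2,1) X(2)]
      finite_gsetD(4)[OF Y(1) that(2,1) Y(2)] by simp
  ultimately show ?thesis
    unfolding gset_iso_def gset_restrict_def
    by (intro exI[of _ f]) (auto simp: orbit_def f)
qed

lemma gset_orbit:
  assumes X: "finite_gset G X" "x \<in> fst X"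
  shows "x \<in> orbit G (snd X) x" "orbit G (snd X) x \<subseteq> fst X"
    "g \<in> carrier G \<Longrightarrow> z \<in> orbit G (snd X) x \<Longrightarrow> snd X g z \<in> orbit G (snd X) x"
    "g \<in> carrier G \<Longrightarrow> z \<in> fst X - orbit G (snd X) x \<Longrightarrow> snd X g z \<in> fst X - orbit G (snd X) x"
proof -
  interpret act: group_action G "fst X" "snd X" using X(1) by (simp add: finite_gset_def)
  show "x \<in> orbit G (snd X) x" using act.orbit_refl[OF X(2)] .
  show sub: "orbit G (snd X) x \<subseteq> fst X" using group_action_closed[OF X(1) _ X(2)] by (auto simp: orbit_def)
  show cl: "snd X g z \<in> orbit G (snd X) x" if g: "g \<in> carrier G" and "z \<in> orbit G (snd X) x" for g z
  proof -
    obtain h where h: "h \<in> carrier G" "z = snd X h x" using \<open>z \<in> orbit G (snd X) x\<close> by (auto simp: orbit_def)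
    then have "snd X g z = snd X (g \<otimes> h) x" using finite_gsetD(4)[OF X(1) g h(1) X(2)] by simp
    then show ?thesis using g h by (auto simp: orbit_def)
  qed
  assume g: "g \<in> carrier G" and z: "z \<in> fst X - orbit G (snd X) x"
  have "snd X (inv g) (snd X g z) = z"
    using finite_gsetD(4)[OF X(1) inv_closed[OF g] g, of z] finite_gsetD(3)[OF X(1), of z] g z by simp
  then show "snd X g z \<in> fst X - orbit G (snd X) x"
    using cl[OF inv_closed[OF g]] z group_action_closed[OF X(1) g] by force
qed

text \<open>Burnside: a point whose stabilizer has maximal order can be matched by equality of marks.\<close>

lemma gset_iso_of_marks:
  assumes fin: "finite (carrier G)" and "finite_gset G X" "finite_gset G Y"
    and "\<And>K. subgroup K G \<Longrightarrow> card (fixed_points K X) = card (fixed_points K Y)"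
  shows "gset_iso G X Y"
  using assms(2-)
proof (induction "card (fst X)" arbitrary: X Y rule: less_induct)
  case less
  note X = less.prems(1) and Y = less.prems(2) and eq = less.prems(3)
  have one: "fixed_points {\<one>} Z = fst Z" if "finite_gset G Z" for Z :: "('a, 'z) gset"
    using finite_gsetD(3)[OF that] by (auto simp: fixed_points_def)
  have card_eq: "card (fst X) = card (fst Y)"
    using eq[OF triv_subgroup] one[OF X] one[OF Y] by simp
  show ?case
  proof (cases "fst X = {}")
    case True
    then have "fst Y = {}" using card_eq finite_gsetD(2)[OF Y] by simp
    then show ?thesis using True by (intro gset_isoI[of undefined]) (auto simp: bij_betw_def)
  next
    case False
    interpret actX: group_action G "fst X" "snd X" using X by (simp add: finite_gset_def)
    interpret actY: group_action G "fst Y" "snd Y" using Y by (simp add: finite_gset_def)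
    let ?S = "\<lambda>x. card (stabilizer G (snd X) x)"
    have img: "finite (?S ` fst X)" "?S ` fst X \<noteq> {}" using finite_gsetD(2)[OF X] False by auto
    obtain x where x: "x \<in> fst X" "?S x = Max (?S ` fst X)" using Max_in[OF img] by auto
    have max: "?S z \<le> ?S x" if "z \<in> fst X" for z
      using Max_ge[OF img(1)] that x(2) by auto
    let ?K = "stabilizer G (snd X) x"
    have "x \<in> fixed_points ?K X" using x(1) by (simp add: fixed_points_def stabilizer_def)
    then have "card (fixed_points ?K Y) \<noteq> 0"
      using eq[OF actX.stabilizer_subgroup[OF x(1)]] fixed_points_finite[OF X, of ?K] card_eq_0_iff[of "fixed_points ?K X"]
      by auto
    then obtain y where "y \<in> fixed_points ?K Y" by (metis card.empty ex_in_conv)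
    then have y: "y \<in> fst Y" "?K \<subseteq> stabilizer G (snd Y) y"
      by (auto simp: fixed_points_def stabilizer_def)
    let ?L = "stabilizer G (snd Y) y"
    \<comment> \<open>Going back with the stabilizer of \<open>y\<close> yields a point of
      \<open>X\<close> whose stabilizer is at least as large; maximality of \<open>?K\<close> then
      forces \<open>?K = ?L\<close>.\<close>
    have "y \<in> fixed_points ?L Y" using y(1) by (simp add: fixed_points_def stabilizer_def)
    then have "card (fixed_points ?L X) \<noteq> 0"
      using eq[OF actY.stabilizer_subgroup[OF y(1)]] fixed_points_finite[OF Y, of ?L] card_eq_0_iff[of "fixed_points ?L Y"]
      by auto
    then obtain z where "z \<in> fixed_points ?L X" by (metis card.empty ex_in_conv)
    then have z: "z \<in> fst X" "?L \<subseteq> stabilizer G (snd X) z"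
      by (auto simp: fixed_points_def stabilizer_def)
    have finL: "finite ?L" using fin by (simp add: stabilizer_def)
    have "card ?L \<le> card ?K"
      using card_mono[of "stabilizer G (snd X) z" ?L] z fin max[OF z(1)] by (simp add: stabilizer_def)
    then have stab: "?K = ?L"
      using y(2) finL by (metis card_seteq)
    let ?A = "orbit G (snd X) x" and ?B = "orbit G (snd Y) y"
    note A = gset_orbit[OF X x(1)] and B = gset_orbit[OF Y y(1)]
    have iso: "gset_iso G (gset_restrict X ?A) (gset_restrict Y ?B)"
      by (rule gset_iso_orbits[OF X x(1) Y y(1) stab])
    have finA: "finite_gset G (gset_restrict X ?A)" by (rule gset_restrict_finite[OF X A(2,3)])
    have finA': "finite_gset G (gset_restrict X (fst X - ?A))"
      by (rule gset_restrict_finite[OF X _ A(4)]) auto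
    have finB': "finite_gset G (gset_restrict Y (fst Y - ?B))"
      by (rule gset_restrict_finite[OF Y _ B(4)]) auto
    have "gset_iso G (gset_restrict X (fst X - ?A)) (gset_restrict Y (fst Y - ?B))"
    proof (rule less.hyps[OF _ finA' finB'])
      have "fst X - ?A \<subset> fst X" using A(1) x(1) by blast
      then show "card (fst (gset_restrict X (fst X - ?A))) < card (fst X)"
        using psubset_card_mono[OF finite_gsetD(2)[OF X]] by (simp add: gset_restrict_def)
      fix K assume K: "subgroup K G"
      show "card (fixed_points K (gset_restrict X (fst X - ?A))) = card (fixed_points K (gset_restrict Y (fst Y - ?B)))"
        using card_fixed_points_restrict[OF X A(2), of K] card_fixed_points_restrict[OF Y B(2), of K] eq[OF K]
          card_fixed_points_iso[OF finA iso subgroup.subset[OF K]] by simp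
    qed
    from gset_iso_glue[OF A(2,3) X B(2) iso this] show ?thesis by blast
  qed
qed

section \<open>Injectivity of the marks on the Burnside ring\<close>

lemma burnside_cases:
  assumes "a \<in> carrier (burnside_ring G)"
  obtains X Y :: "('a, nat) gset" where "finite_gset G X" "finite_gset G Y"
    "a = groth_diff (gset_semiring G) (gset_class G X) (gset_class G Y)"
proof -
  interpret groth "gset_semiring G" by (rule groth_gset_semiring[OF is_group])
  show ?thesis
    using assms that unfolding burnside_ring_def groth_carrier by (auto elim!: gset_semiring_cases)
qed

text \<open>Moving the negative parts of the formal differences across turns equality of marks into
  equality for actual finite G-sets. Identities in the ring can then be checked as identities of
  integers at each subgroup.\<close>

lemma burnside_eqI:
  assumes fin: "finite (carrier G)" and "a \<in> carrier (burnside_ring G)" "b \<in> carrier (burnside_ring G)"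
    and eq: "\<And>K. subgroup K G \<Longrightarrow> mark G K a = mark G K b"
  shows "a = b"
proof -
  interpret groth "gset_semiring G" by (rule groth_gset_semiring[OF is_group])
  obtain X Y :: "('a, nat) gset" where X: "finite_gset G X" and Y: "finite_gset G Y"
    and a: "a = groth_diff (gset_semiring G) (gset_class G X) (gset_class G Y)"
    using assms(2) by (rule burnside_cases)
  obtain X' Y' :: "('a, nat) gset" where X': "finite_gset G X'" and Y': "finite_gset G Y'"
    and b: "b = groth_diff (gset_semiring G) (gset_class G X') (gset_class G Y')"
    using assms(3) by (rule burnside_cases)
  have "card (fixed_points K (gset_sum X Y')) = card (fixed_points K (gset_sum X' Y))" if K: "subgroup K G" for K
    using eq[OF K] unfolding a b mark_diff[OF subgroup.subset[OF K] X Y] mark_diff[OF subgroup.subset[OF K] X' Y']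
    by (simp add: card_fixed_points_sum[OF X Y'] card_fixed_points_sum[OF X' Y])
  then have "gset_iso G (gset_sum X Y') (gset_sum X' Y)"
    by (rule gset_iso_of_marks[OF fin finite_gset_sum[OF X Y'] finite_gset_sum[OF X' Y]])
  then have "gset_class G X \<oplus>\<^bsub>gset_semiring G\<^esub> gset_class G Y' = gset_class G X' \<oplus>\<^bsub>gset_semiring G\<^esub> gset_class G Y"
    using X Y X' Y' by (simp add: gset_class_add gset_class_eq_iff finite_gset_sum)
  then show ?thesis
    unfolding a b using X Y X' Y' by (auto simp: groth_diff_eq_iff gset_class_closed)
qed

end

section \<open>The image of the marks for groups of square-free order\<close>

lemma prod_primes_dvd:
  assumes "finite A" "\<And>p. p \<in> A \<Longrightarrow> prime p \<and> int p dvd z"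
  shows "int (\<Prod>A) dvd z"
  using assms
proof (induction A rule: finite_induct)
  case (insert p A)
  have "coprime p (\<Prod>A)"
    by (rule prod_coprime_right) (use insert in \<open>auto intro: primes_coprime\<close>)
  then have "coprime (int p) (int (\<Prod>A))" by (simp only: coprime_int_iff)
  then show ?case using insert by (simp add: divides_mult del: of_nat_prod)
qed simp

lemma squarefree_dvd:
  assumes "squarefree (n::nat)" "\<And>p. prime p \<Longrightarrow> p dvd n \<Longrightarrow> int p dvd z"
  shows "int n dvd z"
proof -
  have n0: "n \<noteq> 0" using assms(1) by (metis not_squarefree_0)
  have "multiplicity p n = 1" if "p \<in> prime_factors n" for p
    using that assms(1) n0 by (auto simp: squarefree_factorial_semiring'' prime_factors_multiplicity le_Suc_eq)
  then have "n = \<Prod>(prime_factors n)"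
    using prime_factorization_nat[of n] n0 by simp
  moreover have "int (\<Prod>(prime_factors n)) dvd z"
    using assms(2) by (intro prod_primes_dvd) auto
  ultimately show ?thesis by simp
qed

context group
begin

text \<open>The functions live on all subsets, but only their values at subgroups are constrained;
  equations between them are accordingly asserted at subgroups only.\<close>

definition ghost :: "('a set \<Rightarrow> int) \<Rightarrow> bool" where
  "ghost f \<longleftrightarrow> (\<forall>K g. subgroup K G \<longrightarrow> g \<in> carrier G \<longrightarrow> f (conjugate g K) = f K) \<and>
     (\<forall>p K L. prime p \<longrightarrow> normal_step p K L \<longrightarrow> [f K = f L] (mod int p))"

lemma ghostD:
  assumes "ghost f"
  shows "subgroup K G \<Longrightarrow> g \<in> carrier G \<Longrightarrow> f (conjugate g K) = f K"
    and "prime p \<Longrightarrow> normal_step p K L \<Longrightarrow> [f K = f L] (mod int p)"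
  using assms by (auto simp: ghost_def)

lemma mark_coset_gset:
  assumes "finite (carrier G)" "subgroup K G" "subgroup L G"
  shows "mark G L (burnside_class G (coset_gset K)) = int (card (fixed_points L (coset_gset K)))"
  by (rule mark_class[OF subgroup.subset[OF assms(3)] coset_gset_finite[OF assms(1,2)]])

lemma ghost_fixed_points:
  assumes "finite (carrier G)" "finite_gset G X"
  shows "ghost (\<lambda>K. int (card (fixed_points K X)))"
  unfolding ghost_def
  using card_fixed_points_conjugate[OF assms(2) subgroup.subset] card_fixed_points_cong[OF assms(2) _ _ assms(1)]
  by (auto simp: cong_int_iff)

text \<open>One closure property for several purposes: \<open>c = 1\<close> handles formal
  differences, \<open>f = 0\<close> integer multiples, and the general case the subtraction of
  multiples of coset spaces.\<close>

lemma ghost_diff_mult: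
  assumes "ghost f" "ghost g"
  shows "ghost (\<lambda>K. f K - c * g K)"
  unfolding ghost_def using ghostD[OF assms(1)] ghostD[OF assms(2)] by (auto intro!: cong_diff cong_scalar_left)

lemma mark_ghost:
  assumes "finite (carrier G)" "a \<in> carrier (burnside_ring G)"
  shows "ghost (\<lambda>K. mark G K a)"
proof -
  obtain X Y :: "('a, nat) gset" where X: "finite_gset G X" and Y: "finite_gset G Y"
    and a: "a = groth_diff (gset_semiring G) (gset_class G X) (gset_class G Y)"
    using assms(2) by (rule burnside_cases)
  have g: "ghost (\<lambda>K. int (card (fixed_points K X)) - 1 * int (card (fixed_points K Y)))"
    by (rule ghost_diff_mult[OF ghost_fixed_points[OF assms(1) X] ghost_fixed_points[OF assms(1) Y]])
  have eq: "mark G K a = int (card (fixed_points K X)) - 1 * int (card (fixed_points K Y))" if "subgroup K G" for K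
    unfolding a by (simp add: mark_diff[OF subgroup.subset[OF that] X Y])
  have "subgroup K G" "subgroup L G" if "normal_step p K L" for p K L
    using that by (auto simp: normal_step_def)
  then show ?thesis
    using ghostD[OF g] unfolding ghost_def by (metis eq conjugate_subgroup)
qed

interpretation A: cring "burnside_ring G"
  by (rule burnside_ring_cring[OF is_group])

lemma mark_simps:
  assumes "subgroup K G"
  shows "mark G K \<zero>\<^bsub>burnside_ring G\<^esub> = 0" "mark G K \<one>\<^bsub>burnside_ring G\<^esub> = 1"
    and "a \<in> carrier (burnside_ring G) \<Longrightarrow> b \<in> carrier (burnside_ring G) \<Longrightarrow>
      mark G K (a \<oplus>\<^bsub>burnside_ring G\<^esub> b) = mark G K a + mark G K b"
    and "a \<in> carrier (burnside_ring G) \<Longrightarrow> b \<in> carrier (burnside_ring G) \<Longrightarrow>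
      mark G K (a \<otimes>\<^bsub>burnside_ring G\<^esub> b) = mark G K a * mark G K b"
    and "a \<in> carrier (burnside_ring G) \<Longrightarrow> mark G K (\<ominus>\<^bsub>burnside_ring G\<^esub> a) = - mark G K a"
proof -
  note hom = mark_ring_hom[OF is_group subgroup.subset[OF assms]]
  show add: "mark G K (a \<oplus>\<^bsub>burnside_ring G\<^esub> b) = mark G K a + mark G K b"
    if "a \<in> carrier (burnside_ring G)" "b \<in> carrier (burnside_ring G)" for a b
    using ring_hom_add[OF hom that] by simp
  show "mark G K (a \<otimes>\<^bsub>burnside_ring G\<^esub> b) = mark G K a * mark G K b"
    if "a \<in> carrier (burnside_ring G)" "b \<in> carrier (burnside_ring G)"
    using ring_hom_mult[OF hom that] by simp
  show "mark G K \<one>\<^bsub>burnside_ring G\<^esub> = 1" using ring_hom_one[OF hom] by simp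
  show zero: "mark G K \<zero>\<^bsub>burnside_ring G\<^esub> = 0"
    using add[of "\<zero>\<^bsub>burnside_ring G\<^esub>" "\<zero>\<^bsub>burnside_ring G\<^esub>"] by simp
  show "mark G K (\<ominus>\<^bsub>burnside_ring G\<^esub> a) = - mark G K a" if "a \<in> carrier (burnside_ring G)"
    using add[of "\<ominus>\<^bsub>burnside_ring G\<^esub> a" a] that zero by (simp add: A.l_neg)
qed

section \<open>Surjectivity of the marks onto the ghost functions\<close>

definition realized :: "('a set \<Rightarrow> int) \<Rightarrow> bool" where
  "realized f \<longleftrightarrow> (\<exists>a \<in> carrier (burnside_ring G). \<forall>K. subgroup K G \<longrightarrow> mark G K a = f K)"

lemma realized_add: "realized f \<Longrightarrow> realized g \<Longrightarrow> realized (\<lambda>K. f K + g K)"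
  unfolding realized_def by (metis A.a_closed mark_simps(3))

lemma realized_uminus: "realized f \<Longrightarrow> realized (\<lambda>K. - f K)"
  unfolding realized_def by (metis A.a_inv_closed mark_simps(5))

lemma realized_zero: "realized (\<lambda>K. 0)"
  unfolding realized_def by (metis A.zero_closed mark_simps(1))

lemma realized_mult:
  assumes "realized f"
  shows "realized (\<lambda>K. c * f K)"
proof (induction c rule: int_induct[of _ 0])
  case base
  then show ?case using realized_zero by simp
next
  case (step1 i)
  then show ?case using realized_add[OF step1(2) assms] by (simp add: distrib_right)
next
  case (step2 i)
  then show ?case using realized_add[OF step2(2) realized_uminus[OF assms]] by (simp add: left_diff_distrib)
qed

lemma realized_coset:
  assumes "finite (carrier G)" "subgroup K G"
  shows "realized (\<lambda>L. int (card (fixed_points L (coset_gset K))))"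
proof -
  have fin: "finite_gset G (coset_gset K)" by (rule coset_gset_finite[OF assms])
  interpret groth "gset_semiring G" by (rule groth_gset_semiring[OF is_group])
  have "burnside_class G (coset_gset K) \<in> carrier (burnside_ring G)"
    using groth_diff_closed[OF gset_class_closed[OF fin]] unfolding burnside_class_def burnside_ring_def by simp
  then show ?thesis
    unfolding realized_def using mark_coset_gset[OF assms] by blast
qed

text \<open>
  By Cauchy's theorem in the Weyl group \<open>W\<close> of \<open>K\<close>, the congruences force \<open>card W\<close>, which is
  square-free, to divide \<open>f K\<close> whenever \<open>f\<close> vanishes on all subgroups larger than \<open>K\<close>.  So the
  value at \<open>K\<close> can be cleared by subtracting a multiple of the coset space of \<open>K\<close>.
\<close>

theorem ghost_realized:
  assumes fin: "finite (carrier G)" and sq: "squarefree (order G)" and "ghost f"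
  shows "realized f"
proof -
  have subs: "finite {K. subgroup K G}"
    by (rule finite_subset[of _ "Pow (carrier G)"]) (use subgroup.subset fin in auto)
  have pos: "card K > 0" if "subgroup K G" for K
    using subgroup.one_closed[OF that] finite_subset[OF subgroup.subset[OF that] fin] by (auto simp: card_gt_0_iff)
  \<comment> \<open>\<open>V\<close> contains the support of \<open>f\<close>, is stable under
    conjugation and contains every subgroup smaller than one of its members. Removing the class of a
    member of maximal order preserves this.\<close>
  have gen: "realized f"
    if "finite V" "V \<subseteq> {K. subgroup K G}"
      "\<And>K g. K \<in> V \<Longrightarrow> g \<in> carrier G \<Longrightarrow> conjugate g K \<in> V"
      "\<And>K L. K \<in> V \<Longrightarrow> subgroup L G \<Longrightarrow> card L < card K \<Longrightarrow> L \<in> V"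
      "ghost f" "\<And>K. subgroup K G \<Longrightarrow> K \<notin> V \<Longrightarrow> f K = 0" for V f
    using that
  proof (induction V arbitrary: f rule: finite_psubset_induct)
    case (psubset V)
    show ?case
    proof (cases "V = {}")
      case True
      then show ?thesis using psubset.prems(5) mark_simps(1) A.zero_closed unfolding realized_def by force
    next
      case False
      have img: "finite (card ` V)" "card ` V \<noteq> {}" using psubset.hyps False by auto
      obtain K where KV: "K \<in> V" "card K = Max (card ` V)" using Max_in[OF img] by auto
      have max: "card L \<le> card K" if "L \<in> V" for L using Max_ge[OF img(1)] that KV(2) by auto
      have K: "subgroup K G" "K \<subseteq> carrier G" using KV(1) psubset.prems(1) subgroup.subset by auto
      let ?c = "\<lambda>L. int (card (fixed_points L (coset_gset K)))"
      \<comment> \<open>The mark of the coset space of \<open>K\<close> at \<open>K\<close> itself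
        is the order of the Weyl group.\<close>
      let ?W = "card (fixed_points K (coset_gset K))"
      have W: "?W * card K = card (normalizing K)"
        using card_fixed_points_coset[OF fin K] transporter_normalizing[OF fin K(1)] by simp
      have N: "card (normalizing K) dvd order G"
        using subgroup_card_dvd[OF normalizing_subgroup[OF K(2)] subgroup_self]
        by (simp add: order_def normalizing_def)
      have "int ?W dvd f K"
      proof (rule squarefree_dvd)
        have "?W dvd order G" using N W by (metis dvd_mult_left)
        then show "squarefree ?W" using sq squarefree_mono by blast
        fix p assume p: "prime p" "p dvd ?W"
        then have d: "p * card K dvd card (normalizing K)" unfolding W[symmetric] by (simp add: mult_dvd_mono)
        then have "\<not> p dvd card K" using squarefree_not_square_dvd[OF sq p(1)] N dvd_trans by blast
        then obtain L where L: "normal_step p K L"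
          using normal_step_exists[OF fin K(1) p(1) d] by blast
        have "card L > card K" using L pos[OF K(1)] prime_gt_1_nat[OF p(1)] by (auto simp: normal_step_def)
        then have "f L = 0" using psubset.prems(5) L max by (force simp: normal_step_def)
        then show "int p dvd f K"
          using ghostD(2)[OF psubset.prems(4) p(1) L] by (simp add: cong_0_iff)
      qed
      then obtain d where "f K = int ?W * d" by (rule dvdE)
      then have d: "f K = d * ?c K" by simp
      let ?f = "\<lambda>L. f L - d * ?c L"
      have gh: "ghost ?f"
        by (rule ghost_diff_mult[OF psubset.prems(4) ghost_fixed_points[OF fin coset_gset_finite[OF fin K(1)]]])
      define V' where "V' = V - {conjugate g K | g. g \<in> carrier G}"
      have KK: "K \<in> {conjugate g K | g. g \<in> carrier G}" using conjugate_one[OF K(2)] by force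
      have "realized ?f"
      proof (rule psubset.IH[of V'])
        show "V' \<subset> V" using KV(1) KK by (auto simp: V'_def)
        show "V' \<subseteq> {K. subgroup K G}" using psubset.prems(1) by (auto simp: V'_def)
        show "ghost ?f" by (rule gh)
      next
        fix L g assume L: "L \<in> V'" and g: "g \<in> carrier G"
        then have Lc: "L \<subseteq> carrier G" using psubset.prems(1) subgroup.subset by (auto simp: V'_def)
        have "L = conjugate (inv g \<otimes> h) K" if h: "h \<in> carrier G" "conjugate g L = conjugate h K" for h
        proof -
          have "L = conjugate (inv g) (conjugate h K)" using conjugate_inv(1)[OF g Lc] h(2) by simp
          then show ?thesis using g h(1) K(2) by (simp add: conjugate_mult)
        qed
        then show "conjugate g L \<in> V'"
          using L g psubset.prems(2) by (auto simp: V'_def)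
      next
        fix L M assume L: "L \<in> V'" and M: "subgroup M G" "card M < card L"
        then have "M \<in> V" "card L \<le> card K" using psubset.prems(3) max by (auto simp: V'_def)
        then show "M \<in> V'" using M(2) card_conjugate[OF _ K(2)] by (auto simp: V'_def)
      next
        fix L assume L: "subgroup L G" "L \<notin> V'"
        show "?f L = 0"
        proof (cases "L \<in> V")
          case True
          then obtain g where g: "g \<in> carrier G" "L = conjugate g K" using L(2) by (auto simp: V'_def)
          show ?thesis using ghostD(1)[OF gh K(1) g(1)] d unfolding g(2) by simp
        next
          case False
          \<comment> \<open>A subgroup conjugate into \<open>K\<close> is either smaller than
            \<open>K\<close>, hence in \<open>V\<close> by closure, or a conjugate of
            \<open>K\<close>, hence in \<open>V\<close> as well. So the subtracted coset space has
            mark 0 outside \<open>V\<close>.\<close>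
          have "transporter L K = {}"
          proof (rule ccontr)
            assume "transporter L K \<noteq> {}"
            then obtain g where g: "g \<in> transporter L K" by blast
            have "card L \<le> card K" by (rule card_le_of_transporter[OF fin K(1) L(1) g])
            moreover have "\<not> card L < card K" using psubset.prems(3)[OF KV(1) L(1)] False by blast
            ultimately have "conjugate g K = L" using transporter_self[OF fin K(1) L(1) _ g] by simp
            then show False using psubset.prems(2)[OF KV(1)] g False by (auto simp: transporter_def)
          qed
          then have "card (fixed_points L (coset_gset K)) * card K = 0"
            using card_fixed_points_coset[OF fin K(1) subgroup.subset[OF L(1)]] by simp
          then have "card (fixed_points L (coset_gset K)) = 0" using pos[OF K(1)] by simp
          then show ?thesis using psubset.prems(5)[OF L(1) False] by simp
        qed
      qed
      from realized_add[OF this realized_mult[OF realized_coset[OF fin K(1)], of d]]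
      show ?thesis by simp
    qed
  qed
  show ?thesis
    by (rule gen[OF subs]) (use assms(3) conjugate_subgroup in auto)
qed

end

section \<open>Subgroups linked to a given subgroup\<close>

text \<open>\<open>u\<close> is \<open>x div p\<close> for a Chinese remainder solution
  \<open>x\<close>. Prescribing \<open>x\<close> modulo \<open>p ^ 2\<close> rather than
  \<open>p\<close> fixes \<open>u\<close> modulo \<open>p\<close>, so that \<open>u\<close> becomes
  prime to all of \<open>n\<close>.\<close>

lemma prime_unit_multiplier:
  assumes "squarefree (n::nat)" "prime p" "p dvd n"
  shows "\<exists>u :: int. coprime u (int n) \<and> [int p * u = 1] (mod int (n div p))"
proof -
  have n: "n = p * (n div p)" using assms(3) by simp
  have "\<not> p dvd n div p" using squarefree_not_square_dvd[OF assms(1,2), of "n div p"] n by simp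
  then have "coprime p (n div p)" using assms(2) by (simp add: prime_imp_coprime)
  then have cop: "coprime (int p) (int (n div p))" by (simp only: coprime_int_iff)
  then have "coprime (int p ^ 2) (int (n div p))" by simp
  then obtain x where x: "[x = int p] (mod int p ^ 2)" "[x = 1] (mod int (n div p))"
    using binary_chinese_remainder_int by blast
  have "[x = int p] (mod int p)"
    using x(1) by (rule cong_dvd_modulus) (simp add: power2_eq_square)
  then have "int p dvd x" by (simp add: cong_dvd_iff)
  then obtain u where u: "x = int p * u" by (rule dvdE)
  have "[int p * u = int p * 1] (mod int p * int p)" using x(1) u by (simp add: power2_eq_square)
  then have "int p * int p dvd int p * (u - 1)" by (simp add: cong_iff_dvd_diff right_diff_distrib)
  then have "int p dvd u - 1" using prime_gt_0_nat[OF assms(2)] by (subst (asm) dvd_times_left_cancel_iff) auto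
  then have "[u = 1] (mod int p)" by (simp add: cong_iff_dvd_diff)
  then have "coprime u (int p)" by (metis cong_imp_coprime cong_sym coprime_1_left)
  moreover have "coprime u (int (n div p))"
    using x(2) unfolding u by (metis cong_imp_coprime cong_sym coprime_1_left coprime_mult_left_iff)
  ultimately have "coprime u (int p * int (n div p))" by simp
  also have "int p * int (n div p) = int n" using n by (metis of_nat_mult)
  finally show ?thesis using x(2) u by blast
qed

locale squarefree_group = group G for G (structure) +
  fixes H
  assumes fin: "finite (carrier G)" and sq: "squarefree (order G)" and H: "subgroup H G"
begin

definition linked where
  "linked p K L \<longleftrightarrow> normal_step p K L \<or> normal_step p L K"

lemma linked_sym: "linked p K L \<Longrightarrow> linked p L K"
  by (auto simp: linked_def)

lemma linked_subgroups: "linked p K L \<Longrightarrow> subgroup K G \<and> subgroup L G"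
  by (auto simp: linked_def normal_step_def)

lemma linked_card: "linked p K L \<Longrightarrow> card L = p * card K \<or> card K = p * card L"
  by (auto simp: linked_def normal_step_def)

lemma linked_conjugate: "linked p K L \<Longrightarrow> g \<in> carrier G \<Longrightarrow> linked p (conjugate g K) (conjugate g L)"
  by (auto simp: linked_def normal_step_conjugate)

lemma card_pos: "subgroup K G \<Longrightarrow> card K > 0"
  using subgroup.one_closed[of K G] finite_subset[OF subgroup.subset[of K G] fin] by (auto simp: card_gt_0_iff)

lemma card_dvd_order: "subgroup K G \<Longrightarrow> card K dvd order G"
  using subgroup_card_dvd[OF _ subgroup_self subgroup.subset] by (simp add: order_def)

lemma linked_dvd_order:
  assumes "linked p K L"
  shows "p dvd order G"
proof -
  have "card K dvd order G" "card L dvd order G" "p dvd card K \<or> p dvd card L"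
    using linked_subgroups[OF assms] linked_card[OF assms] card_dvd_order by auto
  then show ?thesis using dvd_trans by blast
qed

text \<open>\<open>K\<close> has order prime to \<open>p\<close> if it is the smaller group of a
  step and divisible by \<open>p\<close> if it is the larger one, so both links go in the same
  direction. Upwards the neighbours are conjugate, downwards even equal.\<close>

lemma linked_unique:
  assumes p: "prime p" and "linked p K L" "linked p K M"
  shows "\<exists>g \<in> carrier G. M = conjugate g L"
proof -
  have not_dvd: "\<not> p dvd card A" if "normal_step p A B" for A B
    using squarefree_not_square_dvd[OF sq p, of "card A"] card_dvd_order[of B] that by (simp add: normal_step_def)
  have dvd: "p dvd card B" if "normal_step p A B" for A B
    using that by (simp add: normal_step_def)
  consider "normal_step p K L" "normal_step p K M" | "normal_step p L K" "normal_step p M K"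
    using assms(2,3) not_dvd dvd unfolding linked_def by blast
  then show ?thesis
  proof cases
    case 1
    then show ?thesis using normal_step_unique_above[OF fin sq p 1(2,1)] by auto
  next
    case 2
    have M: "subgroup M G" "M \<subseteq> K" and "p * card M = p * card L"
      using 2 by (auto simp: normal_step_def)
    then have "card M = card L" using prime_gt_0_nat[OF p] by simp
    then have "M = L" by (rule normal_step_unique_below[OF fin 2(1) p not_dvd[OF 2(1)] M])
    moreover have "L = conjugate \<one> L"
      using conjugate_one linked_subgroups[OF assms(2)] subgroup.subset by blast
    ultimately show ?thesis by blast
  qed
qed

section \<open>The conjugacy class of \<open>H\<close> and its neighbours at each prime\<close>

definition cls where
  "cls = {conjugate g H | g. g \<in> carrier G}"

text \<open>Neighbours of all conjugates of \<open>H\<close> are collected, so that a case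
  distinction on membership defines a class function.\<close>

definition adj where
  "adj p = {K. \<exists>L \<in> cls. linked p L K}"

lemma H_cls: "H \<in> cls"
proof -
  have "H = conjugate \<one> H" using conjugate_one[OF subgroup.subset[OF H]] by simp
  then show ?thesis unfolding cls_def by blast
qed

lemma cls_card: "K \<in> cls \<Longrightarrow> card K = card H"
  using card_conjugate subgroup.subset[OF H] by (auto simp: cls_def)

lemma adj_subgroup: "K \<in> adj p \<Longrightarrow> subgroup K G"
  using linked_subgroups by (auto simp: adj_def)

lemma cls_conjugate:
  assumes "K \<in> cls" "g \<in> carrier G"
  shows "conjugate g K \<in> cls"
proof -
  obtain h where h: "h \<in> carrier G" "K = conjugate h H" using assms(1) by (auto simp: cls_def)
  then have "conjugate g K = conjugate (g \<otimes> h) H"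
    using conjugate_mult[OF assms(2) h(1) subgroup.subset[OF H]] by simp
  then show ?thesis using h(1) assms(2) unfolding cls_def by blast
qed

lemma adj_conjugate: "K \<in> adj p \<Longrightarrow> g \<in> carrier G \<Longrightarrow> conjugate g K \<in> adj p"
  using linked_conjugate cls_conjugate unfolding adj_def by blast

lemma cls_adj_conjugate_iff:
  assumes "subgroup K G" "g \<in> carrier G"
  shows "conjugate g K \<in> cls \<longleftrightarrow> K \<in> cls" "conjugate g K \<in> adj p \<longleftrightarrow> K \<in> adj p"
  using cls_conjugate adj_conjugate inv_closed[OF assms(2)] assms(2)
    conjugate_inv(1)[OF assms(2) subgroup.subset[OF assms(1)]]
  by metis+

lemma linked_cls_adj: "K \<in> cls \<Longrightarrow> linked p K L \<Longrightarrow> L \<in> adj p"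
  by (auto simp: adj_def)

text \<open>A \<open>p\<close>-neighbour of the class already has a \<open>p\<close>-neighbour in
  it, and all its \<open>p\<close>-neighbours are conjugate. So congruences modulo \<open>p\<close>
  at such a subgroup involve the value at \<open>H\<close> only.\<close>

lemma linked_adj_cls:
  assumes "prime p" "K \<in> adj p" "linked p K L"
  shows "L \<in> cls"
proof -
  obtain M where M: "M \<in> cls" "linked p M K" using assms(2) by (auto simp: adj_def)
  then show ?thesis
    using linked_unique[OF assms(1) linked_sym[OF M(2)] assms(3)] cls_conjugate[OF M(1)] by auto
qed

text \<open>After moving both to the same conjugate of \<open>H\<close>, uniqueness of neighbours
  applies. One representative per prime therefore suffices in
  \<open>gen_val_quotient\<close>.\<close>

lemma adj_conjugates:
  assumes p: "prime p" and "K \<in> adj p" "L \<in> adj p"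
  shows "\<exists>g \<in> carrier G. L = conjugate g K"
proof -
  obtain g h where g: "g \<in> carrier G" "linked p (conjugate g H) K" and h: "h \<in> carrier G" "linked p (conjugate h H) L"
    using assms(2,3) by (auto simp: adj_def cls_def)
  note Hc = subgroup.subset[OF H] and Kc = subgroup.subset[OF adj_subgroup[OF assms(2)]]
  have gh: "h \<otimes> inv g \<in> carrier G" using g h by simp
  have "linked p (conjugate (h \<otimes> inv g) (conjugate g H)) (conjugate (h \<otimes> inv g) K)"
    by (rule linked_conjugate[OF g(2) gh])
  moreover have "conjugate (h \<otimes> inv g) (conjugate g H) = conjugate h H"
    using g(1) h(1) Hc by (simp add: conjugate_mult[symmetric] m_assoc)
  ultimately obtain k where k: "k \<in> carrier G" "L = conjugate k (conjugate (h \<otimes> inv g) K)"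
    using linked_unique[OF p _ h(2)] by auto
  then show ?thesis using conjugate_mult[OF k(1) gh Kc] m_closed[OF k(1) gh] by metis
qed

lemma adj_card: "K \<in> adj p \<Longrightarrow> card K = p * card H \<or> card H = p * card K"
  using linked_card[of p _ K] cls_card unfolding adj_def by force

lemma adj_not_cls:
  assumes "prime p" "K \<in> adj p"
  shows "K \<notin> cls"
proof
  assume "K \<in> cls"
  then have "card H = p * card H" using adj_card[OF assms(2)] cls_card by auto
  then show False using card_pos[OF H] prime_gt_1_nat[OF assms(1)] by simp
qed

text \<open>The ratio of the orders of \<open>K\<close> and \<open>H\<close> is the prime or its
  inverse, and it determines the prime.\<close>

lemma adj_prime_unique:
  assumes p: "prime p" "prime q" and K: "K \<in> adj p" "K \<in> adj q"
  shows "p = q"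
proof -
  have eq: "p = q" if "x = p * z" "x = q * z" "z > 0" for x z :: nat
    using that by auto
  have no: False if "x = a * z" "z = b * x" "x > 0" "prime a" for a b x z :: nat
  proof -
    have "x * (a * b) = x * 1" using that(1,2) by (simp add: ac_simps)
    then have "a * b = 1" using that(3) by (simp only: mult_cancel1) simp
    then show False using that(4) by simp
  qed
  from adj_card[OF K(1)] adj_card[OF K(2)] show ?thesis
    using eq no p card_pos[OF H] card_pos[OF adj_subgroup[OF K(1)]] by (elim disjE) blast+
qed

section \<open>The primes at which \<open>H\<close> has neighbours, and their units\<close>

definition P where
  "P = {p. prime p \<and> adj p \<noteq> {}}"

lemma P_dvd_order: "p \<in> P \<Longrightarrow> p dvd order G"
  using linked_dvd_order by (auto simp: P_def adj_def)

lemma order_pos: "order G > 0"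
  using sq by (metis gr0I not_squarefree_0)

lemma finite_P: "finite P"
  by (rule finite_subset[of _ "{p. p dvd order G}"]) (use P_dvd_order order_pos in auto)

lemma adj_P: "prime p \<Longrightarrow> K \<in> adj p \<Longrightarrow> p \<in> P"
  by (auto simp: P_def)

text \<open>The correction factor turns \<open>p\<close> into a residue \<open>1\<close> modulo the other primes dividing \<open>|G|\<close>, as
  the congruences between a \<open>p\<close>-neighbour of \<open>H\<close> and its own neighbours require.\<close>

definition unit_of :: "nat \<Rightarrow> int" where
  "unit_of p = (SOME u. coprime u (int (order G)) \<and> [int p * u = 1] (mod int (order G div p)))"

lemma unit_of:
  assumes "p \<in> P"
  shows "coprime (unit_of p) (int (order G))" "[int p * unit_of p = 1] (mod int (order G div p))"
  using someI_ex[OF prime_unit_multiplier[OF sq _ P_dvd_order[OF assms]]] assms unfolding unit_of_def P_def by auto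

lemma unit_of_cong:
  assumes "p \<in> P" "prime q" "q dvd order G" "q \<noteq> p"
  shows "[int p * unit_of p = 1] (mod int q)"
proof -
  have "prime p" using assms(1) by (simp add: P_def)
  have "q dvd p * (order G div p)" using assms(3) P_dvd_order[OF assms(1)] by simp
  then have "q dvd order G div p"
    using assms(2,4) \<open>prime p\<close> by (metis prime_dvd_mult_iff primes_dvd_imp_eq)
  then show ?thesis using unit_of(2)[OF assms(1)] by (meson cong_dvd_modulus of_nat_dvd_iff)
qed

lemma unit_of_nonzero:
  assumes "p \<in> P"
  shows "unit_of p \<noteq> 0"
proof
  assume "unit_of p = 0"
  then have "order G = 1" using unit_of(1)[OF assms] by simp
  then show False using P_dvd_order[OF assms] assms by (simp add: P_def)
qed

text \<open>Empty or a singleton, by \<open>adj_prime_unique\<close>; as a set it allows values to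
  be written as products without a case distinction.\<close>

definition nbrs where
  "nbrs K = {p \<in> P. K \<in> adj p}"

lemma nbrs_conjugate: "subgroup K G \<Longrightarrow> g \<in> carrier G \<Longrightarrow> nbrs (conjugate g K) = nbrs K"
  by (simp add: nbrs_def cls_adj_conjugate_iff)

lemma finite_nbrs: "finite (nbrs K)"
  using finite_P by (simp add: nbrs_def)

lemma nbrs_adj:
  assumes "prime p" "K \<in> adj p"
  shows "nbrs K = {p}"
  using assms adj_P adj_prime_unique by (auto simp: nbrs_def P_def)

text \<open>The marks of the elements \<open>x\<close> and \<open>y\<close> in \<open>cyclic_stably_iso\<close>.  The second is the smallest
  multiple of the primitive idempotent of \<open>H\<close> that satisfies the congruences.\<close>

definition gen_val :: "'a set \<Rightarrow> int" where
  "gen_val K = (if K \<in> cls then 0 else \<Prod>p \<in> nbrs K. int p * unit_of p)"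

definition idem_val :: "'a set \<Rightarrow> int" where
  "idem_val K = (if K \<in> cls then int (\<Prod>P) else 0)"

text \<open>Every factor belongs to a prime other than \<open>q\<close>, and its unit makes it 1
  modulo \<open>q\<close>.\<close>

lemma gen_val_cong_1:
  assumes "prime q" "q dvd order G" "K \<notin> cls" "K \<notin> adj q"
  shows "[gen_val K = 1] (mod int q)"
proof -
  have "[(\<Prod>p \<in> nbrs K. int p * unit_of p) = (\<Prod>p \<in> nbrs K. 1)] (mod int q)"
    by (rule cong_prod) (use assms unit_of_cong in \<open>auto simp: nbrs_def\<close>)
  then show ?thesis using assms(3) by (simp add: gen_val_def)
qed

text \<open>If one end of a \<open>q\<close>-link lies in the class of \<open>H\<close>, the other
  is a \<open>q\<close>-neighbour; otherwise neither end is one, by \<open>linked_adj_cls\<close>.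
  So only two kinds of congruences remain.\<close>

lemma ghostI:
  fixes f :: "'a set \<Rightarrow> int"
  assumes conj: "\<And>K g. subgroup K G \<Longrightarrow> g \<in> carrier G \<Longrightarrow> f (conjugate g K) = f K"
    and cls: "\<And>q K L. prime q \<Longrightarrow> K \<in> cls \<Longrightarrow> L \<in> adj q \<Longrightarrow> [f K = f L] (mod int q)"
    and other: "\<And>q K L. prime q \<Longrightarrow> q dvd order G \<Longrightarrow> linked q K L \<Longrightarrow> K \<notin> cls \<Longrightarrow> L \<notin> cls \<Longrightarrow>
      K \<notin> adj q \<Longrightarrow> L \<notin> adj q \<Longrightarrow> [f K = f L] (mod int q)"
  shows "ghost f"
  unfolding ghost_def
proof (intro conjI allI impI)
  fix p K L assume p: "prime (p::nat)" and "normal_step p K L"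
  then have l: "linked p K L" by (simp add: linked_def)
  show "[f K = f L] (mod int p)"
  proof (cases "K \<in> cls")
    case True
    then show ?thesis using cls[OF p] linked_cls_adj l by blast
  next
    case False
    show ?thesis
    proof (cases "L \<in> cls")
      case True
      then show ?thesis using cls[OF p] linked_cls_adj linked_sym[OF l] cong_sym by blast
    next
      case L: False
      then show ?thesis
        using other[OF p linked_dvd_order[OF l] l False L] linked_adj_cls[OF p _ l]
          linked_adj_cls[OF p _ linked_sym[OF l]] False
        by blast
    qed
  qed
qed (rule conj)

lemma ghost_gen_val: "ghost gen_val"
proof (rule ghostI)
  show "gen_val (conjugate g K) = gen_val K" if "subgroup K G" "g \<in> carrier G" for K g
    using that by (simp add: gen_val_def nbrs_conjugate cls_adj_conjugate_iff)
  fix q :: nat and K L assume q: "prime q"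
  show "[gen_val K = gen_val L] (mod int q)" if "K \<in> cls" "L \<in> adj q"
    using that adj_not_cls[OF q that(2)] by (simp add: gen_val_def nbrs_adj[OF q] cong_def)
  assume "q dvd order G" "K \<notin> cls" "L \<notin> cls" "K \<notin> adj q" "L \<notin> adj q"
  then show "[gen_val K = gen_val L] (mod int q)"
    using gen_val_cong_1[OF q] cong_trans cong_sym by metis
qed

lemma ghost_idem_val: "ghost idem_val"
proof (rule ghostI)
  show "idem_val (conjugate g K) = idem_val K" if "subgroup K G" "g \<in> carrier G" for K g
    using that by (simp add: idem_val_def cls_adj_conjugate_iff)
  fix q :: nat and K L assume q: "prime q"
  show "[idem_val K = idem_val L] (mod int q)" if "K \<in> cls" "L \<in> adj q"
  proof -
    have "q dvd \<Prod>P" using dvd_prodI[OF finite_P adj_P[OF q that(2)], of id] by simp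
    then have "int q dvd int (\<Prod>P)" by (simp only: int_dvd_int_iff)
    then show ?thesis
      using that adj_not_cls[OF q that(2)] by (simp add: idem_val_def cong_0_iff del: of_nat_prod)
  qed
  assume "K \<notin> cls" "L \<notin> cls"
  then show "[idem_val K = idem_val L] (mod int q)" by (simp add: idem_val_def)
qed

lemma gen_val_nonzero: "K \<notin> cls \<Longrightarrow> gen_val K \<noteq> 0"
  using finite_nbrs unit_of_nonzero by (auto simp: gen_val_def nbrs_def P_def)

lemma ghost_cls: "ghost f \<Longrightarrow> K \<in> cls \<Longrightarrow> f K = f H"
  using ghostD(1) H by (auto simp: cls_def)

lemma ghost_adj:
  assumes "ghost f" "prime p" "K \<in> adj p"
  shows "[f K = f H] (mod int p)"
proof -
  obtain L where L: "L \<in> cls" "linked p L K" using assms(3) by (auto simp: adj_def)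
  then have "[f K = f L] (mod int p)"
    using ghostD(2)[OF assms(1,2)] cong_sym unfolding linked_def by blast
  then show ?thesis using ghost_cls[OF assms(1) L(1)] by simp
qed

text \<open>Each prime in \<open>P\<close> has a neighbour at which \<open>f\<close> vanishes, and
  the congruence carries the divisibility over to \<open>H\<close>. This minimality makes
  \<open>y\<close> generate the kernel of \<open>x\<close>.\<close>

lemma idem_val_divides:
  assumes "ghost f" "\<And>K. subgroup K G \<Longrightarrow> K \<notin> cls \<Longrightarrow> f K = 0"
  shows "int (\<Prod>P) dvd f H"
proof (rule prod_primes_dvd[OF finite_P])
  fix p assume "p \<in> P"
  then obtain K where p: "prime p" and K: "K \<in> adj p" by (auto simp: P_def)
  have "f K = 0" by (rule assms(2)[OF adj_subgroup[OF K] adj_not_cls[OF p K]])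
  then have "[f H = 0] (mod int p)" using ghost_adj[OF assms(1) p K] cong_sym by metis
  then show "prime p \<and> int p dvd f H" using p by (simp add: cong_0_iff)
qed

definition unit_prod :: int where
  "unit_prod = (\<Prod>p \<in> P. unit_of p)"

text \<open>The units are prime to the whole group order, which all primes in \<open>P\<close>
  divide. This gives the Bezout relation that makes the denominator stably invertible.\<close>

lemma unit_prod_coprime: "coprime unit_prod (int (\<Prod>P))"
proof -
  have "coprime (unit_of p) (int q)" if "p \<in> P" "q \<in> P" for p q
    using unit_of(1)[OF that(1)] P_dvd_order[OF that(2)] by (metis coprime_divisors dvd_refl int_dvd_int_iff)
  then show ?thesis unfolding unit_prod_def of_nat_prod
    by (intro prod_coprime_left prod_coprime_right) auto
qed

text \<open>Locally at every prime in \<open>P\<close>, \<^const>\<open>gen_val\<close> generates the ideal of all \<open>f\<close> vanishing at \<open>H\<close>;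
  \<^const>\<open>unit_prod\<close> is a common denominator.\<close>

lemma gen_val_quotient:
  assumes f: "ghost f" "f H = 0"
  shows "\<exists>b. ghost b \<and> (\<forall>K. subgroup K G \<longrightarrow> unit_prod * f K = gen_val K * b K)"
proof -
  \<comment> \<open>Off the class of \<open>H\<close> the quotient is forced: the units in
    \<open>gen_val K\<close> cancel against \<open>unit_prod\<close>, and the primes in
    \<open>nbrs K\<close> divide \<open>f K\<close> because \<open>f\<close> vanishes at
    \<open>H\<close>.\<close>
  define b0 where "b0 K = (\<Prod>p \<in> P - nbrs K. unit_of p) * (f K div int (\<Prod>(nbrs K)))" for K
  have conj: "b0 (conjugate g K) = b0 K" if "subgroup K G" "g \<in> carrier G" for g K
    using that by (simp add: b0_def nbrs_conjugate ghostD(1)[OF f(1)])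
  have b0: "gen_val K * b0 K = unit_prod * f K" if "K \<notin> cls" for K
  proof -
    have "int (\<Prod>(nbrs K)) dvd f K"
    proof (rule prod_primes_dvd[OF finite_nbrs])
      fix p assume "p \<in> nbrs K"
      then have p: "prime p" "K \<in> adj p" by (auto simp: nbrs_def P_def)
      then show "prime p \<and> int p dvd f K" using ghost_adj[OF f(1) p] f(2) by (simp add: cong_0_iff)
    qed
    then obtain d where d: "f K = int (\<Prod>(nbrs K)) * d" by (rule dvdE)
    have "int (\<Prod>(nbrs K)) \<noteq> 0"
      using finite_nbrs by (auto simp: nbrs_def P_def simp del: of_nat_prod)
    then have b0K: "b0 K = (\<Prod>p \<in> P - nbrs K. unit_of p) * d"
      unfolding b0_def d by (simp del: of_nat_prod)
    have u: "unit_prod = (\<Prod>p \<in> P - nbrs K. unit_of p) * (\<Prod>p \<in> nbrs K. unit_of p)"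
      unfolding unit_prod_def by (rule prod.subset_diff) (auto simp: nbrs_def finite_P)
    have g: "gen_val K = int (\<Prod>(nbrs K)) * (\<Prod>p \<in> nbrs K. unit_of p)"
      using that by (simp add: gen_val_def prod.distrib)
    show ?thesis unfolding b0K u g d by (simp only: ac_simps)
  qed
  \<comment> \<open>On the class of \<open>H\<close>, where \<open>gen_val\<close> is 0, the
    quotient is free. Its value \<open>c\<close> is chosen by the Chinese remainder theorem to match
    the neighbours, one class for each prime; \<open>nat\<close> and \<open>mod\<close> turn the
    integers into the required natural residues.\<close>
  define rep where "rep p = (SOME K. K \<in> adj p)" for p
  have rep: "rep p \<in> adj p" if "p \<in> P" for p
    using that someI_ex[of "\<lambda>K. K \<in> adj p"] by (auto simp: P_def rep_def)
  have cop: "\<forall>p \<in> P. \<forall>q \<in> P. p \<noteq> q \<longrightarrow> coprime p q"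
    by (auto simp: P_def intro: primes_coprime)
  obtain c where c: "\<forall>p \<in> P. [c = nat (b0 (rep p) mod int p)] (mod p)"
    using chinese_remainder_nat[OF finite_P cop, where u = "\<lambda>p. nat (b0 (rep p) mod int p)"] by blast
  have c': "[int c = b0 K] (mod int p)" if p: "prime p" "K \<in> adj p" for p K
  proof -
    have "p \<in> P" using adj_P p by blast
    obtain g where g: "g \<in> carrier G" "K = conjugate g (rep p)"
      using adj_conjugates[OF p(1) rep[OF \<open>p \<in> P\<close>] p(2)] by blast
    have eq: "b0 K = b0 (rep p)" unfolding g(2) by (rule conj[OF adj_subgroup[OF rep[OF \<open>p \<in> P\<close>]] g(1)])
    have "[int c = int (nat (b0 (rep p) mod int p))] (mod int p)"
      using c \<open>p \<in> P\<close> by (simp only: cong_int_iff)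
    then show ?thesis using prime_gt_0_nat[OF p(1)] by (simp add: eq)
  qed
  let ?b = "\<lambda>K. if K \<in> cls then int c else b0 K"
  have "ghost ?b"
  proof (rule ghostI)
    show "?b (conjugate g K) = ?b K" if "subgroup K G" "g \<in> carrier G" for K g
      using that by (simp add: conj cls_adj_conjugate_iff)
    fix q :: nat and K L assume q: "prime q"
    show "[?b K = ?b L] (mod int q)" if "K \<in> cls" "L \<in> adj q"
      using that c'[OF q that(2)] adj_not_cls[OF q that(2)] by simp
    assume d: "q dvd order G" and l: "linked q K L" and KL: "K \<notin> cls" "L \<notin> cls" "K \<notin> adj q" "L \<notin> adj q"
    \<comment> \<open>Here \<open>gen_val M\<close> is 1 modulo \<open>q\<close>, so
      \<open>b0\<close> inherits the congruences of \<open>f\<close>.\<close>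
    have "[b0 M = unit_prod * f M] (mod int q)" if "M \<notin> cls" "M \<notin> adj q" for M
      using cong_scalar_right[OF gen_val_cong_1[OF q d that], of "b0 M"] b0[OF that(1)] cong_sym by fastforce
    moreover have "[f K = f L] (mod int q)"
      using l ghostD(2)[OF f(1) q] cong_sym unfolding linked_def by blast
    ultimately have "[b0 K = b0 L] (mod int q)"
      using KL by (meson cong_scalar_left cong_sym cong_trans)
    then show "[?b K = ?b L] (mod int q)" using KL by simp
  qed
  moreover have "unit_prod * f K = gen_val K * ?b K" for K
    using b0[of K] ghost_cls[OF f(1), of K] f(2) by (simp add: gen_val_def)
  ultimately show ?thesis by blast
qed

end

section \<open>Periodicity over the Burnside ring\<close>

context squarefree_group
begin

interpretation A: cring "burnside_ring G"
  by (rule burnside_ring_cring[OF is_group])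

lemma ghost_const: "ghost (\<lambda>K. c)"
  by (simp add: ghost_def)

lemma ghost_element:
  assumes "ghost f"
  obtains a where "a \<in> carrier (burnside_ring G)" "\<And>K. subgroup K G \<Longrightarrow> mark G K a = f K"
  using ghost_realized[OF fin sq assms] unfolding realized_def by blast

lemma mark_module_simps:
  "carrier (mark_module G H) = UNIV" "\<zero>\<^bsub>mark_module G H\<^esub> = 0"
  "a \<odot>\<^bsub>mark_module G H\<^esub> n = mark G H a * n"
  by (simp_all add: mark_module_def)

text \<open>With \<open>m = 1\<close>, the annihilator of the generator is the kernel of the mark at
  \<open>H\<close>. Elements are obtained from ghost functions and identities are verified on
  marks.\<close>

lemma mark_module_stably_iso: "resolved_module.stably_iso (burnside_ring G) (mark_module G H) 0 2"
proof -
  interpret resolved_module "burnside_ring G" "mark_module G H"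
    by (rule resolved_module.intro[OF mark_module_module[OF is_group subgroup.subset[OF H]]])
  let ?A = "burnside_ring G"
  note marks = mark_simps[OF H] and eqI = burnside_eqI[OF fin]
  obtain x where x: "x \<in> carrier ?A" "\<And>K. subgroup K G \<Longrightarrow> mark G K x = gen_val K"
    using ghost_element[OF ghost_gen_val] by blast
  obtain y where y: "y \<in> carrier ?A" "\<And>K. subgroup K G \<Longrightarrow> mark G K y = idem_val K"
    using ghost_element[OF ghost_idem_val] by blast
  have yH: "mark G H y = int (\<Prod>P)" using y(2)[OF H] H_cls by (simp add: idem_val_def)
  have P0: "int (\<Prod>P) \<noteq> 0" using finite_P by (auto simp: P_def simp del: of_nat_prod)
  \<comment> \<open>\<open>r\<close> and \<open>t'\<close> are realized by constant marks; this
    relation says that \<open>r \<oplus> t' \<otimes> y\<close> has mark 1 at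
    \<open>H\<close>.\<close>
  obtain s t where st: "unit_prod * s + t * int (\<Prod>P) = 1"
    using unit_prod_coprime by (metis bezout_int coprime_iff_gcd_eq_1 mult.commute)
  obtain r where r: "r \<in> carrier ?A" "\<And>K. subgroup K G \<Longrightarrow> mark G K r = unit_prod * s"
    using ghost_element[OF ghost_const] by blast
  obtain t' where t': "t' \<in> carrier ?A" "\<And>K. subgroup K G \<Longrightarrow> mark G K t' = t"
    using ghost_element[OF ghost_const] by blast
  have at_cls: "mark G K a = mark G H a" if "a \<in> carrier ?A" "K \<in> cls" for a K
    using ghost_cls[OF mark_ghost[OF fin that(1)] that(2)] .
  show ?thesis
  proof (rule cyclic_stably_iso[where m = 1 and x = x and y = y and r = r and t = t'])
    show "\<exists>a \<in> carrier ?A. n = a \<odot>\<^bsub>mark_module G H\<^esub> 1" for n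
    proof -
      obtain a where "a \<in> carrier ?A" "\<And>K. subgroup K G \<Longrightarrow> mark G K a = n"
        using ghost_element[OF ghost_const] by blast
      then show ?thesis using H by (auto simp: mark_module_simps)
    qed
    show "x \<odot>\<^bsub>mark_module G H\<^esub> 1 = \<zero>\<^bsub>mark_module G H\<^esub>"
      using x(2)[OF H] H_cls by (simp add: mark_module_simps gen_val_def)
    show "(r \<oplus>\<^bsub>?A\<^esub> t' \<otimes>\<^bsub>?A\<^esub> y) \<odot>\<^bsub>mark_module G H\<^esub> 1 = 1"
      using r t' y(1) yH st H by (simp add: mark_module_simps marks)
  next
    fix a assume a: "a \<in> carrier ?A"
    show "a \<odot>\<^bsub>mark_module G H\<^esub> 1 = \<zero>\<^bsub>mark_module G H\<^esub> \<longleftrightarrow> a \<otimes>\<^bsub>?A\<^esub> y = \<zero>\<^bsub>?A\<^esub>"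
    proof
      assume "a \<odot>\<^bsub>mark_module G H\<^esub> 1 = \<zero>\<^bsub>mark_module G H\<^esub>"
      then have "mark G H a = 0" by (simp add: mark_module_simps)
      then show "a \<otimes>\<^bsub>?A\<^esub> y = \<zero>\<^bsub>?A\<^esub>"
        using a y at_cls[OF a] by (intro eqI) (auto simp: mark_simps idem_val_def)
    next
      assume "a \<otimes>\<^bsub>?A\<^esub> y = \<zero>\<^bsub>?A\<^esub>"
      then have "mark G H a * mark G H y = 0" using marks(1) marks(4)[OF a y(1)] by simp
      then show "a \<odot>\<^bsub>mark_module G H\<^esub> 1 = \<zero>\<^bsub>mark_module G H\<^esub>"
        using yH P0 by (simp add: mark_module_simps del: of_nat_prod)
    qed
  next
    fix a assume a: "a \<in> carrier ?A" and xa: "x \<otimes>\<^bsub>?A\<^esub> a = \<zero>\<^bsub>?A\<^esub>"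
    \<comment> \<open>\<open>gen_val\<close> has no zero off the class of \<open>H\<close>, so
      whatever \<open>x\<close> annihilates is supported on that class.\<close>
    have zero: "mark G K a = 0" if K: "subgroup K G" "K \<notin> cls" for K
      using mark_simps(1)[OF K(1)] mark_simps(4)[OF K(1) x(1) a] xa x(2)[OF K(1)] gen_val_nonzero[OF K(2)] by simp
    then obtain d where d: "mark G H a = int (\<Prod>P) * d"
      using idem_val_divides[OF mark_ghost[OF fin a]] by (auto elim: dvdE)
    obtain b where b: "b \<in> carrier ?A" "\<And>K. subgroup K G \<Longrightarrow> mark G K b = d"
      using ghost_element[OF ghost_const] by blast
    have "a = b \<otimes>\<^bsub>?A\<^esub> y"
    proof (rule eqI)
      fix K assume K: "subgroup K G"
      show "mark G K a = mark G K (b \<otimes>\<^bsub>?A\<^esub> y)"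
        using zero[OF K] at_cls[OF a, of K] d
        by (simp add: mark_simps(4)[OF K b(1) y(1)] b(2)[OF K] y(2)[OF K] idem_val_def)
    qed (use a b y in auto)
    then show "\<exists>b \<in> carrier ?A. a = b \<otimes>\<^bsub>?A\<^esub> y" using b(1) by blast
  next
    fix a assume a: "a \<in> carrier ?A" and "a \<odot>\<^bsub>mark_module G H\<^esub> 1 = \<zero>\<^bsub>mark_module G H\<^esub>"
    then have "mark G H a = 0" by (simp add: mark_module_simps)
    then obtain f where f: "ghost f" "\<And>K. subgroup K G \<Longrightarrow> unit_prod * mark G K a = gen_val K * f K"
      using gen_val_quotient[OF mark_ghost[OF fin a]] by blast
    \<comment> \<open>This is \<open>s\<close> times \<open>f\<close>, written in the form that
      \<open>ghost_diff_mult\<close> offers.\<close>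
    have "ghost (\<lambda>K. 0 - (- s) * f K)" by (rule ghost_diff_mult[OF ghost_const f(1)])
    then obtain b where b: "b \<in> carrier ?A" "\<And>K. subgroup K G \<Longrightarrow> mark G K b = 0 - (- s) * f K"
      using ghost_element by blast
    have "r \<otimes>\<^bsub>?A\<^esub> a = x \<otimes>\<^bsub>?A\<^esub> b"
    proof (rule eqI)
      fix K assume K: "subgroup K G"
      show "mark G K (r \<otimes>\<^bsub>?A\<^esub> a) = mark G K (x \<otimes>\<^bsub>?A\<^esub> b)"
        using f(2)[OF K]
        by (simp add: mark_simps(4)[OF K r(1) a] mark_simps(4)[OF K x(1) b(1)] r(2)[OF K] x(2)[OF K] b(2)[OF K]
            mult.assoc mult.left_commute[of _ s])
    qed (use a b r x in auto)
    then show "\<exists>b \<in> carrier ?A. r \<otimes>\<^bsub>?A\<^esub> a = x \<otimes>\<^bsub>?A\<^esub> b" using b(1) by blast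
  qed (use x y r t' in \<open>auto simp: mark_module_simps\<close>)
qed

end

theorem theorem20:
  fixes G :: "('g, 'k) monoid_scheme" and H J :: "'g set" and l :: nat
  assumes "Group.group G" and "finite (carrier G)" and "squarefree (Coset.order G)"
    and "subgroup H G" and "subgroup J G" and "l \<ge> 1"
  shows "module_iso (burnside_ring G)
    (Ext (burnside_ring G) l (mark_module G H) (mark_module G J))
    (Ext (burnside_ring G) (l + 2) (mark_module G H) (mark_module G J))"
proof -
  interpret squarefree_group G H
    by (intro squarefree_group.intro squarefree_group_axioms.intro assms(1-4))
  interpret resolved_module "burnside_ring G" "mark_module G H"
    by (rule resolved_module.intro[OF mark_module_module[OF assms(1) subgroup.subset[OF assms(4)]]])
  show ?thesis
    by (rule stably_iso_imp_Ext_periodic[OF mark_module_stably_iso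
          mark_module_module[OF assms(1) subgroup.subset[OF assms(5)]] assms(6)])
qed

end
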